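(* Let $H$ be a subgroup of $\mathcal D_q=\mathrm{Diff}(\mathbb K^q,0)$ such that its Lie algebra $LH$ is a $C_q$-submodule of $\theta_q$ which is closed with respect to integration. Let $\Omega_0,\Omega_1$ be germs of volume forms on $(\mathbb K^q,0)$; if $\mathbb K=\mathbb R$ assume also that $\Omega_0$ and $\Omega_1$ define the same orientation. Then $\Omega_0$ and $\Omega_1$ are $LH$-equivalent if and only if $\Omega_0$ and $\Omega_1$ are $H$-isotopic.
   Context: $\mathbb K=\mathbb C$ or $\mathbb R$; "smooth" means complex-analytic if $\mathbb K=\mathbb C$ and $C^\infty$ or real-analytic if $\mathbb K=\mathbb R$. $C_q$ is the ring of smooth function germs on $(\mathbb K^q,0)$, $\theta_q$ the $C_q$-module of germs of smooth vector fields on $(\mathbb K^q,0)$, and $\mathcal D_q=\mathrm{Diff}(\mathbb K^q,0)$ the group of origin-preserving diffeomorphism germs. $LH$ is the Lie algebra of $H\subset\mathcal D_q$, consisting of vector fields vanishing at $0$; it is understood in the usual sense that smooth families $\Phi_t\in H$ ($t\in[0,1]$, $\Phi_0=\mathrm{Id}$) are exactly the solutions of $\frac{d}{dt}\Phi_t=X_t\circ\Phi_t$, $\Phi_0=\mathrm{Id}$, with $X_t\in LH$ a smooth family. $LH$ is closed with respect to integration if for every smooth family $X_t\in LH$, $t\in[0,1]$, the integral $\int_0^1X_t\,dt$ belongs to $LH$. Two volume forms $\Omega_0,\Omega_1$ are $H$-isotopic if there is a smooth family $\Phi_t\in H$, $t\in[0,1]$, with $\Phi_0=\mathrm{Id}$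 and $\Phi_1^*\Omega_1=\Omega_0$. For a $C_q$-module $M\subset LH$, they are $M$-equivalent if there is $X\in M$ with $\Omega_0-\Omega_1=d(X\rfloor\Omega)$, where $\Omega$ is a volume form (the notion does not depend on the choice of $\Omega$) and $\rfloor$ denotes contraction. *)

theory Defs
  imports "HOL-Analysis.Analysis"
begin

text \<open>
  Throughout, \<open>'k\<close> is the ground field (it is used only with \<open>'k = real\<close> and \<open>'k = complex\<close>)
  and \<open>'q\<close> is a finite index type, so that \<open>'k^'q\<close> is $\mathbb{K}^q$ with $q$ = \<open>CARD('q)\<close>.

  A germ at the origin is handled through its representatives, which are total functions whose
  values away from the origin are irrelevant.  A set of germs is accordingly a set of functions
  that is saturated for equality near the origin.
\<close>

definition germ_eq :: "('a::{zero,topological_space} \<Rightarrow> 'b) \<Rightarrow> ('a \<Rightarrow> 'b) \<Rightarrow> bool"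
  (infix "\<simeq>" 50)
  where "f \<simeq> g \<longleftrightarrow> (\<forall>\<^sub>F x in nhds 0. f x = g x)"

definition germ_saturated :: "('a::{zero,topological_space} \<Rightarrow> 'b) set \<Rightarrow> bool"
  where "germ_saturated S \<longleftrightarrow> (\<forall>f g. f \<in> S \<longrightarrow> f \<simeq> g \<longrightarrow> g \<in> S)"


section \<open>Smooth functions, vector fields and diffeomorphisms\<close>

text \<open>
  The three meanings of ``smooth'' are \<open>Analytic\<close> over \<open>complex\<close>, \<open>Cinf\<close> over \<open>real\<close> and
  \<open>Analytic\<close> over \<open>real\<close>.
\<close>

datatype regularity = Analytic | Cinf

text \<open>
  Expansion in a convergent power series with coefficients in \<open>'k\<close>, summed over all
  multi-indices.
\<close>

definition analytic_at :: "'k::real_normed_field^'m \<Rightarrow> ('k^'m \<Rightarrow> 'k) \<Rightarrow> bool"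
  where "analytic_at a f \<longleftrightarrow>
    (\<exists>c :: ('m \<Rightarrow> nat) \<Rightarrow> 'k. \<exists>r>0. \<forall>x\<in>ball a r.
       ((\<lambda>\<alpha>. c \<alpha> * (\<Prod>i\<in>UNIV. (x $ i - a $ i) ^ \<alpha> i)) has_sum f x) UNIV)"

text \<open>To be used on open sets only.\<close>

primrec Ck_on :: "nat \<Rightarrow> 'a::real_normed_vector set \<Rightarrow> ('a \<Rightarrow> 'b::real_normed_vector) \<Rightarrow> bool"
  where
    "Ck_on 0 U f \<longleftrightarrow> continuous_on U f"
  | "Ck_on (Suc n) U f \<longleftrightarrow>
       f differentiable_on U \<and> (\<forall>v. Ck_on n U (\<lambda>x. frechet_derivative f (at x) v))"

fun smooth_on :: "regularity \<Rightarrow> ('k::real_normed_field^'m) set \<Rightarrow> ('k^'m \<Rightarrow> 'k) \<Rightarrow> bool"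
  where
    "smooth_on Analytic U f \<longleftrightarrow> (\<forall>a\<in>U. analytic_at a f)"
  | "smooth_on Cinf U f \<longleftrightarrow> (\<forall>n. Ck_on n U f)"

definition smooth_germs :: "regularity \<Rightarrow> ('k::real_normed_field^'q \<Rightarrow> 'k) set"
  where "smooth_germs r = {f. \<exists>U. open U \<and> 0 \<in> U \<and> smooth_on r U f}"

text \<open>
  Since the tangent spaces of \<open>'k^'q\<close> are identified with \<open>'k^'q\<close>, vector fields are maps
  \<open>'k^'q \<Rightarrow> 'k^'q\<close>.
\<close>

definition vector_fields :: "regularity \<Rightarrow> ('k::real_normed_field^'q \<Rightarrow> 'k^'q) set"
  where "vector_fields r = {X. \<forall>j. (\<lambda>x. X x $ j) \<in> smooth_germs r}"

definition Diff0 :: "regularity \<Rightarrow> ('k::real_normed_field^'q \<Rightarrow> 'k^'q) set"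
  where "Diff0 r = {\<Phi>. \<Phi> 0 = 0 \<and> (\<forall>j. (\<lambda>x. \<Phi> x $ j) \<in> smooth_germs r) \<and>
    (\<exists>\<Psi>. \<Psi> 0 = 0 \<and> (\<forall>j. (\<lambda>x. \<Psi> x $ j) \<in> smooth_germs r) \<and>
         \<Psi> \<circ> \<Phi> \<simeq> id \<and> \<Phi> \<circ> \<Psi> \<simeq> id)}"

definition subgroup_of_Diff0 ::
    "regularity \<Rightarrow> ('k::real_normed_field^'q \<Rightarrow> 'k^'q) set \<Rightarrow> bool"
  where "subgroup_of_Diff0 r H \<longleftrightarrow>
    H \<subseteq> Diff0 r \<and> germ_saturated H \<and> id \<in> H \<and>
    (\<forall>\<Phi>\<in>H. \<forall>\<Psi>\<in>H. \<Phi> \<circ> \<Psi> \<in> H) \<and>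
    (\<forall>\<Phi>\<in>H. \<forall>\<Psi>\<in>Diff0 r. \<Phi> \<circ> \<Psi> \<simeq> id \<longrightarrow> \<Psi> \<in> H)"

definition submodule_of_vector_fields ::
    "regularity \<Rightarrow> ('k::real_normed_field^'q \<Rightarrow> 'k^'q) set \<Rightarrow> bool"
  where "submodule_of_vector_fields r M \<longleftrightarrow>
    M \<subseteq> vector_fields r \<and> germ_saturated M \<and> (\<lambda>x. 0) \<in> M \<and>
    (\<forall>X\<in>M. \<forall>Y\<in>M. (\<lambda>x. X x + Y x) \<in> M) \<and>
    (\<forall>f\<in>smooth_germs r. \<forall>X\<in>M. (\<lambda>x. f x *s X x) \<in> M)"


section \<open>Smooth families and the Lie algebra of a group of diffeomorphism germs\<close>

text \<open>
  A point of $\mathbb{K} \times \mathbb{K}^q$, seen as a point of $\mathbb{K}^{1+q}$.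
\<close>

definition time_space :: "'k \<Rightarrow> 'k^'q \<Rightarrow> 'k^('q option)"
  where "time_space t x = (\<chi> i. case i of None \<Rightarrow> t | Some j \<Rightarrow> x $ j)"

text \<open>
  A family of germs $F_t$, $t \in [0,1]$, is smooth if, over some neighbourhood of the origin
  which does not depend on $t$, it is the restriction of a map that is smooth jointly in time and
  space on a neighbourhood of $[0,1] \times \{0\}$ in $\mathbb{K} \times \mathbb{K}^q$.
  The values $F_t$ for $t \notin [0,1]$ are irrelevant.
\<close>

definition smooth_family ::
    "regularity \<Rightarrow> (real \<Rightarrow> 'k::real_normed_field^'q \<Rightarrow> 'k^'q) \<Rightarrow> bool"
  where "smooth_family r F \<longleftrightarrow>
    (\<exists>T U. \<exists>G :: 'k^('q option) \<Rightarrow> 'k^'q.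
       open T \<and> of_real ` {0..1} \<subseteq> T \<and> open U \<and> 0 \<in> U \<and>
       (\<forall>j. smooth_on r {time_space s x | s x. s \<in> T \<and> x \<in> U} (\<lambda>z. G z $ j)) \<and>
       (\<forall>t\<in>{0..1}. \<forall>x\<in>U. F t x = G (time_space (of_real t) x)))"

text \<open>The germ equation $\frac{d}{dt}\Phi_t = X_t \circ \Phi_t$ on $[0,1]$.\<close>

definition generates ::
    "(real \<Rightarrow> 'k::real_normed_field^'q \<Rightarrow> 'k^'q) \<Rightarrow> (real \<Rightarrow> 'k^'q \<Rightarrow> 'k^'q) \<Rightarrow> bool"
  where "generates X \<Phi> \<longleftrightarrow>
    (\<forall>\<^sub>F x in nhds 0. \<forall>t\<in>{0..1}.
       ((\<lambda>s. \<Phi> s x) has_vector_derivative X t (\<Phi> t x)) (at t within {0..1}))"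

text \<open>
  \<open>L\<close> is the Lie algebra of \<open>H\<close>: it consists of vector fields vanishing at the origin, and the
  smooth families in \<open>H\<close> starting at the identity are exactly the solutions of
  $\frac{d}{dt}\Phi_t = X_t \circ \Phi_t$, $\Phi_0 = \mathrm{Id}$, with \<open>X\<close> a smooth family in
  \<open>L\<close>.  Solvability of this initial value problem is not part of the definition.
\<close>

definition is_Lie_algebra_of ::
    "regularity \<Rightarrow> ('k::real_normed_field^'q \<Rightarrow> 'k^'q) set \<Rightarrow> ('k^'q \<Rightarrow> 'k^'q) set \<Rightarrow> bool"
  where "is_Lie_algebra_of r L H \<longleftrightarrow>
    L \<subseteq> {X \<in> vector_fields r. X 0 = 0} \<and>
    {\<Phi>. smooth_family r \<Phi> \<and> (\<forall>t\<in>{0..1}. \<Phi> t \<in> H) \<and> \<Phi> 0 \<simeq> id} =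
    {\<Phi>. \<Phi> 0 \<simeq> id \<and> (\<exists>X. smooth_family r X \<and> (\<forall>t\<in>{0..1}. X t \<in> L) \<and> generates X \<Phi>)}"

definition closed_under_integration ::
    "regularity \<Rightarrow> ('k::real_normed_field^'q \<Rightarrow> 'k^'q) set \<Rightarrow> bool"
  where "closed_under_integration r L \<longleftrightarrow>
    (\<forall>X. smooth_family r X \<and> (\<forall>t\<in>{0..1}. X t \<in> L) \<longrightarrow>
       (\<lambda>x. integral {0..1} (\<lambda>t. X t x)) \<in> L)"


section \<open>Differential forms\<close>

text \<open>
  A differential form of degree $k$ is evaluated at a point and at a list of $k$ tangent vectors;
  its values on lists of any other length are irrelevant.
\<close>

definition alternating_multilinear :: "nat \<Rightarrow> (('k::field^'q) list \<Rightarrow> 'k) \<Rightarrow> bool"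
  where "alternating_multilinear k \<omega> \<longleftrightarrow>
    (\<forall>vs. length vs = k \<longrightarrow>
      (\<forall>i<k. Vector_Spaces.linear (*s) (*) (\<lambda>v. \<omega> (vs[i := v]))) \<and>
      (\<forall>i<k. \<forall>j<k. i \<noteq> j \<and> vs ! i = vs ! j \<longrightarrow> \<omega> vs = 0))"

definition volume_form ::
    "regularity \<Rightarrow> ('k::real_normed_field^'q \<Rightarrow> ('k^'q) list \<Rightarrow> 'k) \<Rightarrow> bool"
  where "volume_form r \<Omega> \<longleftrightarrow>
    (\<exists>U. open U \<and> 0 \<in> U \<and>
      (\<forall>x\<in>U. alternating_multilinear CARD('q) (\<Omega> x) \<and>
             (\<exists>vs. length vs = CARD('q) \<and> \<Omega> x vs \<noteq> 0)) \<and>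
      (\<forall>vs. length vs = CARD('q) \<longrightarrow> smooth_on r U (\<lambda>x. \<Omega> x vs)))"

definition contraction ::
    "('k^'q \<Rightarrow> 'k^'q) \<Rightarrow> ('k^'q \<Rightarrow> ('k^'q) list \<Rightarrow> 'k) \<Rightarrow> ('k^'q \<Rightarrow> ('k^'q) list \<Rightarrow> 'k)"
  (infixr "\<rfloor>" 75)
  where "X \<rfloor> \<omega> = (\<lambda>x vs. \<omega> x (X x # vs))"

text \<open>
  $(d\omega)_x(v_0,\dots,v_k) =
     \sum_i (-1)^i D_{v_i}\bigl(\omega(v_0,\dots,\widehat{v_i},\dots,v_k)\bigr)(x)$.
  Over \<open>complex\<close> the real derivative \<open>frechet_derivative\<close> of a holomorphic map is its complex
  derivative.
\<close>

definition exterior_derivative ::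
    "('k::real_normed_field^'q \<Rightarrow> ('k^'q) list \<Rightarrow> 'k) \<Rightarrow> ('k^'q \<Rightarrow> ('k^'q) list \<Rightarrow> 'k)"
  where "exterior_derivative \<omega> = (\<lambda>x vs. \<Sum>i<length vs.
    (- 1) ^ i * frechet_derivative (\<lambda>y. \<omega> y (take i vs @ drop (Suc i) vs)) (at x) (vs ! i))"

definition pullback ::
    "('k::real_normed_field^'q \<Rightarrow> 'k^'q) \<Rightarrow> ('k^'q \<Rightarrow> ('k^'q) list \<Rightarrow> 'k) \<Rightarrow>
     ('k^'q \<Rightarrow> ('k^'q) list \<Rightarrow> 'k)"
  where "pullback \<Phi> \<omega> = (\<lambda>x vs. \<omega> (\<Phi> x) (map (frechet_derivative \<Phi> (at x)) vs))"

text \<open>Equality of germs of forms of top degree.\<close>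

definition top_form_eq ::
    "('k::real_normed_field^'q \<Rightarrow> ('k^'q) list \<Rightarrow> 'k) \<Rightarrow> ('k^'q \<Rightarrow> ('k^'q) list \<Rightarrow> 'k) \<Rightarrow> bool"
  where "top_form_eq \<omega> \<eta> \<longleftrightarrow>
    (\<forall>\<^sub>F x in nhds 0. \<forall>vs. length vs = CARD('q) \<longrightarrow> \<omega> x vs = \<eta> x vs)"

text \<open>The same frames at the origin are positively oriented.\<close>

definition same_orientation ::
    "(real^'q \<Rightarrow> (real^'q) list \<Rightarrow> real) \<Rightarrow> (real^'q \<Rightarrow> (real^'q) list \<Rightarrow> real) \<Rightarrow> bool"
  where "same_orientation \<Omega>0 \<Omega>1 \<longleftrightarrow>
    (\<forall>vs. length vs = CARD('q) \<longrightarrow> (\<Omega>0 0 vs > 0 \<longleftrightarrow> \<Omega>1 0 vs > 0))"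

definition isotopic ::
    "regularity \<Rightarrow> ('k::real_normed_field^'q \<Rightarrow> 'k^'q) set \<Rightarrow>
     ('k^'q \<Rightarrow> ('k^'q) list \<Rightarrow> 'k) \<Rightarrow> ('k^'q \<Rightarrow> ('k^'q) list \<Rightarrow> 'k) \<Rightarrow> bool"
  where "isotopic r H \<Omega>0 \<Omega>1 \<longleftrightarrow>
    (\<exists>\<Phi>. smooth_family r \<Phi> \<and> (\<forall>t\<in>{0..1}. \<Phi> t \<in> H) \<and> \<Phi> 0 \<simeq> id \<and>
         top_form_eq (pullback (\<Phi> 1) \<Omega>1) \<Omega>0)"

text \<open>
  The reference volume form \<open>\<Omega>\<close> is an explicit argument; the notion does not depend on it when
  \<open>M\<close> is a module.
\<close>

definition module_equivalent ::
    "('k::real_normed_field^'q \<Rightarrow> ('k^'q) list \<Rightarrow> 'k) \<Rightarrow> ('k^'q \<Rightarrow> 'k^'q) set \<Rightarrow>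
     ('k^'q \<Rightarrow> ('k^'q) list \<Rightarrow> 'k) \<Rightarrow> ('k^'q \<Rightarrow> ('k^'q) list \<Rightarrow> 'k) \<Rightarrow> bool"
  where "module_equivalent \<Omega> M \<Omega>0 \<Omega>1 \<longleftrightarrow>
    (\<exists>X\<in>M. top_form_eq (\<lambda>x vs. \<Omega>0 x vs - \<Omega>1 x vs) (exterior_derivative (X \<rfloor> \<Omega>)))"

end

theory Submission
  imports Defs
begin

text \<open>
  The proof is Moser's path method.  A top-degree form is a function, its density, times the
  determinant, and if \<open>w\<close> is the density of \<open>\<Omega>\<close> then $d(X \rfloor \Omega)$ has
  density $\mathrm{div}(wX)$ (\<open>exterior_derivative_contraction\<close>).  With \<open>a\<close> and \<open>b\<close> the densities
  of \<open>\<Omega>0\<close> and \<open>\<Omega>1\<close>, equivalence says that $a - b = \mathrm{div}(wX)$ for some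
  \<open>X\<close> in \<open>LH\<close>, and isotopy says that $(b \circ \Phi_1) \det D\Phi_1 = a$ for some family in \<open>H\<close>
  that starts at the identity.

  An isotopy gives an equivalence (\<open>isotopic_imp_module_equivalent\<close>): put
  $Y_t = (D\Phi_t)^{-1} \partial_t \Phi_t$.  The transported density
  $F_t = (b \circ \Phi_t) \det D\Phi_t$ satisfies $\partial_t F_t = \mathrm{div}(F_t Y_t)$
  (\<open>transported_density_time_derivative\<close>), so that
  $a - b = \mathrm{div}(wX)$ with $X = \int_0^1 w^{-1} F_t Y_t\,dt$.  Since \<open>LH\<close> is a module that is closed
  under integration, it remains to see that $Y_t \in LH$.  For fixed $t$ the family
  $s \mapsto \Phi_t^{-1} \circ \Phi_{t + s\delta}$ lies in \<open>H\<close> and starts at the identity, and the field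
  that generates it is $\delta Y_t$ at $s = 0$ (\<open>logarithmic_derivative_in_Lie_algebra\<close>).  Only the inverse
  of the single germ $\Phi_t$ enters here, and it is smooth because $\Phi_t$ is a diffeomorphism germ.

  An equivalence gives an isotopy (\<open>module_equivalent_imp_isotopic\<close>): join the densities by
  $f_t = a + h(t)(b - a)$, where $h$ runs from $0$ to $1$ and $f_t(0) \neq 0$ throughout.  The field
  $Z_t = h'(t) f_t^{-1} w X$ is in \<open>LH\<close> and satisfies the continuity equation
  $\partial_t f_t + \mathrm{div}(f_t Z_t) = 0$, so $(f_t \circ \Phi_t) \det D\Phi_t$ is constant in time along
  its flow $\Phi$ (Liouville's formula, \<open>liouville_formula\<close>), which for $t = 0$ and $t = 1$ is the claim.
  As $Z_t$ vanishes at the origin, its flow exists up to time $1$ near the origin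
  (\<open>flow_of_vanishing_field\<close>), and because \<open>LH\<close> is the Lie algebra of \<open>H\<close> this flow is a smooth
  family in \<open>H\<close>.  Over the reals equal orientation permits $h(t) = t$.  Over the complex numbers the
  segment from $a(0)$ to $b(0)$ may contain $0$, and then $h(t) = t + i\,t(1-t)$ goes around it.

  The three meanings of smoothness are treated together: the locale \<open>smooth_category\<close> collects the
  closure under algebra, reciprocals, composition and partial differentiation on which everything
  else is built.  In the analytic cases these come from the algebra of absolutely convergent
  power series, over the reals and the complex numbers at once.
\<close>

section \<open>Algebra of absolutely convergent power series\<close>

definition monomial_at :: "'k::real_normed_field^'m \<Rightarrow> ('m \<Rightarrow> nat) \<Rightarrow> 'k^'m \<Rightarrow> 'k"
  where "monomial_at a \<alpha> x = (\<Prod>i\<in>UNIV. (x $ i - a $ i) ^ \<alpha> i)"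

definition total_degree :: "('m::finite \<Rightarrow> nat) \<Rightarrow> nat"
  where "total_degree \<alpha> = (\<Sum>i\<in>UNIV. \<alpha> i)"

definition polydisc :: "'k::real_normed_field^'m \<Rightarrow> real \<Rightarrow> ('k^'m) set"
  where "polydisc a \<rho> = {x. \<forall>i. norm (x $ i - a $ i) \<le> \<rho>}"

text \<open>
  The power series algebra on a polydisc: \<open>M\<close> bounds the $\ell^1$ norm of the coefficients, weighted by the
  powers of \<open>\<rho>\<close>.  This norm is submultiplicative and complete, which is what products, reciprocals and
  compositions need.
\<close>

definition expands :: "'k::real_normed_field^'m \<Rightarrow> real \<Rightarrow> real \<Rightarrow> ('k^'m \<Rightarrow> 'k) \<Rightarrow> bool"
  where "expands a \<rho> M f \<longleftrightarrow> (\<exists>c. (\<lambda>\<alpha>. norm (c \<alpha>) * \<rho> ^ total_degree \<alpha>) summable_on UNIV \<and>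
     (\<Sum>\<^sub>\<infinity>\<alpha>. norm (c \<alpha>) * \<rho> ^ total_degree \<alpha>) \<le> M \<and>
     (\<forall>x\<in>polydisc a \<rho>. ((\<lambda>\<alpha>. c \<alpha> * monomial_at a \<alpha> x) has_sum f x) UNIV))"

lemma monomial_at_bound:
  assumes "x \<in> polydisc a \<rho>"
  shows "norm (monomial_at a \<alpha> x) \<le> \<rho> ^ total_degree \<alpha>"
proof -
  have "norm (monomial_at a \<alpha> x) = (\<Prod>i\<in>UNIV. norm (x $ i - a $ i) ^ \<alpha> i)"
    by (simp add: monomial_at_def norm_power flip: prod_norm)
  also have "\<dots> \<le> (\<Prod>i\<in>UNIV. \<rho> ^ \<alpha> i)"
    using assms by (intro prod_mono) (auto simp: polydisc_def intro!: power_mono)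
  finally show ?thesis
    by (simp add: total_degree_def power_sum)
qed

lemma monomial_at_add: "monomial_at a (\<lambda>i. \<alpha> i + \<beta> i) x = monomial_at a \<alpha> x * monomial_at a \<beta> x"
  by (simp add: monomial_at_def power_add prod.distrib)

lemma total_degree_add: "total_degree (\<lambda>i. \<alpha> i + \<beta> i) = total_degree \<alpha> + total_degree \<beta>"
  by (simp add: total_degree_def sum.distrib)

lemma polydisc_mono: "\<sigma> \<le> \<rho> \<Longrightarrow> polydisc a \<sigma> \<subseteq> polydisc a \<rho>"
  by (auto simp: polydisc_def intro: order_trans)

lemma has_sum_in_fibres:
  fixes f :: "'i \<Rightarrow> 'a::{topological_comm_monoid_add,t3_space}"
  assumes "(f has_sum s) I" and "\<And>j. (f has_sum g j) {i\<in>I. E i = j}"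
  shows "(g has_sum s) UNIV"
proof -
  have inj: "inj_on snd (Sigma UNIV (\<lambda>j. {i\<in>I. E i = j}))"
    by (auto simp: inj_on_def)
  have img: "snd ` (Sigma UNIV (\<lambda>j. {i\<in>I. E i = j})) = I"
    by force
  have "((f \<circ> snd) has_sum s) (Sigma UNIV (\<lambda>j. {i\<in>I. E i = j}))"
    using has_sum_reindex[OF inj, of f s] assms(1) by (simp add: img)
  then show ?thesis
    by (rule has_sum_SigmaD) (use assms(2) in auto)
qed

text \<open>
  The workhorse of this part.  Terms of an absolutely convergent family that have the same exponent may be
  collected into one coefficient, and by the triangle inequality the weighted norm does not increase.
  Products, infinite sums and termwise derivatives of power series all arise as such families, indexed by
  something else than multi-indices.
\<close>

lemma expands_regroup:
  fixes C :: "'i \<Rightarrow> 'k::{real_normed_field,banach}" and E :: "'i \<Rightarrow> 'm::finite \<Rightarrow> nat"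
  assumes rho: "0 < \<rho>"
    and S: "(\<lambda>i. norm (C i) * \<rho> ^ total_degree (E i)) summable_on I"
    and M: "(\<Sum>\<^sub>\<infinity>i\<in>I. norm (C i) * \<rho> ^ total_degree (E i)) \<le> M"
    and f: "\<And>x. x \<in> polydisc a \<rho> \<Longrightarrow> ((\<lambda>i. C i * monomial_at a (E i) x) has_sum f x) I"
  shows "expands a \<rho> M f"
proof -
  define F where "F \<gamma> = {i\<in>I. E i = \<gamma>}" for \<gamma>
  define c where "c \<gamma> = infsum C (F \<gamma>)" for \<gamma>
  define N where "N i = norm (C i) * \<rho> ^ total_degree (E i)" for i
  define n where "n \<gamma> = infsum N (F \<gamma>)" for \<gamma>
  have Nsum: "N summable_on F \<gamma>" for \<gamma>
    using S unfolding N_def F_def by (rule summable_on_subset_banach) auto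
  have Nhas: "(N has_sum infsum N I) I"
    using S by (simp add: N_def[abs_def] summable_iff_has_sum_infsum)
  have nhas: "(n has_sum infsum N I) UNIV"
    by (rule has_sum_in_fibres[OF Nhas, where E=E]) (use Nsum in \<open>simp add: n_def F_def\<close>)
  have Cabs: "(\<lambda>i. norm (C i)) summable_on F \<gamma>" for \<gamma>
  proof -
    have "(\<lambda>i. N i * inverse (\<rho> ^ total_degree \<gamma>)) summable_on F \<gamma>"
      by (intro summable_on_cmult_left Nsum)
    moreover have "N i * inverse (\<rho> ^ total_degree \<gamma>) = norm (C i)" if "i \<in> F \<gamma>" for i
      using that rho by (auto simp: N_def F_def)
    ultimately show ?thesis
      by (metis (no_types, lifting) summable_on_cong)
  qed
  have Chas: "(C has_sum c \<gamma>) (F \<gamma>)" for \<gamma>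
    using Cabs abs_summable_summable by (auto simp: c_def summable_iff_has_sum_infsum)
  have cn: "norm (c \<gamma>) * \<rho> ^ total_degree \<gamma> \<le> n \<gamma>" for \<gamma>
  proof -
    have "n \<gamma> = infsum (\<lambda>i. norm (C i) * \<rho> ^ total_degree \<gamma>) (F \<gamma>)"
      unfolding n_def by (rule infsum_cong) (auto simp: N_def F_def)
    also have "\<dots> = infsum (\<lambda>i. norm (C i)) (F \<gamma>) * \<rho> ^ total_degree \<gamma>"
      using Cabs by (intro infsum_cmult_left) auto
    finally show ?thesis
      using norm_infsum_bound[OF Cabs] rho by (simp add: c_def mult_right_mono)
  qed
  have nsum: "n summable_on UNIV"
    using nhas summable_on_def by blast
  have csum: "(\<lambda>\<gamma>. norm (c \<gamma>) * \<rho> ^ total_degree \<gamma>) summable_on UNIV"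
    by (rule summable_on_comparison_test[OF nsum]) (use cn rho in auto)
  moreover have "(\<Sum>\<^sub>\<infinity>\<gamma>. norm (c \<gamma>) * \<rho> ^ total_degree \<gamma>) \<le> M"
  proof -
    have "(\<Sum>\<^sub>\<infinity>\<gamma>. norm (c \<gamma>) * \<rho> ^ total_degree \<gamma>) \<le> infsum n UNIV"
      by (rule infsum_mono[OF csum nsum]) (use cn in auto)
    also have "\<dots> = infsum N I"
      using nhas by (rule infsumI)
    finally show ?thesis
      using M by (simp add: N_def[abs_def])
  qed
  moreover have "((\<lambda>\<gamma>. c \<gamma> * monomial_at a \<gamma> x) has_sum f x) UNIV" if "x \<in> polydisc a \<rho>" for x
  proof (rule has_sum_in_fibres[OF f[OF that], where E=E])
    fix \<gamma>
    have "((\<lambda>i. C i * monomial_at a \<gamma> x) has_sum c \<gamma> * monomial_at a \<gamma> x) (F \<gamma>)"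
      by (intro has_sum_cmult_left Chas)
    then show "((\<lambda>i. C i * monomial_at a (E i) x) has_sum c \<gamma> * monomial_at a \<gamma> x) {i \<in> I. E i = \<gamma>}"
      unfolding F_def by (rule has_sum_cong[THEN iffD1, rotated]) auto
  qed
  ultimately show ?thesis
    unfolding expands_def by blast
qed

lemma abs_summable_coefficients:
  fixes C :: "'i \<Rightarrow> 'k::{real_normed_field,banach}"
  assumes "(\<lambda>i. norm (C i) * \<rho> ^ total_degree (E i)) summable_on I" "x \<in> polydisc a \<rho>"
  shows "(\<lambda>i. norm (C i * monomial_at a (E i) x)) summable_on I"
proof (rule summable_on_comparison_test[OF assms(1)])
  fix i
  show "norm (C i * monomial_at a (E i) x) \<le> norm (C i) * \<rho> ^ total_degree (E i)"
    using monomial_at_bound[OF assms(2)] by (auto simp: norm_mult intro: mult_left_mono)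
qed auto

lemma expands_nonneg:
  assumes "expands a \<rho> M f" "0 \<le> \<rho>" shows "0 \<le> M"
proof -
  obtain c where c: "(\<Sum>\<^sub>\<infinity>\<alpha>. norm (c \<alpha>) * \<rho> ^ total_degree \<alpha>) \<le> M"
    "\<forall>x\<in>polydisc a \<rho>. ((\<lambda>\<alpha>. c \<alpha> * monomial_at a \<alpha> x) has_sum f x) UNIV"
    using assms(1) unfolding expands_def by blast
  have "0 \<le> (\<Sum>\<^sub>\<infinity>\<alpha>. norm (c \<alpha>) * \<rho> ^ total_degree \<alpha>)"
    using assms(2) by (intro infsum_nonneg) auto
  with c(1) show ?thesis by linarith
qed

lemma expands_norm:
  fixes f :: "'k::{real_normed_field,banach}^'m \<Rightarrow> 'k"
  assumes "expands a \<rho> M f" "x \<in> polydisc a \<rho>" shows "norm (f x) \<le> M"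
proof -
  obtain c where c: "(\<lambda>\<alpha>. norm (c \<alpha>) * \<rho> ^ total_degree \<alpha>) summable_on UNIV"
    "(\<Sum>\<^sub>\<infinity>\<alpha>. norm (c \<alpha>) * \<rho> ^ total_degree \<alpha>) \<le> M"
    "((\<lambda>\<alpha>. c \<alpha> * monomial_at a \<alpha> x) has_sum f x) UNIV"
    using assms unfolding expands_def by blast
  have abs: "(\<lambda>\<alpha>. norm (c \<alpha> * monomial_at a \<alpha> x)) summable_on UNIV"
    using abs_summable_coefficients[OF c(1) assms(2)] .
  have "norm (f x) \<le> (\<Sum>\<^sub>\<infinity>\<alpha>. norm (c \<alpha> * monomial_at a \<alpha> x))"
    using norm_infsum_bound[OF abs] infsumI[OF c(3)] by simp
  also have "\<dots> \<le> (\<Sum>\<^sub>\<infinity>\<alpha>. norm (c \<alpha>) * \<rho> ^ total_degree \<alpha>)"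
    by (rule infsum_mono[OF abs c(1)])
       (use monomial_at_bound[OF assms(2)] in \<open>auto simp: norm_mult intro: mult_left_mono\<close>)
  finally show ?thesis using c(2) by linarith
qed

lemma expands_cong:
  assumes "expands a \<rho> M f" "\<And>x. x \<in> polydisc a \<rho> \<Longrightarrow> f x = g x"
  shows "expands a \<rho> M g"
proof -
  obtain c where "(\<lambda>\<alpha>. norm (c \<alpha>) * \<rho> ^ total_degree \<alpha>) summable_on UNIV"
    "(\<Sum>\<^sub>\<infinity>\<alpha>. norm (c \<alpha>) * \<rho> ^ total_degree \<alpha>) \<le> M"
    "\<forall>x\<in>polydisc a \<rho>. ((\<lambda>\<alpha>. c \<alpha> * monomial_at a \<alpha> x) has_sum f x) UNIV"
    using assms(1) unfolding expands_def by blast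
  then show ?thesis
    unfolding expands_def by (intro exI[of _ c]) (simp add: assms(2))
qed

lemma expands_weaken: "expands a \<rho> M f \<Longrightarrow> M \<le> N \<Longrightarrow> expands a \<rho> N f"
  unfolding expands_def by (blast intro: order_trans)

text \<open>
  Completeness of the algebra: a series of power series whose norms are summable is a power series.
\<close>

lemma expands_infsum:
  fixes f :: "'i \<Rightarrow> 'k::{real_normed_field,banach}^'m \<Rightarrow> 'k"
  assumes rho: "0 < \<rho>" and f: "\<And>i. i \<in> I \<Longrightarrow> expands a \<rho> (M i) (f i)" and M: "M summable_on I"
  shows "expands a \<rho> (infsum M I) (\<lambda>x. infsum (\<lambda>i. f i x) I)"
proof -
  have "\<exists>c. \<forall>i\<in>I. (\<lambda>\<alpha>. norm (c i \<alpha>) * \<rho> ^ total_degree \<alpha>) summable_on UNIV \<and>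
     (\<Sum>\<^sub>\<infinity>\<alpha>. norm (c i \<alpha>) * \<rho> ^ total_degree \<alpha>) \<le> M i \<and>
     (\<forall>x\<in>polydisc a \<rho>. ((\<lambda>\<alpha>. c i \<alpha> * monomial_at a \<alpha> x) has_sum f i x) UNIV)"
    using f unfolding expands_def by (intro bchoice) auto
  then obtain c where c:
     "\<And>i. i\<in>I \<Longrightarrow> (\<lambda>\<alpha>. norm (c i \<alpha>) * \<rho> ^ total_degree \<alpha>) summable_on UNIV"
     "\<And>i. i\<in>I \<Longrightarrow> (\<Sum>\<^sub>\<infinity>\<alpha>. norm (c i \<alpha>) * \<rho> ^ total_degree \<alpha>) \<le> M i"
     "\<And>i x. i\<in>I \<Longrightarrow> x\<in>polydisc a \<rho> \<Longrightarrow> ((\<lambda>\<alpha>. c i \<alpha> * monomial_at a \<alpha> x) has_sum f i x) UNIV"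
    by blast
  define C where "C = (\<lambda>(i,\<alpha>). c i \<alpha>)"
  define n where "n i = (\<Sum>\<^sub>\<infinity>\<alpha>. norm (c i \<alpha>) * \<rho> ^ total_degree \<alpha>)" for i
  define N where "N p = norm (C p) * \<rho> ^ total_degree (snd p)" for p
  have hs: "((\<lambda>\<alpha>. N (i, \<alpha>)) has_sum n i) UNIV" if "i \<in> I" for i
    using c(1)[OF that] by (simp add: N_def C_def n_def summable_iff_has_sum_infsum)
  have nsum: "n summable_on I"
    by (rule summable_on_comparison_test[OF M]) (use c(2) rho in \<open>auto simp: n_def intro!: infsum_nonneg\<close>)
  have NS: "N summable_on (I \<times> UNIV)"
    by (rule summable_on_SigmaI[OF hs nsum]) (use rho in \<open>auto simp: N_def\<close>)
  have "(n has_sum infsum N (I\<times>UNIV)) I"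
    by (rule has_sum_SigmaD[OF _ hs]) (use NS in auto)
  then have "infsum N (I\<times>UNIV) = infsum n I"
    by (simp add: infsumI)
  also have "\<dots> \<le> infsum M I"
    by (rule infsum_mono[OF nsum M]) (use c(2) in \<open>auto simp: n_def\<close>)
  finally have Nle: "infsum N (I\<times>UNIV) \<le> infsum M I" .
  show ?thesis
  proof (rule expands_regroup[OF rho, where C=C and E=snd and I="I\<times>UNIV"])
    show "(\<lambda>p. norm (C p) * \<rho> ^ total_degree (snd p)) summable_on (I \<times> UNIV)"
      using NS by (simp add: N_def[abs_def])
    show "(\<Sum>\<^sub>\<infinity>p\<in>I \<times> UNIV. norm (C p) * \<rho> ^ total_degree (snd p)) \<le> infsum M I"
      using Nle by (simp add: N_def[abs_def])
    fix x :: "'k^'m" assume x: "x \<in> polydisc a \<rho>"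
    have "(\<lambda>p. norm (C p * monomial_at a (snd p) x)) summable_on (I \<times> UNIV)"
      by (rule abs_summable_coefficients[OF _ x]) (use NS in \<open>simp add: N_def[abs_def]\<close>)
    then have s: "(\<lambda>p. C p * monomial_at a (snd p) x) summable_on (I \<times> UNIV)"
      by (rule abs_summable_summable)
    have fs: "((\<lambda>i. f i x) has_sum infsum (\<lambda>p. C p * monomial_at a (snd p) x) (I\<times>UNIV)) I"
      by (rule has_sum_SigmaD[OF has_sum_infsum[OF s]]) (use c(3) x in \<open>auto simp: C_def\<close>)
    then show "((\<lambda>p. C p * monomial_at a (snd p) x) has_sum (\<Sum>\<^sub>\<infinity>i\<in>I. f i x)) (I \<times> UNIV)"
      using has_sum_infsum[OF s] by (simp add: infsumI[OF fs])
  qed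
qed

lemma expands_term:
  assumes "0 < \<rho>"
  shows "expands a \<rho> (norm (c::'k::{real_normed_field,banach}) * \<rho> ^ total_degree \<alpha>) (\<lambda>x. c * monomial_at a \<alpha> x)"
  by (rule expands_regroup[OF assms, where I="{()}" and C="\<lambda>_. c" and E="\<lambda>_. \<alpha>"]) (auto simp: has_sum_finite_iff)

lemma expands_const:
  assumes "0 < \<rho>" shows "expands a \<rho> (norm c) (\<lambda>x. c::'k::{real_normed_field,banach})"
  using expands_term[OF assms, where c=c and \<alpha>="\<lambda>_. 0" and a=a] by (simp add: monomial_at_def total_degree_def)

lemma expands_coord:
  fixes a :: "'k::{real_normed_field,banach}^'m"
  assumes "0 < \<rho>" shows "expands a \<rho> \<rho> (\<lambda>x. x $ i - a $ i)"
proof -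
  have "monomial_at a (\<lambda>j. if j = i then 1 else 0) x = x $ i - a $ i" for x :: "'k^'m"
  proof -
    have "monomial_at a (\<lambda>j. if j = i then 1 else 0) x = (\<Prod>j\<in>UNIV. if j = i then x $ j - a $ j else 1)"
      unfolding monomial_at_def by (intro prod.cong) auto
    then show ?thesis by simp
  qed
  moreover have "total_degree (\<lambda>j. if j = i then 1 else 0) = 1"
    by (simp add: total_degree_def)
  ultimately show ?thesis
    using expands_term[OF assms, where c=1 and \<alpha>="\<lambda>j. if j = i then 1 else 0" and a=a] by simp
qed

lemma expands_add:
  fixes f :: "'k::{real_normed_field,banach}^'m \<Rightarrow> 'k"
  assumes "0 < \<rho>" "expands a \<rho> M f" "expands a \<rho> N g"
  shows "expands a \<rho> (M + N) (\<lambda>x. f x + g x)"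
  using expands_infsum[OF assms(1), where I=UNIV and a=a and M="\<lambda>b. if b then M else N" and f="\<lambda>b. if b then f else g"] assms
  by (simp add: UNIV_bool add.commute)

lemma expands_mult:
  fixes f :: "'k::{real_normed_field,banach}^'m \<Rightarrow> 'k"
  assumes rho: "0 < \<rho>" and f: "expands a \<rho> M f" and g: "expands a \<rho> N g"
  shows "expands a \<rho> (M * N) (\<lambda>x. f x * g x)"
proof -
  obtain c where c: "(\<lambda>\<alpha>. norm (c \<alpha>) * \<rho> ^ total_degree \<alpha>) summable_on UNIV"
     "(\<Sum>\<^sub>\<infinity>\<alpha>. norm (c \<alpha>) * \<rho> ^ total_degree \<alpha>) \<le> M"
     "\<forall>x\<in>polydisc a \<rho>. ((\<lambda>\<alpha>. c \<alpha> * monomial_at a \<alpha> x) has_sum f x) UNIV"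
    using f unfolding expands_def by blast
  obtain d where d: "(\<lambda>\<alpha>. norm (d \<alpha>) * \<rho> ^ total_degree \<alpha>) summable_on UNIV"
     "(\<Sum>\<^sub>\<infinity>\<alpha>. norm (d \<alpha>) * \<rho> ^ total_degree \<alpha>) \<le> N"
     "\<forall>x\<in>polydisc a \<rho>. ((\<lambda>\<alpha>. d \<alpha> * monomial_at a \<alpha> x) has_sum g x) UNIV"
    using g unfolding expands_def by blast
  \<comment> \<open>Multiplying \<open>g\<close> by one term of \<open>f\<close> shifts exponents; the product is the sum of these.\<close>
  have trm: "expands a \<rho> (norm (c \<alpha>) * \<rho> ^ total_degree \<alpha> * N) (\<lambda>x. c \<alpha> * monomial_at a \<alpha> x * g x)" for \<alpha>
  proof (rule expands_regroup[OF rho, where I=UNIV and C="\<lambda>\<beta>. c \<alpha> * d \<beta>" and E="\<lambda>\<beta> i. \<alpha> i + \<beta> i"])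
    have eq: "norm (c \<alpha> * d \<beta>) * \<rho> ^ total_degree (\<lambda>i. \<alpha> i + \<beta> i)
        = norm (c \<alpha>) * \<rho> ^ total_degree \<alpha> * (norm (d \<beta>) * \<rho> ^ total_degree \<beta>)" for \<beta>
      by (simp add: norm_mult total_degree_add power_add)
    show "(\<lambda>\<beta>. norm (c \<alpha> * d \<beta>) * \<rho> ^ total_degree (\<lambda>i. \<alpha> i + \<beta> i)) summable_on UNIV"
      unfolding eq by (intro summable_on_cmult_right d)
    show "(\<Sum>\<^sub>\<infinity>\<beta>. norm (c \<alpha> * d \<beta>) * \<rho> ^ total_degree (\<lambda>i. \<alpha> i + \<beta> i)) \<le> norm (c \<alpha>) * \<rho> ^ total_degree \<alpha> * N"
      unfolding eq using d rho by (subst infsum_cmult_right) (auto intro!: mult_left_mono)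
    fix x assume x: "x \<in> polydisc a \<rho>"
    show "((\<lambda>\<beta>. c \<alpha> * d \<beta> * monomial_at a (\<lambda>i. \<alpha> i + \<beta> i) x) has_sum c \<alpha> * monomial_at a \<alpha> x * g x) UNIV"
      using has_sum_cmult_right[OF d(3)[rule_format, OF x], of "c \<alpha> * monomial_at a \<alpha> x"]
      by (simp add: monomial_at_add mult_ac)
  qed
  have N: "0 \<le> N" using expands_nonneg[OF g] rho by simp
  have S: "(\<lambda>\<alpha>. norm (c \<alpha>) * \<rho> ^ total_degree \<alpha> * N) summable_on UNIV"
    by (intro summable_on_cmult_left c)
  have "expands a \<rho> (\<Sum>\<^sub>\<infinity>\<alpha>. norm (c \<alpha>) * \<rho> ^ total_degree \<alpha> * N) (\<lambda>x. \<Sum>\<^sub>\<infinity>\<alpha>. c \<alpha> * monomial_at a \<alpha> x * g x)"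
    by (rule expands_infsum[OF rho trm S])
  moreover have "(\<Sum>\<^sub>\<infinity>\<alpha>. norm (c \<alpha>) * \<rho> ^ total_degree \<alpha> * N) \<le> M * N"
    using c N by (subst infsum_cmult_left) (auto intro: mult_right_mono)
  ultimately have "expands a \<rho> (M * N) (\<lambda>x. \<Sum>\<^sub>\<infinity>\<alpha>. c \<alpha> * monomial_at a \<alpha> x * g x)"
    by (rule expands_weaken)
  then show ?thesis
  proof (rule expands_cong)
    fix x assume "x \<in> polydisc a \<rho>"
    then show "(\<Sum>\<^sub>\<infinity>\<alpha>. c \<alpha> * monomial_at a \<alpha> x * g x) = f x * g x"
      by (intro infsumI has_sum_cmult_left) (use c(3) in blast)
  qed
qed

lemma expands_power:
  fixes f :: "'k::{real_normed_field,banach}^'m \<Rightarrow> 'k"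
  assumes "0 < \<rho>" "expands a \<rho> M f" shows "expands a \<rho> (M ^ n) (\<lambda>x. f x ^ n)"
proof (induction n)
  case 0 show ?case using expands_const[OF assms(1), where a=a and c=1] by simp
next
  case (Suc n) then show ?case using expands_mult[OF assms(1,2)] by simp
qed

lemma expands_prod:
  fixes f :: "'i \<Rightarrow> 'k::{real_normed_field,banach}^'m \<Rightarrow> 'k"
  assumes "0 < \<rho>" "finite I" "\<And>i. i \<in> I \<Longrightarrow> expands a \<rho> (M i) (f i)"
  shows "expands a \<rho> (\<Prod>i\<in>I. M i) (\<lambda>x. \<Prod>i\<in>I. f i x)"
  using assms(2,3)
proof (induction I)
  case empty show ?case using expands_const[OF assms(1), where a=a and c=1] by simp
next
  case (insert i I) then show ?case by (auto intro!: expands_mult[OF assms(1)])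
qed

text \<open>
  Substituting a power series whose increment has norm at most the radius \<open>\<sigma>\<close> turns each monomial of the
  outer series into a product of norm at most its own weight; so the outer norm bounds the composite.
\<close>

lemma expands_compose:
  fixes g :: "'k::{real_normed_field,banach}^'n \<Rightarrow> 'k" and f :: "'k^'m \<Rightarrow> 'k^'n"
  assumes rho: "0 < \<rho>" and g: "expands b \<sigma> N g"
    and f: "\<And>j. expands a \<rho> \<sigma> (\<lambda>x. f x $ j - b $ j)"
  shows "expands a \<rho> N (\<lambda>x. g (f x))"
proof -
  obtain d where d: "(\<lambda>\<alpha>. norm (d \<alpha>) * \<sigma> ^ total_degree \<alpha>) summable_on UNIV"
     "(\<Sum>\<^sub>\<infinity>\<alpha>. norm (d \<alpha>) * \<sigma> ^ total_degree \<alpha>) \<le> N"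
     "\<forall>x\<in>polydisc b \<sigma>. ((\<lambda>\<alpha>. d \<alpha> * monomial_at b \<alpha> x) has_sum g x) UNIV"
    using g unfolding expands_def by blast
  have "expands a \<rho> (norm (d \<beta>) * \<sigma> ^ total_degree \<beta>) (\<lambda>x. d \<beta> * monomial_at b \<beta> (f x))" for \<beta>
  proof -
    have "expands a \<rho> (\<Prod>j\<in>UNIV. \<sigma> ^ \<beta> j) (\<lambda>x. monomial_at b \<beta> (f x))"
      unfolding monomial_at_def by (intro expands_prod expands_power f rho) auto
    then show ?thesis
      using expands_mult[OF rho expands_const[OF rho]]
      by (simp add: total_degree_def power_sum)
  qed
  then have "expands a \<rho> (\<Sum>\<^sub>\<infinity>\<beta>. norm (d \<beta>) * \<sigma> ^ total_degree \<beta>) (\<lambda>x. \<Sum>\<^sub>\<infinity>\<beta>. d \<beta> * monomial_at b \<beta> (f x))"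
    by (intro expands_infsum rho d)
  then have "expands a \<rho> N (\<lambda>x. \<Sum>\<^sub>\<infinity>\<beta>. d \<beta> * monomial_at b \<beta> (f x))"
    using d(2) expands_weaken by blast
  then show ?thesis
  proof (rule expands_cong)
    fix x assume x: "x \<in> polydisc a \<rho>"
    have "f x \<in> polydisc b \<sigma>"
      using expands_norm[OF f x] by (simp add: polydisc_def)
    then show "(\<Sum>\<^sub>\<infinity>\<beta>. d \<beta> * monomial_at b \<beta> (f x)) = g (f x)"
      using d(3) by (intro infsumI) auto
  qed
qed

section \<open>Analytic functions\<close>

lemma expands_smaller:
  assumes "expands a \<rho> M f" "0 < \<sigma>" "\<sigma> \<le> \<rho>"
  shows "expands a \<sigma> M f"
proof -
  obtain c where c: "(\<lambda>\<alpha>. norm (c \<alpha>) * \<rho> ^ total_degree \<alpha>) summable_on UNIV"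
    "(\<Sum>\<^sub>\<infinity>\<alpha>. norm (c \<alpha>) * \<rho> ^ total_degree \<alpha>) \<le> M"
    "\<forall>x\<in>polydisc a \<rho>. ((\<lambda>\<alpha>. c \<alpha> * monomial_at a \<alpha> x) has_sum f x) UNIV"
    using assms(1) unfolding expands_def by blast
  have le: "norm (c \<alpha>) * \<sigma> ^ total_degree \<alpha> \<le> norm (c \<alpha>) * \<rho> ^ total_degree \<alpha>" for \<alpha>
    using assms by (intro mult_left_mono power_mono) auto
  have s: "(\<lambda>\<alpha>. norm (c \<alpha>) * \<sigma> ^ total_degree \<alpha>) summable_on UNIV"
    by (rule summable_on_comparison_test[OF c(1)]) (use le assms in auto)
  have "(\<Sum>\<^sub>\<infinity>\<alpha>. norm (c \<alpha>) * \<sigma> ^ total_degree \<alpha>) \<le> M"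
    using infsum_mono[OF s c(1) le] c(2) by linarith
  then show ?thesis
    unfolding expands_def using s c(3) polydisc_mono[OF assms(3)] by (intro exI[of _ c]) blast
qed

lemma ball_subset_polydisc: "ball a \<rho> \<subseteq> polydisc (a::'k::real_normed_field^'m) \<rho>"
proof
  fix x assume "x \<in> ball a \<rho>"
  then have "norm (x - a) < \<rho>" by (simp add: dist_norm norm_minus_commute)
  then have "norm ((x - a) $ i) \<le> \<rho>" for i
    using Finite_Cartesian_Product.norm_nth_le[of "x - a" i] by linarith
  then show "x \<in> polydisc a \<rho>" by (simp add: polydisc_def)
qed

lemma expands_imp_analytic_at:
  assumes "expands a \<rho> M f" "0 < \<rho>" shows "analytic_at a f"
  using assms ball_subset_polydisc[of a \<rho>] unfolding expands_def analytic_at_def monomial_at_def by blast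

lemma summable_on_finite_sum:
  fixes f :: "'b \<Rightarrow> 'i \<Rightarrow> real"
  assumes "finite B" "\<And>b. f b summable_on I"
  shows "(\<lambda>i. \<Sum>b\<in>B. f b i) summable_on I"
  using assms(1) by (induction B) (auto intro!: summable_on_add assms(2))

lemma norm_vec_le_sum: "norm x \<le> (\<Sum>i\<in>UNIV. norm (x $ i))"
  by (simp add: norm_vec_def L2_set_le_sum)

lemma summable_on_imp_abs_summable_on:
  fixes f :: "'i \<Rightarrow> 'a::euclidean_space"
  assumes "f summable_on I" shows "(\<lambda>i. norm (f i)) summable_on I"
proof -
  have "(\<lambda>i. \<bar>f i \<bullet> b\<bar>) summable_on I" for b
    using summable_on_bounded_linear[OF bounded_linear_inner_left assms, of b]
      summable_on_iff_abs_summable_on_real by force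
  then have "(\<lambda>i. \<Sum>b\<in>Basis. \<bar>f i \<bullet> b\<bar>) summable_on I"
    by (rule summable_on_finite_sum[OF finite_Basis])
  then show ?thesis
    by (rule Infinite_Sum.abs_summable_on_comparison_test') (rule norm_le_l1)
qed

text \<open>
  Convergence on a ball is unconditional, hence absolute in finite dimension; at a corner of a polydisc inside
  the ball this is exactly summability of the weighted coefficients.
\<close>

lemma analytic_at_imp_expands:
  fixes f :: "'k::{real_normed_field,euclidean_space}^'m \<Rightarrow> 'k"
  assumes "analytic_at a f" obtains \<rho> M where "0 < \<rho>" "expands a \<rho> M f"
proof -
  obtain c r where r: "r > 0" and c: "\<And>x. x \<in> ball a r \<Longrightarrow> ((\<lambda>\<alpha>. c \<alpha> * monomial_at a \<alpha> x) has_sum f x) UNIV"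
    using assms unfolding analytic_at_def monomial_at_def by metis
  define m where "m = real CARD('m)"
  have m: "m > 0" by (simp add: m_def)
  define \<rho> where "\<rho> = r / (2 * m)"
  have rho: "\<rho> > 0" using r m by (simp add: \<rho>_def)
  have sub: "polydisc a \<rho> \<subseteq> ball a r"
  proof
    fix x assume x: "x \<in> polydisc a \<rho>"
    have "norm (x - a) \<le> (\<Sum>i\<in>UNIV. norm ((x - a) $ i))"
      by (rule norm_vec_le_sum)
    also have "\<dots> \<le> (\<Sum>i\<in>(UNIV::'m set). \<rho>)"
      using x by (intro sum_mono) (auto simp: polydisc_def)
    also have "\<dots> < r" using r m by (simp add: \<rho>_def m_def)
    finally show "x \<in> ball a r" by (simp add: dist_norm norm_minus_commute)
  qed
  \<comment> \<open>At the corner of the polydisc all monomials take their maximal modulus.\<close>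
  define p where "p = (\<chi> i. a $ i + of_real \<rho>)"
  have p: "p \<in> polydisc a \<rho>" using rho by (simp add: p_def polydisc_def)
  have mp: "norm (monomial_at a \<alpha> p) = \<rho> ^ total_degree \<alpha>" for \<alpha>
    using rho by (simp add: monomial_at_def p_def total_degree_def norm_power power_sum flip: prod_norm)
  have "(\<lambda>\<alpha>. norm (c \<alpha> * monomial_at a \<alpha> p)) summable_on UNIV"
    using has_sum_imp_summable[OF c[OF subsetD[OF sub p]]] by (rule summable_on_imp_abs_summable_on)
  then have "(\<lambda>\<alpha>. norm (c \<alpha>) * \<rho> ^ total_degree \<alpha>) summable_on UNIV"
    by (simp add: norm_mult mp)
  then have "expands a \<rho> (\<Sum>\<^sub>\<infinity>\<alpha>. norm (c \<alpha>) * \<rho> ^ total_degree \<alpha>) f"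
    unfolding expands_def using c sub by (intro exI[of _ c]) auto
  with rho that show ?thesis by blast
qed

lemma analytic_at_cong:
  assumes "analytic_at a f" "open U" "a \<in> U" "\<And>x. x \<in> U \<Longrightarrow> f x = g x"
  shows "analytic_at a g"
proof -
  obtain c r where r: "r > 0" and c: "\<And>x. x \<in> ball a r \<Longrightarrow> ((\<lambda>\<alpha>. c \<alpha> * (\<Prod>i\<in>UNIV. (x $ i - a $ i) ^ \<alpha> i)) has_sum f x) UNIV"
    using assms(1) unfolding analytic_at_def by metis
  obtain s where s: "s > 0" "ball a s \<subseteq> U"
    using assms(2,3) open_contains_ball by blast
  show ?thesis
    unfolding analytic_at_def
    by (rule exI[of _ c], rule exI[of _ "min r s"]) (use r s c assms(4)[symmetric] in \<open>auto simp: subset_iff\<close>)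
qed

lemma monomial_at_center: "monomial_at a \<alpha> a = (if \<alpha> = (\<lambda>_. 0) then 1 else 0)"
proof (cases "\<alpha> = (\<lambda>_. 0)")
  case False
  then obtain i where "\<alpha> i \<noteq> 0" by auto
  then have "\<exists>i. (a $ i - a $ i) ^ \<alpha> i = 0" by auto
  then show ?thesis using False by (simp add: monomial_at_def)
qed (simp add: monomial_at_def)

text \<open>
  An increment has no constant term, so passing from radius \<open>\<sigma>\<close> to \<open>\<rho>\<close> multiplies its norm by at
  most \<open>\<rho> / \<sigma>\<close>.  This makes inner functions small enough to be substituted.
\<close>

lemma analytic_at_small_increment:
  fixes f :: "'k::{real_normed_field,euclidean_space}^'m \<Rightarrow> 'k"
  assumes "analytic_at a f" "0 < \<epsilon>"
  obtains \<rho>0 where "0 < \<rho>0" "\<And>\<rho>. 0 < \<rho> \<Longrightarrow> \<rho> \<le> \<rho>0 \<Longrightarrow> expands a \<rho> \<epsilon> (\<lambda>x. f x - f a)"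
proof -
  obtain \<sigma> M where sig: "0 < \<sigma>" and "expands a \<sigma> M f"
    using analytic_at_imp_expands[OF assms(1)] .
  then obtain c where c: "(\<lambda>\<alpha>. norm (c \<alpha>) * \<sigma> ^ total_degree \<alpha>) summable_on UNIV"
    "\<forall>x\<in>polydisc a \<sigma>. ((\<lambda>\<alpha>. c \<alpha> * monomial_at a \<alpha> x) has_sum f x) UNIV"
    unfolding expands_def by blast
  let ?z = "\<lambda>_. 0 :: nat"
  define S where "S = (\<Sum>\<^sub>\<infinity>\<alpha>. norm (c \<alpha>) * \<sigma> ^ total_degree \<alpha>)"
  have S: "0 \<le> S" using sig by (auto simp: S_def intro!: infsum_nonneg)
  define \<rho>0 where "\<rho>0 = min \<sigma> (\<epsilon> * \<sigma> / (S + 1))"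
  have a: "a \<in> polydisc a \<sigma>" using sig by (simp add: polydisc_def)
  have c0: "f a = c ?z"
  proof -
    have "((\<lambda>\<alpha>. c \<alpha> * monomial_at a \<alpha> a) has_sum c ?z) UNIV"
      by (rule has_sum_finite_neutralI[of "{?z}"]) (auto simp: monomial_at_center)
    then show ?thesis using c(2) a has_sum_unique by blast
  qed
  show thesis
  proof (rule that[of \<rho>0])
    show "0 < \<rho>0" using sig S assms(2) by (simp add: \<rho>0_def)
    fix \<rho> :: real assume rho: "0 < \<rho>" "\<rho> \<le> \<rho>0"
    then have rs: "\<rho> \<le> \<sigma>" and re: "\<rho> / \<sigma> * S \<le> \<epsilon>"
    proof -
      show "\<rho> \<le> \<sigma>" using rho by (simp add: \<rho>0_def)
      have "\<rho> * (S + 1) \<le> \<epsilon> * \<sigma>"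
        using rho S by (simp add: \<rho>0_def pos_le_divide_eq)
      then have "\<rho> * S \<le> \<epsilon> * \<sigma>" using rho(1) by (simp add: distrib_left)
      then show "\<rho> / \<sigma> * S \<le> \<epsilon>" using sig by (simp add: field_simps)
    qed
    have le: "norm (c \<alpha>) * \<rho> ^ total_degree \<alpha> \<le> \<rho> / \<sigma> * (norm (c \<alpha>) * \<sigma> ^ total_degree \<alpha>)"
      if "\<alpha> \<in> UNIV - {?z}" for \<alpha>
    proof -
      have "total_degree \<alpha> \<noteq> 0" using that by (auto simp: total_degree_def fun_eq_iff)
      then obtain n where n: "total_degree \<alpha> = Suc n" using not0_implies_Suc by blast
      have "\<rho> ^ n \<le> \<sigma> ^ n" using rho rs by (intro power_mono) auto
      then have "\<rho> * \<rho> ^ n \<le> \<rho> * \<sigma> ^ n" using rho by simp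
      then have "norm (c \<alpha>) * (\<rho> * \<rho> ^ n) \<le> norm (c \<alpha>) * (\<rho> * \<sigma> ^ n)"
          by (rule mult_left_mono) simp
      moreover have "\<rho> / \<sigma> * (norm (c \<alpha>) * \<sigma> ^ Suc n) = norm (c \<alpha>) * (\<rho> * \<sigma> ^ n)"
        using sig by simp
      ultimately show ?thesis unfolding n power_Suc by simp
    qed
    have s: "(\<lambda>\<alpha>. \<rho> / \<sigma> * (norm (c \<alpha>) * \<sigma> ^ total_degree \<alpha>)) summable_on (UNIV - {?z})"
      by (intro summable_on_cmult_right summable_on_subset_banach[OF c(1)]) auto
    show "expands a \<rho> \<epsilon> (\<lambda>x. f x - f a)"
    proof (rule expands_regroup[OF rho(1), where I="UNIV - {?z}" and C=c and E="\<lambda>\<alpha>. \<alpha>"])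
      show s': "(\<lambda>\<alpha>. norm (c \<alpha>) * \<rho> ^ total_degree \<alpha>) summable_on (UNIV - {?z})"
        by (rule summable_on_comparison_test[OF s le]) (use rho in auto)
      have "(\<Sum>\<^sub>\<infinity>\<alpha>\<in>UNIV - {?z}. norm (c \<alpha>) * \<rho> ^ total_degree \<alpha>)
          \<le> (\<Sum>\<^sub>\<infinity>\<alpha>\<in>UNIV - {?z}. \<rho> / \<sigma> * (norm (c \<alpha>) * \<sigma> ^ total_degree \<alpha>))"
        by (rule infsum_mono[OF s' s le])
      also have "\<dots> = \<rho> / \<sigma> * (\<Sum>\<^sub>\<infinity>\<alpha>\<in>UNIV - {?z}. (norm (c \<alpha>) * \<sigma> ^ total_degree \<alpha>))"
        by (rule infsum_cmult_right) (auto intro: summable_on_subset_banach[OF c(1)])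
      also have "\<dots> \<le> \<rho> / \<sigma> * S"
        unfolding S_def using sig rho c(1)
        by (intro mult_left_mono infsum_mono_neutral summable_on_subset_banach[OF c(1)]) auto
      finally show "(\<Sum>\<^sub>\<infinity>\<alpha>\<in>UNIV - {?z}. norm (c \<alpha>) * \<rho> ^ total_degree \<alpha>) \<le> \<epsilon>"
        using re by linarith
      fix x assume "x \<in> polydisc a \<rho>"
      then have "((\<lambda>\<alpha>. c \<alpha> * monomial_at a \<alpha> x) has_sum f x) UNIV"
        using c(2) polydisc_mono[OF rs] by blast
      moreover have "((\<lambda>\<alpha>. c \<alpha> * monomial_at a \<alpha> x) has_sum f a) {?z}"
        by (simp add: has_sum_finite_iff c0 monomial_at_def)
      ultimately show "((\<lambda>\<alpha>. c \<alpha> * monomial_at a \<alpha> x) has_sum (f x - f a)) (UNIV - {?z})"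
        by (rule has_sum_Diff) auto
    qed
  qed
qed

lemma analytic_at_compose:
  fixes g :: "'k::{real_normed_field,euclidean_space}^'n \<Rightarrow> 'k" and f :: "'k^'m \<Rightarrow> 'k^'n"
  assumes "analytic_at (f a) g" "\<And>j. analytic_at a (\<lambda>x. f x $ j)"
  shows "analytic_at a (\<lambda>x. g (f x))"
proof -
  obtain \<sigma> N where sig: "0 < \<sigma>" and g: "expands (f a) \<sigma> N g"
    using analytic_at_imp_expands[OF assms(1)] .
  have "\<exists>\<rho>0>0. \<forall>\<rho>. 0 < \<rho> \<longrightarrow> \<rho> \<le> \<rho>0 \<longrightarrow> expands a \<rho> \<sigma> (\<lambda>x. f x $ j - f a $ j)" for j
    using analytic_at_small_increment[OF assms(2) sig] by metis
  then obtain R where R: "\<And>j. 0 < R j" "\<And>j \<rho>. 0 < \<rho> \<Longrightarrow> \<rho> \<le> R j \<Longrightarrow> expands a \<rho> \<sigma> (\<lambda>x. f x $ j - f a $ j)"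
    by metis
  define \<rho> where "\<rho> = Min (range R)"
  have "0 < \<rho>" "\<And>j. \<rho> \<le> R j"
    using R(1) by (auto simp: \<rho>_def)
  then show ?thesis
    by (intro expands_imp_analytic_at[OF expands_compose[OF _ g]]) (auto intro: R(2))
qed

lemma analytic_at_const: "analytic_at a (\<lambda>x. c::'k::{real_normed_field,banach})"
  by (rule expands_imp_analytic_at[OF expands_const]) (auto intro: zero_less_one)

lemma analytic_at_coord: "analytic_at (a::'k::{real_normed_field,banach}^'m) (\<lambda>x. x $ i)"
proof -
  have "expands a 1 (1 + norm (a $ i)) (\<lambda>x. (x $ i - a $ i) + a $ i)"
    by (intro expands_add expands_coord expands_const zero_less_one)
  then show ?thesis using expands_imp_analytic_at[OF _ zero_less_one] by simp
qed

lemma analytic_at_common_radius: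
  fixes f g :: "'k::{real_normed_field,euclidean_space}^'m \<Rightarrow> 'k"
  assumes "analytic_at a f" "analytic_at a g"
  obtains \<rho> M N where "0 < \<rho>" "expands a \<rho> M f" "expands a \<rho> N g"
proof -
  obtain \<rho> M where "0 < \<rho>" "expands a \<rho> M f" using analytic_at_imp_expands[OF assms(1)] .
  moreover obtain \<sigma> N where "0 < \<sigma>" "expands a \<sigma> N g" using analytic_at_imp_expands[OF assms(2)] .
  ultimately show ?thesis
    by (intro that[of "min \<rho> \<sigma>" M N]) (auto intro: expands_smaller)
qed

lemma analytic_at_add:
  fixes f g :: "'k::{real_normed_field,euclidean_space}^'m \<Rightarrow> 'k"
  assumes "analytic_at a f" "analytic_at a g" shows "analytic_at a (\<lambda>x. f x + g x)"
  by (rule analytic_at_common_radius[OF assms]) (blast intro: expands_imp_analytic_at expands_add)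

lemma analytic_at_mult:
  fixes f g :: "'k::{real_normed_field,euclidean_space}^'m \<Rightarrow> 'k"
  assumes "analytic_at a f" "analytic_at a g" shows "analytic_at a (\<lambda>x. f x * g x)"
  by (rule analytic_at_common_radius[OF assms]) (blast intro: expands_imp_analytic_at expands_mult)

text \<open>
  The geometric series about a nonzero value, on the disc of half the radius of convergence.
\<close>

lemma analytic_at_inverse_coord:
  fixes b :: "'k::{real_normed_field,banach}^'m"
  assumes "b $ i \<noteq> 0" shows "analytic_at b (\<lambda>x. inverse (x $ i))"
proof -
  define \<beta> where "\<beta> = b $ i"
  define \<rho> where "\<rho> = norm \<beta> / 2"
  have beta: "\<beta> \<noteq> 0" using assms by (simp add: \<beta>_def)
  then have rho: "0 < \<rho>" by (simp add: \<rho>_def)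
  define C where "C n = inverse \<beta> * (- inverse \<beta>) ^ n" for n :: nat
  define E where "E n = (\<lambda>j. if j = i then n else 0)" for n :: nat
  have E1: "monomial_at b (E n) x = (x $ i - b $ i) ^ n" for n x
  proof -
    have "monomial_at b (E n) x = (\<Prod>j\<in>UNIV. if j = i then (x $ j - b $ j) ^ n else 1)"
      unfolding monomial_at_def E_def by (intro prod.cong) auto
    then show ?thesis by simp
  qed
  have E2: "total_degree (E n) = n" for n
    by (simp add: total_degree_def E_def)
  have C: "norm (C n) * \<rho> ^ n = inverse (norm \<beta>) * (1/2) ^ n" for n
  proof -
    have "norm (C n) = inverse (norm \<beta>) * inverse (norm \<beta>) ^ n"
      by (simp add: C_def norm_mult norm_power norm_inverse del: inverse_eq_divide)
    moreover have "\<rho> = norm \<beta> * (1/2)" by (simp add: \<rho>_def)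
    moreover have "inverse (norm \<beta>) ^ n * norm \<beta> ^ n = 1"
      using beta by (simp flip: power_mult_distrib)
    ultimately show ?thesis
      by (simp only: power_mult_distrib mult.assoc) (simp flip: mult.assoc)
  qed
  have s: "(\<lambda>n. norm (C n) * \<rho> ^ total_degree (E n)) summable_on UNIV"
    unfolding E2 C by (intro summable_on_cmult_right summable_nonneg_imp_summable_on summable_geometric) auto
  have "expands b \<rho> (\<Sum>\<^sub>\<infinity>n. norm (C n) * \<rho> ^ total_degree (E n)) (\<lambda>x. inverse (x $ i))"
  proof (rule expands_regroup[OF rho s order_refl])
    fix x assume x: "x \<in> polydisc b \<rho>"
    define u where "u = x $ i - b $ i"
    have u: "norm u \<le> \<rho>" using x by (simp add: polydisc_def u_def)
    have q: "norm (- inverse \<beta> * u) < 1"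
    proof -
      have "norm u < norm \<beta>" using u rho unfolding \<rho>_def by linarith
      then show ?thesis using beta by (simp add: norm_mult norm_inverse norm_divide divide_simps)
    qed
    have xi: "x $ i = \<beta> + u" by (simp add: \<beta>_def u_def)
    have nz: "\<beta> + u \<noteq> 0"
    proof
      assume "\<beta> + u = 0"
      then have "norm u = norm \<beta>" by (simp add: add_eq_0_iff)
      with u rho show False by (simp add: \<rho>_def)
    qed
    have "(\<lambda>n. (- inverse \<beta> * u) ^ n) sums (1 / (1 - (- inverse \<beta> * u)))"
      by (rule geometric_sums[OF q])
    then have "(\<lambda>n. inverse \<beta> * (- inverse \<beta> * u) ^ n) sums (inverse \<beta> * (1 / (1 - (- inverse \<beta> * u))))"
      by (rule sums_mult)
    also have "inverse \<beta> * (1 / (1 - (- inverse \<beta> * u))) = inverse (x $ i)"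
      unfolding xi using beta nz by (simp add: field_simps)
    also have "(\<lambda>n. inverse \<beta> * (- inverse \<beta> * u) ^ n) = (\<lambda>n. C n * monomial_at b (E n) x)"
      unfolding C_def E1 u_def power_mult_distrib by (simp add: mult_ac)
    finally have "(\<lambda>n. C n * monomial_at b (E n) x) sums inverse (x $ i)" .
    moreover have "summable (\<lambda>n. norm (C n * monomial_at b (E n) x))"
      using abs_summable_coefficients[OF s x] by (rule summable_on_imp_summable)
    ultimately show "((\<lambda>n. C n * monomial_at b (E n) x) has_sum inverse (x $ i)) UNIV"
      by (intro norm_summable_imp_has_sum)
  qed
  with rho show ?thesis by (rule expands_imp_analytic_at[rotated])
qed

lemma analytic_at_inverse:
  fixes f :: "'k::{real_normed_field,euclidean_space}^'m \<Rightarrow> 'k"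
  assumes "analytic_at a f" "f a \<noteq> 0" shows "analytic_at a (\<lambda>x. inverse (f x))"
  using analytic_at_compose[where f="\<lambda>x. (\<chi> (i::1). f x)" and a=a, OF analytic_at_inverse_coord[where i=1]] assms
  by simp

text \<open>
  The partial derivative of a monomial.  For \<open>\<alpha> i = 0\<close> the truncated exponent is harmless, since the
  factor in front vanishes.
\<close>

definition monomial_deriv :: "'k::real_normed_field^'m \<Rightarrow> 'm \<Rightarrow> ('m \<Rightarrow> nat) \<Rightarrow> 'k^'m \<Rightarrow> 'k"
  where "monomial_deriv a i \<alpha> x = of_nat (\<alpha> i) * monomial_at a (\<alpha>(i := \<alpha> i - 1)) x"

lemma monomial_at_has_derivative:
  "(monomial_at a \<alpha> has_derivative (\<lambda>v. \<Sum>i\<in>UNIV. monomial_deriv a i \<alpha> x * v $ i)) (at (x::'k::real_normed_field^'m))"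
proof -
  have der: "((\<lambda>x. (x $ i - a $ i) ^ \<alpha> i) has_derivative
        (\<lambda>v. of_nat (\<alpha> i) * (x $ i - a $ i) ^ (\<alpha> i - 1) * v $ i)) (at x)" for i
    by (rule derivative_eq_intros bounded_linear_imp_has_derivative bounded_linear_vec_nth | simp add: mult_ac)+
  have "((\<lambda>x. \<Prod>i\<in>UNIV. (x $ i - a $ i) ^ \<alpha> i) has_derivative
     (\<lambda>v. \<Sum>i\<in>UNIV. (of_nat (\<alpha> i) * (x $ i - a $ i) ^ (\<alpha> i - 1) * v $ i) * (\<Prod>j\<in>UNIV - {i}. (x $ j - a $ j) ^ \<alpha> j))) (at x)"
    by (rule has_derivative_prod[OF der])
  moreover have "(of_nat (\<alpha> i) * (x $ i - a $ i) ^ (\<alpha> i - 1) * v) * (\<Prod>j\<in>UNIV - {i}. (x $ j - a $ j) ^ \<alpha> j)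
      = monomial_deriv a i \<alpha> x * v" for i v
  proof -
    have "monomial_at a (\<alpha>(i := \<alpha> i - 1)) x = (x $ i - a $ i) ^ (\<alpha> i - 1) * (\<Prod>j\<in>UNIV - {i}. (x $ j - a $ j) ^ \<alpha> j)"
      unfolding monomial_at_def by (subst prod.remove[of _ i]) (auto intro!: prod.cong)
    then show ?thesis by (simp add: monomial_deriv_def mult_ac)
  qed
  ultimately show ?thesis
    unfolding monomial_at_def[abs_def] by (simp only:)
qed

text \<open>
  Halving the radius absorbs the factor that differentiation produces, because \<open>n \<le> 2 ^ n\<close>.
\<close>

lemma monomial_deriv_majorant:
  assumes "0 < \<rho>"
  shows "real (\<alpha> i) * (\<rho>/2) ^ total_degree (\<alpha>(i := \<alpha> i - 1)) \<le> 2 / \<rho> * \<rho> ^ total_degree \<alpha>"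
proof (cases "\<alpha> i")
  case (Suc k)
  define n where "n = total_degree (\<alpha>(i := \<alpha> i - 1))"
  have "total_degree \<alpha> = \<alpha> i + (\<Sum>j\<in>UNIV - {i}. \<alpha> j)"
    unfolding total_degree_def by (rule sum.remove) auto
  moreover have "n = \<alpha> i - 1 + (\<Sum>j\<in>UNIV - {i}. \<alpha> j)"
    unfolding total_degree_def n_def by (subst sum.remove[of _ i]) auto
  ultimately have td: "total_degree \<alpha> = Suc n" "\<alpha> i \<le> Suc n"
    using Suc by auto
  have "Suc n < 2 ^ Suc n" by (rule less_exp)
  then have "\<alpha> i < 2 ^ Suc n" using td(2) by linarith
  then have "real (\<alpha> i) < real (2 ^ Suc n)" by (rule of_nat_less_iff[THEN iffD2])
  then have "real (\<alpha> i) \<le> 2 * 2 ^ n" by simp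
  then have "real (\<alpha> i) / 2 ^ n \<le> 2" by (simp add: divide_le_eq)
  then have "real (\<alpha> i) / 2 ^ n * \<rho> ^ n \<le> 2 * \<rho> ^ n"
    using assms by (intro mult_right_mono) auto
  moreover have "real (\<alpha> i) * (\<rho>/2) ^ n = real (\<alpha> i) / 2 ^ n * \<rho> ^ n"
    by (simp add: power_divide)
  moreover have "2 / \<rho> * \<rho> ^ Suc n = 2 * \<rho> ^ n" using assms by simp
  ultimately show ?thesis unfolding td(1) n_def[symmetric] by linarith
qed (use assms in simp)

lemma infinite_multiindices: "infinite (UNIV :: ('m::finite \<Rightarrow> nat) set)"
proof -
  have "inj (\<lambda>n::nat. \<lambda>_::'m. n)" by (auto simp: inj_def fun_eq_iff)
  then show ?thesis by (metis infinite_super finite_imageD infinite_UNIV_nat top_greatest)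
qed

text \<open>
  A power series may be differentiated term by term, and its derivatives are again power series, on the
  polydisc of half the radius.
\<close>

lemma expands_has_derivative:
  fixes f :: "'k::{real_normed_field,banach}^'m \<Rightarrow> 'k"
  assumes f: "expands a \<rho> M f" and rho: "0 < \<rho>"
  shows "\<exists>D. (\<forall>x\<in>ball a (\<rho>/2). (f has_derivative (\<lambda>v. \<Sum>i\<in>UNIV. D i x * v $ i)) (at x)) \<and>
    (\<forall>i. \<exists>N. expands a (\<rho>/2) N (D i))"
proof -
  obtain c where c: "(\<lambda>\<alpha>. norm (c \<alpha>) * \<rho> ^ total_degree \<alpha>) summable_on UNIV"
    "\<forall>x\<in>polydisc a \<rho>. ((\<lambda>\<alpha>. c \<alpha> * monomial_at a \<alpha> x) has_sum f x) UNIV"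
    using f unfolding expands_def by blast
  define \<sigma> where "\<sigma> = \<rho> / 2"
  have sig: "0 < \<sigma>" "\<sigma> \<le> \<rho>" using rho by (auto simp: \<sigma>_def)
  define K where "K \<alpha> = 2 / \<rho> * (norm (c \<alpha>) * \<rho> ^ total_degree \<alpha>)" for \<alpha>
  have K: "K summable_on UNIV"
    unfolding K_def[abs_def] by (intro summable_on_cmult_right c)
  define C where "C i \<alpha> = c \<alpha> * of_nat (\<alpha> i)" for i \<alpha>
  define E where "E i \<alpha> = \<alpha>(i := \<alpha> i - 1)" for i and \<alpha> :: "'m \<Rightarrow> nat"
  have CE: "C i \<alpha> * monomial_at a (E i \<alpha>) x = c \<alpha> * monomial_deriv a i \<alpha> x" for i \<alpha> x
    by (simp add: C_def E_def monomial_deriv_def mult_ac)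
  have CK: "norm (C i \<alpha>) * \<sigma> ^ total_degree (E i \<alpha>) \<le> K \<alpha>" for i \<alpha>
  proof -
    have "norm (c \<alpha>) * (real (\<alpha> i) * (\<rho>/2) ^ total_degree (\<alpha>(i := \<alpha> i - 1)))
        \<le> norm (c \<alpha>) * (2 / \<rho> * \<rho> ^ total_degree \<alpha>)"
      by (intro mult_left_mono monomial_deriv_majorant rho) auto
    then show ?thesis by (simp add: C_def E_def K_def \<sigma>_def norm_mult mult_ac)
  qed
  have Csum: "(\<lambda>\<alpha>. norm (C i \<alpha>) * \<sigma> ^ total_degree (E i \<alpha>)) summable_on UNIV" for i
    by (rule summable_on_comparison_test[OF K]) (use CK sig in auto)
  define D where "D i x = (\<Sum>\<^sub>\<infinity>\<alpha>. C i \<alpha> * monomial_at a (E i \<alpha>) x)" for i x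
  have Dsum: "(\<lambda>\<alpha>. norm (C i \<alpha> * monomial_at a (E i \<alpha>) x)) summable_on UNIV" if "x \<in> polydisc a \<sigma>" for i x
    by (rule abs_summable_coefficients[OF Csum that])
  have Dhas: "((\<lambda>\<alpha>. C i \<alpha> * monomial_at a (E i \<alpha>) x) has_sum D i x) UNIV" if "x \<in> polydisc a \<sigma>" for i x
    unfolding D_def using abs_summable_summable[OF Dsum[OF that]] by simp
  have Dexp: "expands a \<sigma> (\<Sum>\<^sub>\<infinity>\<alpha>. norm (C i \<alpha>) * \<sigma> ^ total_degree (E i \<alpha>)) (D i)" for i
    by (rule expands_regroup[OF sig(1) Csum order_refl Dhas])
  have bound: "norm (C i \<alpha> * monomial_at a (E i \<alpha>) x) \<le> K \<alpha>" if "x \<in> polydisc a \<sigma>" for i \<alpha> x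
    using CK[of i \<alpha>] mult_left_mono[OF monomial_at_bound[OF that, of "E i \<alpha>"], of "norm (C i \<alpha>)"]
    by (simp add: norm_mult)
  \<comment> \<open>Enumerate the multi-indices, to apply the theorem on series of differentiable functions.\<close>
  define e where "e = from_nat_into (UNIV :: ('m \<Rightarrow> nat) set)"
  have e: "bij_betw e UNIV UNIV"
    unfolding e_def using infinite_multiindices by (intro bij_betw_from_nat_into) auto
  then have inj: "inj_on e A" for A
    using bij_betw_imp_inj_on inj_on_subset by blast
  have to_nat_sum: "((\<lambda>n. h (e n)) sums s)" if "(h has_sum s) UNIV" for h :: "('m \<Rightarrow> nat) \<Rightarrow> 'k" and s
    using that has_sum_reindex_bij_betw[OF e, of h s] by (intro has_sum_imp_sums) simp
  have Ksums: "(\<lambda>n. K (e n)) sums infsum K UNIV"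
    using K has_sum_reindex_bij_betw[OF e, of K] by (intro has_sum_imp_sums) simp
  define \<tau> where "\<tau> n = infsum K UNIV - (\<Sum>k<n. K (e k))" for n
  have tau0: "\<tau> \<longlonglongrightarrow> 0"
    using tendsto_diff[OF tendsto_const Ksums[unfolded sums_def], of "infsum K UNIV"] by (simp add: \<tau>_def[abs_def])
  have tail: "norm (D i x - (\<Sum>k<n. c (e k) * monomial_deriv a i (e k) x)) \<le> \<tau> n" if x: "x \<in> polydisc a \<sigma>" for i x n
  proof -
    define t where "t \<alpha> = C i \<alpha> * monomial_at a (E i \<alpha>) x" for \<alpha>
    have "(t has_sum D i x) UNIV" using Dhas[OF x] by (simp add: t_def[abs_def])
    moreover have "(t has_sum sum t (e ` {..<n})) (e ` {..<n})" by (simp add: has_sum_finite_iff)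
    ultimately have h: "(t has_sum (D i x - sum t (e ` {..<n}))) (UNIV - e ` {..<n})"
      by (rule has_sum_Diff) auto
    have "(K has_sum infsum K UNIV) UNIV" using K by simp
    moreover have "(K has_sum sum K (e ` {..<n})) (e ` {..<n})" by (simp add: has_sum_finite_iff)
    ultimately have hK: "(K has_sum (infsum K UNIV - sum K (e ` {..<n}))) (UNIV - e ` {..<n})"
      by (rule has_sum_Diff) auto
    have ts: "(\<lambda>\<alpha>. norm (t \<alpha>)) summable_on (UNIV - e ` {..<n})"
      using Dsum[OF x] unfolding t_def by (rule summable_on_subset_banach) auto
    have "norm (D i x - sum t (e ` {..<n})) \<le> (\<Sum>\<^sub>\<infinity>\<alpha>\<in>UNIV - e ` {..<n}. norm (t \<alpha>))"
      using norm_infsum_bound[OF ts] infsumI[OF h] by simp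
    also have "\<dots> \<le> infsum K (UNIV - e ` {..<n})"
      by (rule infsum_mono[OF ts]) (use hK bound[OF x] in \<open>auto simp: t_def summable_on_def\<close>)
    also have "\<dots> = \<tau> n"
      using infsumI[OF hK] by (simp add: \<tau>_def sum.reindex[OF inj])
    finally show ?thesis
      by (simp add: sum.reindex[OF inj] t_def CE)
  qed
  define fn where "fn n x = c (e n) * monomial_at a (e n) x" for n x
  define fn' where "fn' n x v = (\<Sum>i\<in>UNIV. c (e n) * monomial_deriv a i (e n) x * v $ i)" for n x v
  define f' where "f' x v = (\<Sum>i\<in>UNIV. D i x * v $ i)" for x v
  have disc: "x \<in> polydisc a \<sigma>" if "x \<in> ball a \<sigma>" for x
    using that ball_subset_polydisc by blast
  have fs: "(\<lambda>n. fn n x) sums f x" if "x \<in> ball a \<sigma>" for x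
    unfolding fn_def by (rule to_nat_sum) (use c(2) disc[OF that] polydisc_mono[OF sig(2)] in blast)
  have "\<exists>g. \<forall>x\<in>ball a \<sigma>. (\<lambda>n. fn n x) sums g x \<and> (g has_derivative f' x) (at x within ball a \<sigma>)"
  proof (rule has_derivative_series[where f'=fn'])
    show "(fn n has_derivative fn' n x) (at x within ball a \<sigma>)" for n x
    proof -
      have "((\<lambda>x. c (e n) * monomial_at a (e n) x) has_derivative
        (\<lambda>v. c (e n) * (\<Sum>i\<in>UNIV. monomial_deriv a i (e n) x * v $ i))) (at x within ball a \<sigma>)"
        by (intro has_derivative_mult_right has_derivative_at_withinI[OF monomial_at_has_derivative])
      then show ?thesis by (simp add: fn_def[abs_def] fn'_def[abs_def] sum_distrib_left mult.assoc)
    qed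
    show "a \<in> ball a \<sigma>" using sig by simp
    then show "(\<lambda>n. fn n a) sums f a" by (rule fs)
    fix \<epsilon> :: real assume eps: "\<epsilon> > 0"
    define m where "m = real CARD('m)"
    have m: "m > 0" by (simp add: m_def)
    have "\<forall>\<^sub>F n in sequentially. \<tau> n < \<epsilon> / m"
      using tau0 eps m by (intro order_tendstoD) auto
    then show "\<forall>\<^sub>F n in sequentially. \<forall>x\<in>ball a \<sigma>. \<forall>h. norm ((\<Sum>i<n. fn' i x h) - f' x h) \<le> \<epsilon> * norm h"
    proof (eventually_elim, intro ballI allI)
      fix n x and h :: "'k^'m" assume n: "\<tau> n < \<epsilon> / m" and x: "x \<in> ball a \<sigma>"
      have "(\<Sum>k<n. fn' k x h) = (\<Sum>i\<in>UNIV. (\<Sum>k<n. c (e k) * monomial_deriv a i (e k) x) * h $ i)"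
        unfolding fn'_def by (subst sum.swap) (simp add: sum_distrib_right)
      then have "norm ((\<Sum>k<n. fn' k x h) - f' x h) =
          norm (\<Sum>i\<in>UNIV. ((\<Sum>k<n. c (e k) * monomial_deriv a i (e k) x) - D i x) * h $ i)"
        by (simp add: f'_def left_diff_distrib sum_subtractf)
      also have "\<dots> \<le> (\<Sum>i\<in>(UNIV::'m set). \<epsilon> / m * norm h)"
      proof (rule order_trans[OF norm_sum sum_mono])
        fix i
        have "norm ((\<Sum>k<n. c (e k) * monomial_deriv a i (e k) x) - D i x) \<le> \<epsilon> / m"
          using tail[OF disc[OF x], of i n] n by (simp add: norm_minus_commute)
        then show "norm (((\<Sum>k<n. c (e k) * monomial_deriv a i (e k) x) - D i x) * h $ i) \<le> \<epsilon> / m * norm h"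
          unfolding norm_mult using eps m
          by (intro mult_mono Finite_Cartesian_Product.norm_nth_le) auto
      qed
      also have "\<dots> = \<epsilon> * norm h" using m by (simp add: m_def)
      finally show "norm ((\<Sum>i<n. fn' i x h) - f' x h) \<le> \<epsilon> * norm h" .
    qed
  qed auto
  then obtain g where g: "\<And>x. x \<in> ball a \<sigma> \<Longrightarrow> (\<lambda>n. fn n x) sums g x"
     "\<And>x. x \<in> ball a \<sigma> \<Longrightarrow> (g has_derivative f' x) (at x within ball a \<sigma>)" by blast
  have "(f has_derivative f' x) (at x)" if x: "x \<in> ball a \<sigma>" for x
  proof -
    have "(f has_derivative f' x) (at x within ball a \<sigma>)"
      by (rule has_derivative_transform[OF x _ g(2)[OF x]]) (use g(1) fs sums_unique2 in blast)
    then show ?thesis using x by (simp add: at_within_open[of x "ball a \<sigma>"])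
  qed
  then show ?thesis
    using Dexp unfolding \<sigma>_def f'_def[abs_def] by blast
qed

section \<open>Functions of class \<open>C^k\<close>\<close>

lemma frechet_derivative_cong_open:
  assumes "open U" "x \<in> U" "\<And>y. y \<in> U \<Longrightarrow> f y = g y"
  shows "frechet_derivative f (at x) = frechet_derivative g (at x)"
proof -
  have "(f has_derivative F) (at x) \<longleftrightarrow> (g has_derivative F) (at x)" for F
    using has_derivative_transform_within_open[OF _ assms(1,2)] assms(3) by metis
  then show ?thesis by (simp add: frechet_derivative_def)
qed

lemma Ck_on_has_derivative:
  assumes "Ck_on (Suc n) U f" "open U" "x \<in> U"
  shows "(f has_derivative frechet_derivative f (at x)) (at x)"
  using assms by (simp add: differentiable_on_eq_differentiable_at frechet_derivative_works)

lemma Ck_on_cong: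
  assumes "Ck_on n U f" "open U" "\<And>x. x \<in> U \<Longrightarrow> f x = g x"
  shows "Ck_on n U g"
  using assms
proof (induction n arbitrary: f g)
  case 0 then show ?case using continuous_on_cong by fastforce
next
  case (Suc n)
  have "g differentiable_on U"
    using Suc.prems differentiable_on_eq_differentiable_at[OF \<open>open U\<close>]
      has_derivative_transform_within_open unfolding Ck_on.simps differentiable_def by metis
  moreover have "Ck_on n U (\<lambda>x. frechet_derivative g (at x) v)" for v
  proof (rule Suc.IH)
    show "Ck_on n U (\<lambda>x. frechet_derivative f (at x) v)" using Suc.prems by simp
    show "frechet_derivative f (at x) v = frechet_derivative g (at x) v" if "x \<in> U" for x
      using frechet_derivative_cong_open[OF \<open>open U\<close> that, of f g] Suc.prems by simp
  qed fact
  ultimately show ?case by simp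
qed

lemma Ck_on_SucI:
  assumes "open U" "\<And>x. x \<in> U \<Longrightarrow> (f has_derivative f' x) (at x)" "\<And>v. Ck_on n U (\<lambda>x. f' x v)"
  shows "Ck_on (Suc n) U f"
proof -
  have "f differentiable_on U"
    using assms(1,2) by (auto simp: differentiable_on_eq_differentiable_at differentiable_def)
  moreover have "Ck_on n U (\<lambda>x. frechet_derivative f (at x) v)" for v
    by (rule Ck_on_cong[OF assms(3) assms(1)]) (use fun_cong[OF frechet_derivative_at[OF assms(2)]] in auto)
  ultimately show ?thesis by simp
qed

lemma Ck_on_SucD:
  assumes "Ck_on (Suc n) U f" "open U" shows "Ck_on n U f"
  using assms
proof (induction n arbitrary: f)
  case 0 then show ?case by (simp add: differentiable_imp_continuous_on)
next
  case (Suc n)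
  show ?case
    by (rule Ck_on_SucI[OF Suc.prems(2) Ck_on_has_derivative[OF Suc.prems]])
       (use Suc in auto)
qed

lemma Ck_on_subset: "Ck_on n U f \<Longrightarrow> V \<subseteq> U \<Longrightarrow> Ck_on n V f"
  by (induction n arbitrary: f) (auto intro: continuous_on_subset differentiable_on_subset)

lemma Ck_on_const: "open U \<Longrightarrow> Ck_on n U (\<lambda>x. c)"
proof (induction n arbitrary: c)
  case (Suc n)
  show ?case by (rule Ck_on_SucI[where f'="\<lambda>_ _. 0"]) (use Suc in auto)
qed simp

lemma Ck_on_linear:
  assumes "bounded_linear L" "open U" shows "Ck_on n U L"
proof (cases n)
  case 0 then show ?thesis using assms by (simp add: linear_continuous_on)
next
  case (Suc m)
  show ?thesis unfolding Suc
    by (rule Ck_on_SucI[where f'="\<lambda>_. L"])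
       (use assms in \<open>auto intro: bounded_linear_imp_has_derivative Ck_on_const\<close>)
qed

lemma Ck_on_add:
  assumes "Ck_on n U f" "Ck_on n U g" "open U" shows "Ck_on n U (\<lambda>x. f x + g x)"
  using assms
proof (induction n arbitrary: f g)
  case 0 then show ?case by (simp add: continuous_on_add)
next
  case (Suc n)
  show ?case
    by (rule Ck_on_SucI[OF \<open>open U\<close> has_derivative_add[OF Ck_on_has_derivative Ck_on_has_derivative]])
       (use Suc in auto)
qed

lemma Ck_on_sum:
  assumes "finite I" "\<And>i. i \<in> I \<Longrightarrow> Ck_on n U (f i)" "open U" shows "Ck_on n U (\<lambda>x. \<Sum>i\<in>I. f i x)"
  using assms by (induction I) (auto intro: Ck_on_const Ck_on_add)

lemma Ck_on_bilinear:
  assumes b: "bounded_bilinear b" and "Ck_on n U f" "Ck_on n U g" "open U"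
  shows "Ck_on n U (\<lambda>x. b (f x) (g x))"
  using assms(2-4)
proof (induction n arbitrary: f g)
  case 0 then show ?case by (simp add: bounded_bilinear.continuous_on[OF b])
next
  case (Suc n)
  have d: "Ck_on n U (\<lambda>x. frechet_derivative f (at x) v)" "Ck_on n U (\<lambda>x. frechet_derivative g (at x) v)" for v
    using Suc.prems by auto
  show ?case
    by (rule Ck_on_SucI[OF \<open>open U\<close> bounded_bilinear.FDERIV[OF b Ck_on_has_derivative Ck_on_has_derivative]])
       (use Suc.prems in \<open>auto intro!: Ck_on_add Suc.IH d intro: Ck_on_SucD\<close>)
qed

lemma Ck_on_linear_image:
  assumes "bounded_linear L" "Ck_on n U f" "open U" shows "Ck_on n U (\<lambda>x. L (f x))"
  using assms
proof (induction n arbitrary: f)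
  case 0 then show ?case
    by (auto intro: continuous_on_compose2[OF linear_continuous_on])
next
  case (Suc n)
  show ?case
    by (rule Ck_on_SucI[OF \<open>open U\<close> bounded_linear.has_derivative[OF Suc.prems(1) Ck_on_has_derivative]])
       (use Suc in auto)
qed

text \<open>
  In the chain rule the increment of the inner function is expanded in a basis, so that the derivative is a
  sum of products of maps to which the induction hypothesis and \<open>Ck_on_bilinear\<close> apply.
\<close>

lemma Ck_on_compose:
  fixes f :: "'a::real_normed_vector \<Rightarrow> 'b::euclidean_space"
  assumes "Ck_on n V g" "Ck_on n U f" "f ` U \<subseteq> V" "open U" "open V"
  shows "Ck_on n U (\<lambda>x. g (f x))"
  using assms
proof (induction n arbitrary: g)
  case 0 then show ?case by (auto intro: continuous_on_compose2)
next
  case (Suc n)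
  have f: "Ck_on n U f" using Suc.prems by (blast intro: Ck_on_SucD)
  show ?case
  proof (rule Ck_on_SucI[OF \<open>open U\<close>])
    fix x assume x: "x \<in> U"
    then show "((\<lambda>x. g (f x)) has_derivative
        (\<lambda>v. \<Sum>b\<in>Basis. (frechet_derivative f (at x) v \<bullet> b) *\<^sub>R frechet_derivative g (at (f x)) b)) (at x)"
    proof -
      have g: "(g has_derivative frechet_derivative g (at (f x))) (at (f x))"
        using Suc.prems x by (intro Ck_on_has_derivative) auto
      then have lin: "linear (frechet_derivative g (at (f x)))"
        by (rule has_derivative_linear)
      have comp: "((\<lambda>x. g (f x)) has_derivative (\<lambda>v. frechet_derivative g (at (f x)) (frechet_derivative f (at x) v))) (at x)"
        using diff_chain_at[OF Ck_on_has_derivative[OF Suc.prems(2,4) x] g] by (simp add: o_def)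
      have "frechet_derivative g (at (f x)) w = (\<Sum>b\<in>Basis. (w \<bullet> b) *\<^sub>R frechet_derivative g (at (f x)) b)" for w
      proof -
        have "frechet_derivative g (at (f x)) w = frechet_derivative g (at (f x)) (\<Sum>b\<in>Basis. (w \<bullet> b) *\<^sub>R b)"
          by (simp add: euclidean_representation)
        then show ?thesis by (simp only: linear_sum[OF lin] linear_cmul[OF lin])
      qed
      then have "(\<lambda>v. frechet_derivative g (at (f x)) (frechet_derivative f (at x) v))
          = (\<lambda>v. \<Sum>b\<in>Basis. (frechet_derivative f (at x) v \<bullet> b) *\<^sub>R frechet_derivative g (at (f x)) b)"
        by (rule ext)
      with comp show ?thesis by (rule subst[rotated])
    qed
  next
    fix v
    have "Ck_on n U (\<lambda>x. frechet_derivative g (at (f x)) b)" for b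
      by (rule Suc.IH) (use Suc.prems f in auto)
    moreover have "Ck_on n U (\<lambda>x. frechet_derivative f (at x) v \<bullet> b)" for b
      by (rule Ck_on_linear_image[OF bounded_linear_inner_left]) (use Suc.prems in auto)
    ultimately show "Ck_on n U (\<lambda>x. \<Sum>b\<in>Basis. (frechet_derivative f (at x) v \<bullet> b) *\<^sub>R frechet_derivative g (at (f x)) b)"
      using \<open>open U\<close> by (intro Ck_on_sum Ck_on_bilinear[OF bounded_bilinear_scaleR]) auto
  qed
qed

lemma Ck_on_inverse:
  assumes "Ck_on n U f" "open U" "\<And>x. x \<in> U \<Longrightarrow> f x \<noteq> 0"
  shows "Ck_on n U (\<lambda>x. inverse (f x :: 'k::real_normed_field))"
  using assms
proof (induction n)
  case 0 then show ?case by (simp add: continuous_on_inverse)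
next
  case (Suc n)
  have i: "Ck_on n U (\<lambda>x. inverse (f x))" using Suc Ck_on_SucD by blast
  have "Ck_on n U (\<lambda>x. (- 1) * (inverse (f x) * frechet_derivative f (at x) v * inverse (f x)))" for v
    by (intro Ck_on_bilinear[OF bounded_bilinear_mult] Ck_on_const i) (use Suc.prems in auto)
  then have c: "Ck_on n U (\<lambda>x. - (inverse (f x) * frechet_derivative f (at x) v * inverse (f x)))" for v
    by simp
  show ?case
    by (rule Ck_on_SucI[OF \<open>open U\<close> Deriv.has_derivative_inverse[OF _ Ck_on_has_derivative]])
       (use Suc.prems c in auto)
qed

lemma vec_eq_sum_axis: "(x::'k::comm_monoid_add^'m) = (\<Sum>j\<in>UNIV. axis j (x $ j))"
  by (simp add: vec_eq_iff axis_def if_distrib[of "\<lambda>f. f _"] cong: if_cong)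

lemma norm_axis: "norm (axis i c :: 'k::real_normed_vector^'m) = norm c"
proof -
  have "(\<Sum>j\<in>UNIV. (norm ((axis i c :: 'k^'m) $ j))\<^sup>2) = (\<Sum>j\<in>UNIV. if j = i then (norm c)\<^sup>2 else 0)"
    by (intro sum.cong) (auto simp: axis_def)
  then show ?thesis by (simp add: norm_vec_def L2_set_def)
qed

lemma bounded_linear_axis: "bounded_linear (axis j :: 'k::real_normed_vector \<Rightarrow> 'k^'m)"
  by (rule bounded_linear_intro[where K=1], simp_all add: norm_axis) (simp_all add: axis_def vec_eq_iff)

lemma has_derivative_vec:
  fixes f :: "'a::real_normed_vector \<Rightarrow> 'k::real_normed_vector^'m"
  assumes "\<And>j. ((\<lambda>x. f x $ j) has_derivative (\<lambda>v. f' v $ j)) F"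
  shows "(f has_derivative f') F"
proof -
  have "((\<lambda>x. \<Sum>j\<in>UNIV. axis j (f x $ j)) has_derivative (\<lambda>v. \<Sum>j\<in>UNIV. axis j (f' v $ j))) F"
    by (intro has_derivative_sum bounded_linear.has_derivative[OF bounded_linear_axis] assms)
  then show ?thesis by (simp flip: vec_eq_sum_axis)
qed

section \<open>The calculus common to all smooth categories\<close>

definition partial :: "'m \<Rightarrow> ('k::real_normed_field^'m \<Rightarrow> 'k) \<Rightarrow> 'k^'m \<Rightarrow> 'k"
  where "partial i f x = frechet_derivative f (at x) (axis i 1)"

lemma partialI: "(f has_derivative f') (at x) \<Longrightarrow> partial i f x = f' (axis i 1)"
  by (simp add: partial_def flip: frechet_derivative_at)

lemma sum_axis_nth: "(\<Sum>i\<in>UNIV. D i * (axis k 1 :: 'k::semiring_1^'m) $ i) = D k"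
  by (simp add: axis_def if_distrib cong: if_cong)

lemma partial_cong:
  assumes "open U" "x \<in> U" "\<And>y. y \<in> U \<Longrightarrow> f y = g y"
  shows "partial i f x = partial i g x"
  unfolding partial_def using frechet_derivative_cong_open[OF assms] by simp

lemma analytic_at_derivative:
  fixes f :: "'k::{real_normed_field,euclidean_space}^'m \<Rightarrow> 'k"
  assumes "analytic_at a f"
  shows "(f has_derivative (\<lambda>v. \<Sum>i\<in>UNIV. partial i f a * v $ i)) (at a)"
    and "analytic_at a (partial i f)"
proof -
  obtain \<rho> M where rho: "0 < \<rho>" and f: "expands a \<rho> M f"
    using analytic_at_imp_expands[OF assms] .
  obtain D where D: "\<And>x. x\<in>ball a (\<rho>/2) \<Longrightarrow> (f has_derivative (\<lambda>v. \<Sum>i\<in>UNIV. D i x * v $ i)) (at x)"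
    "\<And>i. \<exists>N. expands a (\<rho>/2) N (D i)"
    using expands_has_derivative[OF f rho] by blast
  have p: "partial i f x = D i x" if "x \<in> ball a (\<rho>/2)" for i x
    using partialI[OF D(1)[OF that], of i] by (simp add: sum_axis_nth)
  show "(f has_derivative (\<lambda>v. \<Sum>i\<in>UNIV. partial i f a * v $ i)) (at a)"
    using D(1)[of a] p[of a] rho by simp
  have "analytic_at a (D i)"
    using D(2)[of i] rho expands_imp_analytic_at[of a "\<rho>/2"] by auto
  then show "analytic_at a (partial i f)"
    by (rule analytic_at_cong[where U="ball a (\<rho>/2)"]) (use rho p in auto)
qed

text \<open>
  For \<open>Cinf\<close> the field must be the reals: there real differentiability already makes derivatives linear over
  the field, whereas for \<open>Analytic\<close> this follows from the power series.  The type argument only fixes the field.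
\<close>

locale smooth_category =
  fixes r :: regularity and K :: "'k::{real_normed_field,euclidean_space} itself"
  assumes Cinf_only_real: "r = Analytic \<or> range (of_real :: real \<Rightarrow> 'k) = UNIV"
begin

text \<open>
  The derivative is linear over the field, hence given by the partial derivatives.
\<close>

lemma smooth_has_derivative:
  fixes f :: "'k^'m \<Rightarrow> 'k"
  assumes "smooth_on r U f" "open U" "x \<in> U"
  shows "(f has_derivative (\<lambda>v. \<Sum>i\<in>UNIV. partial i f x * v $ i)) (at x)"
proof (cases r)
  case Analytic then show ?thesis using assms by (auto intro: analytic_at_derivative)
next
  case Cinf
  define f' where "f' = frechet_derivative f (at x)"
  have "Ck_on (Suc 0) U f" using assms Cinf by (simp del: Ck_on.simps)
  then have d: "(f has_derivative f') (at x)"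
    unfolding f'_def using assms by (intro Ck_on_has_derivative)
  then have lin: "linear f'" by (rule has_derivative_linear)
  have "f' v = (\<Sum>i\<in>UNIV. partial i f x * v $ i)" for v
  proof -
    have "f' (axis i (v $ i)) = partial i f x * v $ i" for i
    proof -
      obtain t where t: "v $ i = of_real t"
        using Cinf_only_real Cinf by auto
      have "axis i (v $ i) = t *\<^sub>R axis i (1::'k)" by (auto simp: t axis_def vec_eq_iff of_real_def)
      then have "f' (axis i (v $ i)) = t *\<^sub>R f' (axis i 1)" using linear_cmul[OF lin] by simp
      then show ?thesis by (simp add: t partial_def f'_def scaleR_conv_of_real mult.commute)
    qed
    moreover have "f' v = (\<Sum>i\<in>UNIV. f' (axis i (v $ i)))"
      using linear_sum[OF lin, of "\<lambda>i. axis i (v $ i)" UNIV] vec_eq_sum_axis[of v] by simp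
    ultimately show ?thesis by simp
  qed
  then show ?thesis using d by presburger
qed

lemma smooth_partial:
  fixes f :: "'k^'m \<Rightarrow> 'k"
  assumes "smooth_on r U f" shows "smooth_on r U (partial i f)"
proof (cases r)
  case Analytic then show ?thesis using assms by (auto intro: analytic_at_derivative)
next
  case Cinf
  have "Ck_on (Suc n) U f" for n using assms Cinf by (simp del: Ck_on.simps)
  then show ?thesis using Cinf by (simp add: partial_def[abs_def])
qed

lemma smooth_subset:
  fixes f :: "'k^'m \<Rightarrow> 'k"
  shows "smooth_on r U f \<Longrightarrow> V \<subseteq> U \<Longrightarrow> smooth_on r V f"
  by (cases r) (auto intro: Ck_on_subset)

lemma smooth_const: "open U \<Longrightarrow> smooth_on r U (\<lambda>x::'k^'m. c)"
  by (cases r) (auto intro: analytic_at_const Ck_on_const)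

lemma smooth_coord: "open U \<Longrightarrow> smooth_on r U (\<lambda>x::'k^'m. x $ i)"
  by (cases r) (auto intro: analytic_at_coord Ck_on_linear bounded_linear_vec_nth)

lemma smooth_add:
  fixes f :: "'k^'m \<Rightarrow> 'k"
  shows "smooth_on r U f \<Longrightarrow> smooth_on r U g \<Longrightarrow> open U \<Longrightarrow> smooth_on r U (\<lambda>x. f x + g x)"
  by (cases r) (auto intro: analytic_at_add Ck_on_add)

lemma smooth_mult:
  fixes f :: "'k^'m \<Rightarrow> 'k"
  shows "smooth_on r U f \<Longrightarrow> smooth_on r U g \<Longrightarrow> open U \<Longrightarrow> smooth_on r U (\<lambda>x. f x * g x)"
  by (cases r) (auto intro: analytic_at_mult Ck_on_bilinear[OF bounded_bilinear_mult])

lemma smooth_inverse: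
  fixes f :: "'k^'m \<Rightarrow> 'k"
  shows "smooth_on r U f \<Longrightarrow> open U \<Longrightarrow> (\<And>x. x \<in> U \<Longrightarrow> f x \<noteq> 0) \<Longrightarrow> smooth_on r U (\<lambda>x. inverse (f x))"
  by (cases r) (auto intro: analytic_at_inverse Ck_on_inverse)

lemma smooth_diff:
  fixes f :: "'k^'m \<Rightarrow> 'k"
  assumes "smooth_on r U f" "smooth_on r U g" "open U" shows "smooth_on r U (\<lambda>x. f x - g x)"
  using smooth_add[OF assms(1) smooth_mult[OF smooth_const[OF assms(3), of "- 1"] assms(2,3)] assms(3)] by simp

lemma smooth_sum:
  fixes f :: "'i \<Rightarrow> 'k^'m \<Rightarrow> 'k"
  assumes "finite I" "\<And>i. i \<in> I \<Longrightarrow> smooth_on r U (f i)" "open U" shows "smooth_on r U (\<lambda>x. \<Sum>i\<in>I. f i x)"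
  using assms by (induction I) (auto intro: smooth_const smooth_add)

lemma smooth_prod:
  fixes f :: "'i \<Rightarrow> 'k^'m \<Rightarrow> 'k"
  assumes "finite I" "\<And>i. i \<in> I \<Longrightarrow> smooth_on r U (f i)" "open U" shows "smooth_on r U (\<lambda>x. \<Prod>i\<in>I. f i x)"
  using assms by (induction I) (auto intro: smooth_const smooth_mult)

lemma smooth_compose:
  fixes g :: "'k^'n \<Rightarrow> 'k" and f :: "'k^'m \<Rightarrow> 'k^'n"
  assumes "smooth_on r V g" "\<And>j. smooth_on r U (\<lambda>x. f x $ j)" "open U" "open V" "\<And>x. x \<in> U \<Longrightarrow> f x \<in> V"
  shows "smooth_on r U (\<lambda>x. g (f x))"
proof (cases r)
  case Analytic then show ?thesis using assms by (auto intro: analytic_at_compose)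
next
  case Cinf
  have "Ck_on n U (\<lambda>x. \<Sum>j\<in>UNIV. axis j (f x $ j))" for n
    by (intro Ck_on_sum Ck_on_linear_image[OF bounded_linear_axis]) (use assms Cinf in auto)
  then have "Ck_on n U f" for n by (simp flip: vec_eq_sum_axis)
  then show ?thesis using Cinf assms by (auto intro: Ck_on_compose)
qed

lemma smooth_det:
  fixes A :: "'k^'m \<Rightarrow> 'k^'n^'n"
  assumes "\<And>i j. smooth_on r U (\<lambda>x. A x $ i $ j)" "open U"
  shows "smooth_on r U (\<lambda>x. det (A x))"
  unfolding det_def
  by (intro smooth_sum smooth_mult smooth_const smooth_prod assms finite_permutations finite)

lemma smooth_continuous_on:
  fixes f :: "'k^'m \<Rightarrow> 'k"
  assumes "smooth_on r U f" "open U" shows "continuous_on U f"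
  using smooth_has_derivative[OF assms] has_derivative_continuous continuous_at_imp_continuous_on by blast

lemma smooth_vec_has_derivative:
  fixes f :: "'k^'m \<Rightarrow> 'k^'n"
  assumes "\<And>j. smooth_on r U (\<lambda>x. f x $ j)" "open U" "x \<in> U"
  shows "(f has_derivative (\<lambda>v. \<chi> j. \<Sum>i\<in>UNIV. partial i (\<lambda>x. f x $ j) x * v $ i)) (at x)"
  by (rule has_derivative_vec) (use smooth_has_derivative[OF assms(1-3)] in simp)

lemma smooth_vec_continuous_on:
  fixes f :: "'k^'m \<Rightarrow> 'k^'n"
  assumes "\<And>j. smooth_on r U (\<lambda>x. f x $ j)" "open U"
  shows "continuous_on U f"
  using smooth_vec_has_derivative[OF assms] has_derivative_continuous continuous_at_imp_continuous_on by blast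

lemma partial_add:
  fixes f g :: "'k^'m \<Rightarrow> 'k"
  assumes "smooth_on r U f" "smooth_on r U g" "open U" "x \<in> U"
  shows "partial i (\<lambda>x. f x + g x) x = partial i f x + partial i g x"
  using partialI[OF has_derivative_add[OF smooth_has_derivative[OF assms(1,3,4)] smooth_has_derivative[OF assms(2-4)]], of i]
  by (simp add: sum_axis_nth)

lemma partial_mult:
  fixes f g :: "'k^'m \<Rightarrow> 'k"
  assumes "smooth_on r U f" "smooth_on r U g" "open U" "x \<in> U"
  shows "partial i (\<lambda>x. f x * g x) x = partial i f x * g x + f x * partial i g x"
  using partialI[OF has_derivative_mult[OF smooth_has_derivative[OF assms(1,3,4)] smooth_has_derivative[OF assms(2-4)]], of i]
  by (simp add: sum_axis_nth)

lemma partial_sum: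
  fixes f :: "'i \<Rightarrow> 'k^'m \<Rightarrow> 'k"
  assumes "\<And>j. j \<in> J \<Longrightarrow> smooth_on r U (f j)" "open U" "x \<in> U"
  shows "partial i (\<lambda>x. \<Sum>j\<in>J. f j x) x = (\<Sum>j\<in>J. partial i (f j) x)"
  using partialI[OF has_derivative_sum[OF smooth_has_derivative[OF assms]], where i=i]
  by (simp add: sum_axis_nth)

lemma partial_coord: "partial i (\<lambda>x::'k^'m. x $ j) x = (if i = j then 1 else 0)"
  using partialI[OF bounded_linear_imp_has_derivative[OF bounded_linear_vec_nth], of i j x]
  by (simp add: axis_def)

lemma partial_const: "partial i (\<lambda>x::'k^'m. c) x = 0"
  using partialI[OF has_derivative_const, of i c x] by simp

lemma partial_compose:
  fixes g :: "'k^'n \<Rightarrow> 'k" and f :: "'k^'m \<Rightarrow> 'k^'n"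
  assumes "smooth_on r V g" "\<And>j. smooth_on r U (\<lambda>x. f x $ j)" "open U" "open V" "x \<in> U" "f x \<in> V"
  shows "partial i (\<lambda>x. g (f x)) x = (\<Sum>j\<in>UNIV. partial j g (f x) * partial i (\<lambda>x. f x $ j) x)"
  using partialI[OF diff_chain_at[OF smooth_vec_has_derivative[OF assms(2,3,5)] smooth_has_derivative[OF assms(1,4,6)]], of i]
  by (simp add: sum_axis_nth o_def)

lemma smooth_along_curve:
  fixes f :: "'k^'m \<Rightarrow> 'k" and \<gamma> :: "real \<Rightarrow> 'k^'m"
  assumes "smooth_on r U f" "open U" "\<gamma> t \<in> U" "(\<gamma> has_vector_derivative w) (at t within S)"
  shows "((\<lambda>t. f (\<gamma> t)) has_vector_derivative (\<Sum>i\<in>UNIV. partial i f (\<gamma> t) * w $ i)) (at t within S)"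
  using vector_derivative_diff_chain_within[OF assms(4) has_derivative_at_withinI[OF smooth_has_derivative[OF assms(1-3)]]]
  by (simp add: o_def)

text \<open>
  Schwarz's theorem, by integration: along the coordinate directions \<open>i\<close> and \<open>j\<close>, the fundamental theorem
  of calculus in \<open>u\<close> followed by differentiation under the integral in \<open>s\<close> expresses the \<open>i\<close>-th derivative
  at \<open>u\<close> as an integral of the mixed derivative, which is then differentiated in \<open>u\<close>.
\<close>

lemma partial_commute:
  fixes f :: "'k^'m \<Rightarrow> 'k"
  assumes f: "smooth_on r U f" and U: "open U" "x \<in> U"
  shows "partial i (partial j f) x = partial j (partial i f) x"
proof -
  define \<gamma> where "\<gamma> s u = x + s *\<^sub>R axis i (1::'k) + u *\<^sub>R axis j 1" for s u
  have \<gamma>_cont: "continuous_on S (\<lambda>p. \<gamma> (fst p) (snd p))" for S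
    unfolding \<gamma>_def by (intro continuous_intros)
  obtain \<epsilon> where eps: "\<epsilon> > 0" "ball x \<epsilon> \<subseteq> U"
    using U open_contains_ball by blast
  define \<delta> where "\<delta> = \<epsilon> / 4"
  have \<delta>: "\<delta> > 0" using eps by (simp add: \<delta>_def)
  have \<gamma>U: "\<gamma> s u \<in> U" if "\<bar>s\<bar> \<le> \<delta>" "\<bar>u\<bar> \<le> \<delta>" for s u
  proof -
    have "norm (s *\<^sub>R axis i (1::'k) + u *\<^sub>R (axis j 1 :: 'k^'m)) \<le> \<bar>s\<bar> + \<bar>u\<bar>"
      by (rule order_trans[OF norm_triangle_ineq]) (simp add: norm_axis)
    moreover have "dist (\<gamma> s u) x = norm (s *\<^sub>R axis i (1::'k) + u *\<^sub>R (axis j 1 :: 'k^'m))"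
      by (simp add: \<gamma>_def dist_norm)
    moreover have "\<bar>s\<bar> + \<bar>u\<bar> < \<epsilon>" using that eps unfolding \<delta>_def by linarith
    ultimately have "dist x (\<gamma> s u) < \<epsilon>" by (simp add: dist_commute)
    then show ?thesis using eps by auto
  qed
  have \<gamma>s: "((\<lambda>s. \<gamma> s u) has_vector_derivative axis i 1) (at s within S)" for s u S
    unfolding \<gamma>_def by (auto intro!: derivative_eq_intros)
  have \<gamma>u: "((\<lambda>u. \<gamma> s u) has_vector_derivative axis j 1) (at u within S)" for s u S
    unfolding \<gamma>_def by (auto intro!: derivative_eq_intros)
  have ds: "((\<lambda>s. g (\<gamma> s u)) has_vector_derivative partial i g (\<gamma> s u)) (at s within S)"
    if "smooth_on r U g" "\<bar>s\<bar> \<le> \<delta>" "\<bar>u\<bar> \<le> \<delta>" for g s u S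
    using smooth_along_curve[OF that(1) U(1) _ \<gamma>s, of s u] \<gamma>U[OF that(2,3)] by (simp add: sum_axis_nth)
  have du: "((\<lambda>u. g (\<gamma> s u)) has_vector_derivative partial j g (\<gamma> s u)) (at u within S)"
    if "smooth_on r U g" "\<bar>s\<bar> \<le> \<delta>" "\<bar>u\<bar> \<le> \<delta>" for g s u S
    using smooth_along_curve[OF that(1) U(1) _ \<gamma>u, of s u] \<gamma>U[OF that(2,3)] by (simp add: sum_axis_nth)
  have cont: "continuous_on S (\<lambda>p. g (\<gamma> (fst p) (snd p)))"
    if "smooth_on r U g" "\<And>p. p \<in> S \<Longrightarrow> \<bar>fst p\<bar> \<le> \<delta> \<and> \<bar>snd p\<bar> \<le> \<delta>" for g S
    by (rule continuous_on_compose2[OF smooth_continuous_on[OF that(1) U(1)] \<gamma>_cont]) (use that(2) \<gamma>U in auto)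
  have cont1: "continuous_on {0..u} (\<lambda>v. g (\<gamma> s v))"
    if "smooth_on r U g" "\<bar>s\<bar> \<le> \<delta>" "u \<le> \<delta>" for g s u
    by (rule continuous_on_vector_derivative[OF du[OF that(1)]]) (use that in auto)
  note sj = smooth_partial[OF f, of j]
  have main: "partial i f (\<gamma> 0 u) = partial i f (\<gamma> 0 0) + integral {0..u} (\<lambda>v. partial i (partial j f) (\<gamma> 0 v))"
    if u: "0 \<le> u" "u \<le> \<delta>" for u
  proof -
    define \<Sigma> where "\<Sigma> = {-\<delta>..\<delta>}"
    have ftc: "f (\<gamma> s 0) + integral (cbox 0 u) (\<lambda>v. partial j f (\<gamma> s v)) = f (\<gamma> s u)" if "s \<in> \<Sigma>" for s
    proof -
      have "((\<lambda>v. partial j f (\<gamma> s v)) has_integral (f (\<gamma> s u) - f (\<gamma> s 0))) {0..u}"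
        by (rule fundamental_theorem_of_calculus) (use u that du[OF f] in \<open>auto simp: \<Sigma>_def\<close>)
      then show ?thesis by (simp add: integral_unique)
    qed
    have "((\<lambda>s. integral (cbox 0 u) (\<lambda>v. partial j f (\<gamma> s v))) has_vector_derivative
        integral (cbox 0 u) (\<lambda>v. partial i (partial j f) (\<gamma> 0 v))) (at 0 within \<Sigma>)"
    proof (rule leibniz_rule_vector_derivative)
      show "((\<lambda>s. partial j f (\<gamma> s v)) has_vector_derivative partial i (partial j f) (\<gamma> s v)) (at s within \<Sigma>)"
        if "s \<in> \<Sigma>" "v \<in> cbox 0 u" for s v
        using ds[OF sj, of s v] that u by (auto simp: \<Sigma>_def)
      show "(\<lambda>v. partial j f (\<gamma> s v)) integrable_on cbox 0 u" if "s \<in> \<Sigma>" for s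
        using cont1[OF sj, of s u] that u by (auto simp: \<Sigma>_def intro!: integrable_continuous_interval)
      show "continuous_on (\<Sigma> \<times> cbox 0 u) (\<lambda>(s, v). partial i (partial j f) (\<gamma> s v))"
        unfolding case_prod_beta by (rule cont[OF smooth_partial[OF sj]]) (use u in \<open>auto simp: \<Sigma>_def\<close>)
    qed (use \<delta> in \<open>auto simp: \<Sigma>_def\<close>)
    then have "((\<lambda>s. f (\<gamma> s 0) + integral (cbox 0 u) (\<lambda>v. partial j f (\<gamma> s v))) has_vector_derivative
       (partial i f (\<gamma> 0 0) + integral (cbox 0 u) (\<lambda>v. partial i (partial j f) (\<gamma> 0 v)))) (at 0 within \<Sigma>)"
      by (intro has_vector_derivative_add ds[OF f]) (use \<delta> in auto)
    then have "((\<lambda>s. f (\<gamma> s u)) has_vector_derivative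
       (partial i f (\<gamma> 0 0) + integral (cbox 0 u) (\<lambda>v. partial i (partial j f) (\<gamma> 0 v)))) (at 0 within \<Sigma>)"
      by (rule has_vector_derivative_transform[rotated 2]) (use ftc \<delta> in \<open>auto simp: \<Sigma>_def\<close>)
    moreover have "((\<lambda>s. f (\<gamma> s u)) has_vector_derivative partial i f (\<gamma> 0 u)) (at 0 within \<Sigma>)"
      by (rule ds[OF f]) (use u \<delta> in auto)
    ultimately have "partial i f (\<gamma> 0 u) = partial i f (\<gamma> 0 0) + integral (cbox 0 u) (\<lambda>v. partial i (partial j f) (\<gamma> 0 v))"
      using \<delta> unfolding \<Sigma>_def
      by (intro vector_derivative_unique_within_closed_interval[of "-\<delta>" \<delta> 0]) auto
    then show ?thesis by simp
  qed
  have "((\<lambda>u. integral {0..u} (\<lambda>v. partial i (partial j f) (\<gamma> 0 v))) has_vector_derivative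
      partial i (partial j f) (\<gamma> 0 0)) (at 0 within {0..\<delta>})"
    by (rule integral_has_vector_derivative[OF cont1[OF smooth_partial[OF sj]]]) (use \<delta> in auto)
  then have "((\<lambda>u. partial i f (\<gamma> 0 0) + integral {0..u} (\<lambda>v. partial i (partial j f) (\<gamma> 0 v))) has_vector_derivative
      0 + partial i (partial j f) (\<gamma> 0 0)) (at 0 within {0..\<delta>})"
    by (intro has_vector_derivative_add has_vector_derivative_const)
  then have "((\<lambda>u. partial i f (\<gamma> 0 u)) has_vector_derivative partial i (partial j f) (\<gamma> 0 0)) (at 0 within {0..\<delta>})"
    unfolding add_0_left by (rule has_vector_derivative_transform[rotated 2]) (use \<delta> in simp, rule main, auto)
  moreover have "((\<lambda>u. partial i f (\<gamma> 0 u)) has_vector_derivative partial j (partial i f) (\<gamma> 0 0)) (at 0 within {0..\<delta>})"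
    by (rule du[OF smooth_partial[OF f]]) (use \<delta> in auto)
  ultimately have "partial i (partial j f) (\<gamma> 0 0) = partial j (partial i f) (\<gamma> 0 0)"
    using \<delta> by (intro vector_derivative_unique_within_closed_interval[of 0 \<delta> 0]) auto
  then show ?thesis by (simp add: \<gamma>_def)
qed

end

section \<open>Determinants and forms of top degree\<close>

definition replace_row :: "'k^'q^'q \<Rightarrow> 'q \<Rightarrow> 'k^'q \<Rightarrow> 'k^'q^'q"
  where "replace_row A r v = (\<chi> i. if i = r then v else A $ i)"

lemma replace_row_nth [simp]: "replace_row A r v $ i = (if i = r then v else A $ i)"
  by (simp add: replace_row_def)

lemma replace_row_same [simp]: "replace_row A r (A $ r) = A"
  by (simp add: vec_eq_iff)

definition alternating_rows :: "('k::field^'q^'q \<Rightarrow> 'k) \<Rightarrow> bool"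
  where "alternating_rows D \<longleftrightarrow>
    (\<forall>A r v w. D (replace_row A r (v + w)) = D (replace_row A r v) + D (replace_row A r w)) \<and>
    (\<forall>A r c v. D (replace_row A r (c *s v)) = c * D (replace_row A r v)) \<and>
    (\<forall>A r s. r \<noteq> s \<longrightarrow> A $ r = A $ s \<longrightarrow> D A = 0)"

lemma alternating_rows_add: "alternating_rows D \<Longrightarrow> D (replace_row A r (v + w)) = D (replace_row A r v) + D (replace_row A r w)"
  and alternating_rows_scale: "alternating_rows D \<Longrightarrow> D (replace_row A r (c *s v)) = c * D (replace_row A r v)"
  and alternating_rows_equal: "alternating_rows D \<Longrightarrow> r \<noteq> s \<Longrightarrow> A $ r = A $ s \<Longrightarrow> D A = 0"
  by (simp_all add: alternating_rows_def)

lemma alternating_rows_zero: "alternating_rows D \<Longrightarrow> D (replace_row A r 0) = 0"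
  using alternating_rows_scale[of D A r 0 0] by simp

lemma alternating_rows_sum:
  assumes "alternating_rows D" "finite J"
  shows "D (replace_row A r (\<Sum>j\<in>J. c j *s v j)) = (\<Sum>j\<in>J. c j * D (replace_row A r (v j)))"
  using assms(2) by (induction J)
    (simp_all add: alternating_rows_zero[OF assms(1)] alternating_rows_add[OF assms(1)] alternating_rows_scale[OF assms(1)])

lemma alternating_rows_swap:
  assumes D: "alternating_rows D" and rs: "r \<noteq> s"
  shows "D (replace_row (replace_row A r x) s y) = - D (replace_row (replace_row A r y) s x)"
proof -
  let ?R = "\<lambda>x y. replace_row (replace_row A r x) s y"
  have comm: "?R x y = replace_row (replace_row A s y) r x" for x y
    using rs by (auto simp: vec_eq_iff)
  have same: "D (?R x x) = 0" for x
    by (rule alternating_rows_equal[OF D rs]) simp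
  have "0 = D (?R (x + y) (x + y))" by (simp only: same)
  also have "\<dots> = D (?R (x + y) x) + D (?R (x + y) y)" by (rule alternating_rows_add[OF D])
  also have "\<dots> = D (?R x y) + D (?R y x)"
    unfolding comm alternating_rows_add[OF D] unfolding comm[symmetric] by (simp add: same)
  finally show ?thesis unfolding eq_neg_iff_add_eq_0 by (rule sym)
qed

lemma vec_eq_sum_axis_scale: "(v::'k::semiring_1^'m) = (\<Sum>j\<in>UNIV. v $ j *s axis j 1)"
  by (simp add: vec_eq_iff axis_def if_distrib cong: if_cong)

text \<open>
  By linearity in one row after another, every row may be taken to be a basis vector; if two rows agree the
  value is $0$, and otherwise the rows are a permutation of the basis and transpositions only change the sign.
\<close>

lemma alternating_rows_eq_0:
  fixes D :: "'k::field^'q^'q \<Rightarrow> 'k"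
  assumes D: "alternating_rows D" and unit: "D (mat 1) = 0"
  shows "D A = 0"
proof -
  let ?P = "\<lambda>p :: 'q \<Rightarrow> 'q. \<chi> i. axis (p i) (1::'k)"
  have perm: "D (?P p) = 0" if "p permutes UNIV" for p
    using that finite
  proof (induction rule: permutes_induct)
    case id
    have "?P id = mat 1" by (auto simp: vec_eq_iff mat_def axis_def)
    then show ?case using unit by simp
  next
    case (swap a b p)
    obtain r s where rs: "p r = a" "p s = b"
      using permutes_surj[OF \<open>p permutes UNIV\<close>] by (metis surjD)
    have "r \<noteq> s" using rs swap by auto
    have inj: "p i = p j \<longleftrightarrow> i = j" for i j
      using permutes_inj[OF \<open>p permutes UNIV\<close>] by (auto simp: inj_def)
    have "?P (Transposition.transpose a b \<circ> p) = replace_row (replace_row (?P p) r (axis b 1)) s (axis a 1)"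
      using \<open>r \<noteq> s\<close> inj unfolding rs[symmetric] by (auto simp: vec_eq_iff Transposition.transpose_def)
    moreover have "?P p = replace_row (replace_row (?P p) r (axis a 1)) s (axis b 1)"
      using rs by (auto simp: vec_eq_iff)
    ultimately show ?case
      using alternating_rows_swap[OF D \<open>r \<noteq> s\<close>, of "?P p" "axis b 1" "axis a 1"] swap by simp
  qed
  have axes: "D (?P p) = 0" for p
  proof (cases "inj p")
    case True
    then have "p permutes UNIV"
      using finite_UNIV_inj_surj[OF finite] by (intro bij_imp_permutes) (auto simp: bij_def)
    then show ?thesis by (rule perm)
  next
    case False
    then obtain r s where "r \<noteq> s" "p r = p s" by (auto simp: inj_def)
    then show ?thesis by (intro alternating_rows_equal[OF D \<open>r \<noteq> s\<close>]) simp
  qed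
  have "\<forall>A. (\<forall>i. i \<notin> S \<longrightarrow> (\<exists>j. A $ i = axis j 1)) \<longrightarrow> D A = 0" if "finite S" for S
    using that
  proof (induction S)
    case empty
    show ?case
    proof (intro allI impI)
      fix A :: "'k^'q^'q" assume "\<forall>i. i \<notin> {} \<longrightarrow> (\<exists>j. A $ i = axis j 1)"
      then obtain p where "\<And>i. A $ i = axis (p i) 1" by auto metis
      then have "A = ?P p" by (simp add: vec_eq_iff)
      then show "D A = 0" using axes by simp
    qed
  next
    case (insert r S)
    show ?case
    proof (intro allI impI)
      fix A :: "'k^'q^'q" assume A: "\<forall>i. i \<notin> insert r S \<longrightarrow> (\<exists>j. A $ i = axis j 1)"
      have "D A = D (replace_row A r (\<Sum>j\<in>UNIV. A $ r $ j *s axis j 1))"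
        by (simp flip: vec_eq_sum_axis_scale)
      also have "\<dots> = (\<Sum>j\<in>UNIV. A $ r $ j * D (replace_row A r (axis j 1)))"
        by (rule alternating_rows_sum[OF D]) simp
      also have "\<dots> = 0"
      proof (intro sum.neutral ballI)
        fix j
        have "\<forall>i. i \<notin> S \<longrightarrow> (\<exists>k. replace_row A r (axis j 1) $ i = axis k 1)"
          using A by auto
        then show "A $ r $ j * D (replace_row A r (axis j 1)) = 0" using insert.IH by simp
      qed
      finally show "D A = 0" .
    qed
  qed
  from this[of UNIV] show ?thesis by simp
qed

lemma alternating_rows_det: "alternating_rows (det :: 'k::field^'q^'q \<Rightarrow> 'k)"
  unfolding alternating_rows_def replace_row_def
proof (intro conjI allI impI)
  fix A :: "'k^'q^'q" and r s assume "r \<noteq> s" "A $ r = A $ s"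
  then show "det A = 0" by (intro det_identical_rows[of r s]) (simp_all add: row_def)
qed (simp_all add: det_row_add det_row_mul)

lemma alternating_rows_eq_det:
  fixes D :: "'k::field^'q^'q \<Rightarrow> 'k"
  assumes D: "alternating_rows D"
  shows "D A = D (mat 1) * det A"
proof -
  have "alternating_rows (\<lambda>A. D A - D (mat 1) * det A)"
    using D alternating_rows_det[where 'k='k and 'q='q] unfolding alternating_rows_def
    by (simp add: algebra_simps)
  then have "D A - D (mat 1) * det A = 0"
    by (rule alternating_rows_eq_0) simp
  then show ?thesis by simp
qed

text \<open>
  The derivative of \<open>det\<close> at \<open>P\<close> in the direction \<open>Q\<close>.
\<close>

definition det_variation :: "'k::field^'q^'q \<Rightarrow> 'k^'q^'q \<Rightarrow> 'k"
  where "det_variation P Q = (\<Sum>r\<in>UNIV. det (replace_row P r (Q $ r)))"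

lemma det_variation_mult_left:
  fixes P :: "'k::field^'q^'q"
  shows "det_variation P (A ** P) = trace A * det P"
proof -
  have "det (replace_row P r ((A ** P) $ r)) = A $ r $ r * det P" for r
  proof -
    have "(A ** P) $ r = (\<Sum>s\<in>UNIV. A $ r $ s *s P $ s)"
      by (simp add: matrix_matrix_mult_def vec_eq_iff)
    then have "det (replace_row P r ((A ** P) $ r)) = (\<Sum>s\<in>UNIV. A $ r $ s * det (replace_row P r (P $ s)))"
      using alternating_rows_sum[OF alternating_rows_det finite] by metis
    also have "\<dots> = (\<Sum>s\<in>UNIV. if s = r then A $ r $ r * det P else 0)"
    proof (rule sum.cong[OF refl])
      fix s
      have "det (replace_row P r (P $ s)) = 0" if "s \<noteq> r"
        using that by (intro alternating_rows_equal[OF alternating_rows_det that]) simp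
      then show "A $ r $ s * det (replace_row P r (P $ s)) = (if s = r then A $ r $ r * det P else 0)"
        by simp
    qed
    finally show ?thesis by simp
  qed
  then show ?thesis by (simp add: det_variation_def trace_def sum_distrib_right)
qed

lemma has_derivative_det:
  fixes A :: "'a::real_normed_vector \<Rightarrow> 'k::real_normed_field^'q^'q"
  assumes "\<And>i j. ((\<lambda>x. A x $ i $ j) has_derivative (\<lambda>v. A' v $ i $ j)) (at x within S)"
  shows "((\<lambda>x. det (A x)) has_derivative (\<lambda>v. det_variation (A x) (A' v))) (at x within S)"
proof -
  let ?P = "{p. p permutes (UNIV :: 'q set)}"
  have "((\<lambda>x. \<Sum>p\<in>?P. of_int (sign p) * (\<Prod>i\<in>UNIV. A x $ i $ p i)) has_derivative
     (\<lambda>v. \<Sum>p\<in>?P. of_int (sign p) * (\<Sum>r\<in>UNIV. A' v $ r $ p r * (\<Prod>i\<in>UNIV - {r}. A x $ i $ p i)))) (at x within S)"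
    by (intro has_derivative_sum has_derivative_mult_right has_derivative_prod assms)
  moreover have "(\<Sum>p\<in>?P. of_int (sign p) * (\<Sum>r\<in>UNIV. Q $ r $ p r * (\<Prod>i\<in>UNIV - {r}. A x $ i $ p i)))
      = det_variation (A x) Q" for Q
  proof -
    have "(\<Prod>i\<in>UNIV. replace_row (A x) r (Q $ r) $ i $ p i) = Q $ r $ p r * (\<Prod>i\<in>UNIV - {r}. A x $ i $ p i)" for r p
      by (subst prod.remove[of _ r]) (auto intro!: prod.cong)
    then show ?thesis
      by (simp add: det_variation_def det_def sum_distrib_left sum.swap[of _ ?P])
  qed
  ultimately show ?thesis by (simp add: det_def)
qed

lemma has_vector_derivative_det_line:
  fixes P Q :: "'k::real_normed_field^'q^'q"
  shows "((\<lambda>t. det (\<chi> i j. P $ i $ j + of_real t * Q $ i $ j)) has_vector_derivative det_variation P Q) (at 0)"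
proof -
  have "((\<lambda>t. det (\<chi> i j. P $ i $ j + of_real t * Q $ i $ j)) has_derivative
      (\<lambda>h. det_variation (\<chi> i j. P $ i $ j + of_real 0 * Q $ i $ j) (\<chi> i j. of_real h * Q $ i $ j))) (at 0)"
    by (rule has_derivative_det) (auto intro!: derivative_eq_intros)
  moreover have "(\<chi> i j. P $ i $ j + of_real 0 * Q $ i $ j) = P" by (simp add: vec_eq_iff)
  moreover have "det_variation P (\<chi> i j. of_real h * Q $ i $ j) = h *\<^sub>R det_variation P Q" for h
  proof -
    have "(\<chi> i j. of_real h * Q $ i $ j) $ r = of_real h *s Q $ r" for r by (simp add: vec_eq_iff)
    then show ?thesis
      by (simp add: det_variation_def alternating_rows_scale[OF alternating_rows_det] scaleR_conv_of_real sum_distrib_left)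
  qed
  ultimately show ?thesis by (simp add: has_vector_derivative_def)
qed

text \<open>
  Differentiate \<open>det (P ** (mat 1 + t B)) = det P * det (mat 1 + t B)\<close> at \<open>t = 0\<close>; singular \<open>P\<close> is thereby
  included.
\<close>

lemma det_variation_mult_right:
  fixes P :: "'k::real_normed_field^'q^'q"
  shows "det_variation P (P ** B) = trace B * det P"
proof -
  have split: "(\<chi> i j. P $ i $ j + of_real t * (P ** B) $ i $ j) = P ** (\<chi> i j. mat 1 $ i $ j + of_real t * B $ i $ j)" for t :: real
  proof -
    have "(\<Sum>k\<in>UNIV. P $ i $ k * mat 1 $ k $ j) = P $ i $ j" for i j
      using arg_cong[OF matrix_mul_rid[of P], of "\<lambda>M. M $ i $ j"] by (simp add: matrix_matrix_mult_def)
    then show ?thesis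
      by (simp add: vec_eq_iff matrix_matrix_mult_def distrib_left sum.distrib sum_distrib_left mult_ac)
  qed
  have "((\<lambda>t. det P * det (\<chi> i j. mat 1 $ i $ j + of_real t * B $ i $ j)) has_vector_derivative det P * det_variation (mat 1) B) (at 0)"
    by (intro has_vector_derivative_mult_right has_vector_derivative_det_line)
  moreover have "((\<lambda>t. det P * det (\<chi> i j. mat 1 $ i $ j + of_real t * B $ i $ j)) has_vector_derivative det_variation P (P ** B)) (at 0)"
    using has_vector_derivative_det_line[of P "P ** B"] by (simp only: split det_mul)
  ultimately have "det_variation P (P ** B) = det P * det_variation (mat 1) B"
    using vector_derivative_unique_at by blast
  also have "det_variation (mat 1) B = trace B"
    using det_variation_mult_left[of "mat 1" B] by simp
  finally show ?thesis by (simp add: mult.commute)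
qed

text \<open>
  Forms take lists of vectors whereas matrices are indexed by \<open>'q\<close>; a fixed enumeration of the indices
  translates between the two.
\<close>

definition index_position :: "'q::finite \<Rightarrow> nat"
  where "index_position = (SOME f. bij_betw f UNIV {..<CARD('q)})"

lemma index_position_bij: "bij_betw (index_position :: 'q::finite \<Rightarrow> nat) UNIV {..<CARD('q)}"
proof -
  have "\<exists>f. bij_betw f (UNIV :: 'q set) {..<CARD('q)}"
    using ex_bij_betw_finite_nat[OF finite, of "UNIV :: 'q set"] by (simp add: atLeast0LessThan)
  then show ?thesis unfolding index_position_def by (rule someI_ex)
qed

lemma index_position_less: "index_position (i::'q::finite) < CARD('q)"
  using index_position_bij[where 'q='q] by (auto simp: bij_betw_def)

lemma index_position_eq [simp]: "index_position i = index_position j \<longleftrightarrow> i = j"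
  using index_position_bij by (auto simp: bij_betw_def inj_def)

definition rows_to_matrix :: "('k^'q) list \<Rightarrow> 'k^'q^'q"
  where "rows_to_matrix vs = (\<chi> i. vs ! index_position i)"

definition matrix_to_rows :: "'k^'q^'q \<Rightarrow> ('k^'q) list"
  where "matrix_to_rows A = map (\<lambda>n. A $ inv index_position n) [0..<CARD('q)]"

lemma length_matrix_to_rows [simp]: "length (matrix_to_rows (A::'k^'q^'q)) = CARD('q)"
  by (simp add: matrix_to_rows_def)

lemma inv_index_position [simp]: "inv index_position (index_position i) = i"
  by (rule inv_f_f) (auto simp: inj_def)

lemma index_position_inv: "n < CARD('q) \<Longrightarrow> index_position (inv index_position n :: 'q::finite) = n"
  using index_position_bij[where 'q='q] by (intro f_inv_into_f) (auto simp: bij_betw_def)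

lemma rows_to_matrix_to_rows [simp]: "rows_to_matrix (matrix_to_rows A) = A"
  by (simp add: rows_to_matrix_def matrix_to_rows_def vec_eq_iff index_position_less)

lemma matrix_to_rows_to_matrix [simp]: "length vs = CARD('q) \<Longrightarrow> matrix_to_rows (rows_to_matrix vs :: 'k^'q^'q) = vs"
  by (rule nth_equalityI) (auto simp: matrix_to_rows_def rows_to_matrix_def index_position_inv)

lemma matrix_to_rows_replace_row: "matrix_to_rows (replace_row A r v :: 'k^'q^'q) = (matrix_to_rows A)[index_position r := v]"
proof (rule nth_equalityI)
  fix n assume "n < length (matrix_to_rows (replace_row A r v))"
  then have n: "n < CARD('q)" by simp
  then have "inv index_position n = r \<longleftrightarrow> n = index_position r"
    using index_position_inv inv_index_position by metis
  then show "matrix_to_rows (replace_row A r v) ! n = (matrix_to_rows A)[index_position r := v] ! n"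
    using n by (simp add: matrix_to_rows_def nth_list_update)
qed simp

lemma rows_to_matrix_update: "length vs = CARD('q) \<Longrightarrow> rows_to_matrix (vs[index_position r := v]) = (replace_row (rows_to_matrix vs) r v :: 'k^'q^'q)"
  by (auto simp: vec_eq_iff rows_to_matrix_def nth_list_update index_position_less)

lemma alternating_multilinearD:
  assumes "alternating_multilinear k \<omega>" "length vs = k" "i < k"
  shows "\<omega> (vs[i := v + w]) = \<omega> (vs[i := v]) + \<omega> (vs[i := w])"
    and "\<omega> (vs[i := c *s v]) = c * \<omega> (vs[i := v])"
proof -
  have "Vector_Spaces.linear (*s) (*) (\<lambda>v. \<omega> (vs[i := v]))"
    using assms unfolding alternating_multilinear_def by blast
  then show "\<omega> (vs[i := v + w]) = \<omega> (vs[i := v]) + \<omega> (vs[i := w])"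
    and "\<omega> (vs[i := c *s v]) = c * \<omega> (vs[i := v])"
    by (simp_all add: Vector_Spaces.linear_iff)
qed

lemma alternating_multilinear_equal:
  assumes "alternating_multilinear k \<omega>" "length vs = k" "i < k" "j < k" "i \<noteq> j" "vs ! i = vs ! j"
  shows "\<omega> vs = 0"
  using assms unfolding alternating_multilinear_def by blast

lemma alternating_multilinear_eq_det:
  fixes \<omega> :: "('k::field^'q) list \<Rightarrow> 'k"
  assumes \<omega>: "alternating_multilinear CARD('q) \<omega>" and len: "length vs = CARD('q)"
  shows "\<omega> vs = \<omega> (matrix_to_rows (mat 1)) * det (rows_to_matrix vs)"
proof -
  have "alternating_rows (\<lambda>A. \<omega> (matrix_to_rows A))"
    unfolding alternating_rows_def matrix_to_rows_replace_row
  proof (intro conjI allI impI)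
    fix A :: "'k^'q^'q" and r s assume "r \<noteq> s" "A $ r = A $ s"
    then show "\<omega> (matrix_to_rows A) = 0"
      by (intro alternating_multilinear_equal[OF \<omega>, of _ "index_position r" "index_position s"])
         (auto simp: index_position_less matrix_to_rows_def)
  qed (simp_all add: alternating_multilinearD[OF \<omega>] index_position_less)
  then have "\<omega> (matrix_to_rows (rows_to_matrix vs)) = \<omega> (matrix_to_rows (mat 1)) * det (rows_to_matrix vs :: 'k^'q^'q)"
    by (rule alternating_rows_eq_det)
  then show ?thesis using len by simp
qed

lemma alternating_multilinear_det:
  "alternating_multilinear CARD('q) (\<lambda>vs. det (rows_to_matrix vs :: 'k::field^'q^'q))"
  unfolding alternating_multilinear_def
proof (intro allI impI conjI)
  fix vs :: "('k^'q) list" and i assume len: "length vs = CARD('q)" and i: "i < CARD('q)"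
  obtain r :: 'q where r: "i = index_position r" using index_position_inv[OF i] by metis
  show "Vector_Spaces.linear (*s) (*) (\<lambda>v. det (rows_to_matrix (vs[i := v]) :: 'k^'q^'q))"
    unfolding Vector_Spaces.linear_iff r rows_to_matrix_update[OF len]
    by (simp add: alternating_rows_add[OF alternating_rows_det] alternating_rows_scale[OF alternating_rows_det]
      vec.vector_space_axioms vector_space_over_itself.vector_space_axioms)
next
  fix vs :: "('k^'q) list" and i j
  assume len: "length vs = CARD('q)" and i: "i < CARD('q)" and j: "j < CARD('q)" and eq: "i \<noteq> j \<and> vs ! i = vs ! j"
  obtain r s :: 'q where "i = index_position r" "j = index_position s" using index_position_inv[OF i] index_position_inv[OF j] by metis
  with eq show "det (rows_to_matrix vs :: 'k^'q^'q) = 0"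
    by (intro alternating_rows_equal[OF alternating_rows_det, of r s]) (auto simp: rows_to_matrix_def)
qed

lemma alternating_multilinear_swap:
  assumes \<omega>: "alternating_multilinear k \<omega>" and len: "length vs = k" and i: "i < k" "j < k" "i \<noteq> j"
  shows "\<omega> (vs[i := x, j := y]) = - \<omega> (vs[i := y, j := x])"
proof -
  have same: "\<omega> (vs[i := x, j := x]) = 0" for x
    by (rule alternating_multilinear_equal[OF \<omega> _ i(1,2,3)]) (use len i in simp_all)
  have addj: "\<omega> (vs[i := z, j := v + w]) = \<omega> (vs[i := z, j := v]) + \<omega> (vs[i := z, j := w])" for z v w
    by (rule alternating_multilinearD[OF \<omega>]) (use len i in simp_all)
  have addi: "\<omega> (vs[i := v + w, j := z]) = \<omega> (vs[i := v, j := z]) + \<omega> (vs[i := w, j := z])" for z v w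
    unfolding list_update_swap[OF i(3)] by (rule alternating_multilinearD[OF \<omega>]) (use len i in simp_all)
  have "0 = \<omega> (vs[i := x + y, j := x + y])" by (simp only: same)
  also have "\<dots> = \<omega> (vs[i := x, j := y]) + \<omega> (vs[i := y, j := x])"
    by (simp only: addi addj) (simp add: same)
  finally show ?thesis unfolding eq_neg_iff_add_eq_0 by (rule sym)
qed

text \<open>
  Moving the first argument to position \<open>j\<close> takes \<open>j\<close> transpositions of neighbours.
\<close>

lemma alternating_multilinear_move:
  assumes \<omega>: "alternating_multilinear (Suc n) \<omega>" and len: "length ws = n" and "j \<le> n"
  shows "\<omega> (u # ws) = (- 1) ^ j * \<omega> (take j ws @ u # drop j ws)"
  using \<open>j \<le> n\<close>
proof (induction j)
  case (Suc j)
  then have j: "j < length ws" using len by simp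
  define a b where "a = take j ws" and "b = drop (Suc j) ws"
  define w where "w = ws ! j"
  have la: "length a = j" using j by (simp add: a_def)
  have ws: "drop j ws = w # b" "take (Suc j) ws = a @ [w]"
    using j by (simp_all add: a_def b_def w_def Cons_nth_drop_Suc take_Suc_conv_app_nth)
  have lb: "length b = n - Suc j" using len by (simp add: b_def)
  have eq1: "(a @ u # w # b)[j := u, Suc j := w] = a @ u # w # b"
    and eq2: "(a @ u # w # b)[j := w, Suc j := u] = a @ w # u # b"
    using la by (simp_all add: list_update_append)
  have "\<omega> (a @ u # w # b) = - \<omega> (a @ w # u # b)"
    using alternating_multilinear_swap[OF \<omega>, of "a @ u # w # b" j "Suc j" u w] j len la lb
    unfolding eq1 eq2 by simp
  then show ?case using Suc by (simp add: ws a_def[symmetric] b_def[symmetric])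
qed simp

lemma alternating_multilinear_front_to_position:
  assumes \<omega>: "alternating_multilinear k \<omega>" and len: "length vs = k" and i: "i < k"
  shows "\<omega> (u # take i vs @ drop (Suc i) vs) = (- 1) ^ i * \<omega> (vs[i := u])"
proof -
  obtain n where n: "k = Suc n" using i by (cases k) auto
  let ?ws = "take i vs @ drop (Suc i) vs"
  have "\<omega> (u # ?ws) = (- 1) ^ i * \<omega> (take i ?ws @ u # drop i ?ws)"
    by (rule alternating_multilinear_move[OF \<omega>[unfolded n]]) (use len i n in auto)
  moreover have "take i ?ws @ u # drop i ?ws = vs[i := u]"
    using len i by (simp add: upd_conv_take_nth_drop)
  ultimately show ?thesis by simp
qed

lemma rows_to_matrix_map:
  assumes "length vs = CARD('q)" "\<And>v. F v = A *v v"
  shows "rows_to_matrix (map F vs) = (rows_to_matrix vs ** Finite_Cartesian_Product.transpose A :: 'k::comm_semiring_1^'q^'q)"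
  using assms by (simp add: vec_eq_iff rows_to_matrix_def index_position_less matrix_vector_mult_def
      matrix_matrix_mult_def Finite_Cartesian_Product.transpose_def mult.commute)

definition form_density :: "('k::real_normed_field^'q \<Rightarrow> ('k^'q) list \<Rightarrow> 'k) \<Rightarrow> 'k^'q \<Rightarrow> 'k"
  where "form_density \<Omega> x = \<Omega> x (matrix_to_rows (mat 1))"

lemma volume_form_density:
  assumes "volume_form r (\<Omega> :: 'k::real_normed_field^'q \<Rightarrow> _)"
  obtains U where "open U" "0 \<in> U" "smooth_on r U (form_density \<Omega>)" "\<And>x. x \<in> U \<Longrightarrow> form_density \<Omega> x \<noteq> 0"
    "\<And>x vs. x \<in> U \<Longrightarrow> length vs = CARD('q) \<Longrightarrow> \<Omega> x vs = form_density \<Omega> x * det (rows_to_matrix vs)"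
proof -
  obtain U where U: "open U" "0 \<in> U"
      "\<And>x. x \<in> U \<Longrightarrow> alternating_multilinear CARD('q) (\<Omega> x)"
      "\<And>x. x \<in> U \<Longrightarrow> \<exists>vs. length vs = CARD('q) \<and> \<Omega> x vs \<noteq> 0"
      "\<And>vs. length vs = CARD('q) \<Longrightarrow> smooth_on r U (\<lambda>x. \<Omega> x vs)"
    using assms unfolding volume_form_def by blast
  have eq: "\<Omega> x vs = form_density \<Omega> x * det (rows_to_matrix vs)" if "x \<in> U" "length vs = CARD('q)" for x vs
    unfolding form_density_def by (rule alternating_multilinear_eq_det[OF U(3)[OF that(1)] that(2)])
  show thesis
  proof (rule that[OF U(1,2) _ _ eq])
    show "smooth_on r U (form_density \<Omega>)" unfolding form_density_def[abs_def] by (rule U(5)) simp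
    show "form_density \<Omega> x \<noteq> 0" if "x \<in> U" for x using U(4)[OF that] eq[OF that] by auto
  qed
qed

definition divergence :: "('k::real_normed_field^'q \<Rightarrow> 'k^'q) \<Rightarrow> 'k^'q \<Rightarrow> 'k"
  where "divergence X x = (\<Sum>m\<in>UNIV. partial m (\<lambda>y. X y $ m) x)"

context smooth_category begin

lemma partial_det:
  fixes A :: "'k^'m \<Rightarrow> 'k^'n^'n"
  assumes "\<And>i j. smooth_on r U (\<lambda>x. A x $ i $ j)" "open U" "x \<in> U"
  shows "partial m (\<lambda>x. det (A x)) x = det_variation (A x) (\<chi> i j. partial m (\<lambda>x. A x $ i $ j) x)"
proof -
  have "((\<lambda>x. det (A x)) has_derivative
     (\<lambda>v. det_variation (A x) (\<chi> i j. \<Sum>k\<in>UNIV. partial k (\<lambda>x. A x $ i $ j) x * v $ k))) (at x)"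
    by (rule has_derivative_det) (use smooth_has_derivative[OF assms] in simp)
  from partialI[OF this, of m] show ?thesis by (simp add: sum_axis_nth)
qed

text \<open>
  Near \<open>x\<close> the contracted form is $\det(wX, \dots)$, so with $J = D(wX)(x)$ the \<open>i\<close>-th term of the exterior
  derivative is the determinant of \<open>vs\<close> with $J v_i$ put in front and $v_i$ left out.  Moving $J v_i$ to
  position \<open>i\<close> cancels the sign $(-1)^i$, and the sum over \<open>i\<close> is the variation of the determinant by $J$,
  which is $\mathrm{tr}\,J\,\det$.
\<close>

lemma exterior_derivative_contraction:
  fixes \<Omega> :: "'k^'q \<Rightarrow> ('k^'q) list \<Rightarrow> 'k"
  assumes U: "open U" "x \<in> U" and w: "smooth_on r U w" and X: "\<And>j. smooth_on r U (\<lambda>y. X y $ j)"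
    and \<Omega>: "\<And>y vs. y \<in> U \<Longrightarrow> length vs = CARD('q) \<Longrightarrow> \<Omega> y vs = w y * det (rows_to_matrix vs)"
    and len: "length vs = CARD('q)"
  shows "exterior_derivative (X \<rfloor> \<Omega>) x vs = divergence (\<lambda>y. w y *s X y) x * det (rows_to_matrix vs)"
proof -
  let ?det = "\<lambda>vs. det (rows_to_matrix vs :: 'k^'q^'q)"
  note alt = alternating_multilinear_det[where 'k='k and 'q='q]
  define J where "J = (\<chi> m k. partial k (\<lambda>y. w y * X y $ m) x)"
  have sm: "smooth_on r U (\<lambda>y. w y * X y $ m)" for m
    by (intro smooth_mult w X U)
  have "(- 1) ^ i * frechet_derivative (\<lambda>y. (X \<rfloor> \<Omega>) y (take i vs @ drop (Suc i) vs)) (at x) (vs ! i)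
      = ?det (vs[i := J *v (vs ! i)])" if i: "i < CARD('q)" for i
  proof -
    define ws where "ws = take i vs @ drop (Suc i) vs"
    have lws: "length (v # ws) = CARD('q)" for v using len i by (simp add: ws_def)
    define d where "d m = ?det (axis m 1 # ws)" for m
    have lin: "?det (v # ws) = (\<Sum>m\<in>UNIV. v $ m * d m)" for v
    proof -
      have front: "?det (v # ws) = (- 1) ^ i * ?det (vs[i := v])" for v
        unfolding ws_def by (rule alternating_multilinear_front_to_position[OF alt len i])
      obtain r :: 'q where r: "i = index_position r" using index_position_inv[OF i] by metis
      have "?det (vs[i := v]) = (\<Sum>m\<in>UNIV. v $ m * ?det (vs[i := axis m 1]))"
        unfolding r rows_to_matrix_update[OF len]
        using alternating_rows_sum[OF alternating_rows_det finite, of "rows_to_matrix vs" r "\<lambda>m. v $ m" "\<lambda>m. axis m 1" UNIV]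
        by (simp flip: vec_eq_sum_axis_scale)
      then show ?thesis by (simp add: d_def front sum_distrib_left mult_ac)
    qed
    have "((\<lambda>y. \<Sum>m\<in>UNIV. (w y * X y $ m) * d m) has_derivative
        (\<lambda>v. \<Sum>m\<in>UNIV. (\<Sum>k\<in>UNIV. partial k (\<lambda>y. w y * X y $ m) x * v $ k) * d m)) (at x)"
      by (intro has_derivative_sum has_derivative_mult_left smooth_has_derivative[OF sm U])
    moreover have "(\<Sum>m\<in>UNIV. (w y * X y $ m) * d m) = (X \<rfloor> \<Omega>) y ws" if "y \<in> U" for y
      using \<Omega>[OF that lws] by (simp add: contraction_def lin sum_distrib_left mult_ac)
    ultimately have "((\<lambda>y. (X \<rfloor> \<Omega>) y ws) has_derivative
        (\<lambda>v. \<Sum>m\<in>UNIV. (\<Sum>k\<in>UNIV. partial k (\<lambda>y. w y * X y $ m) x * v $ k) * d m)) (at x)"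
      by (rule has_derivative_transform_within_open[OF _ U])
    then have "frechet_derivative (\<lambda>y. (X \<rfloor> \<Omega>) y ws) (at x) v = ?det (J *v v # ws)" for v
      by (simp add: lin J_def matrix_vector_mult_def flip: frechet_derivative_at)
    then have "(- 1) ^ i * frechet_derivative (\<lambda>y. (X \<rfloor> \<Omega>) y ws) (at x) (vs ! i)
        = ((- 1) ^ i * (- 1) ^ i) * ?det (vs[i := J *v (vs ! i)])"
      using alternating_multilinear_front_to_position[OF alt len i, of "J *v (vs ! i)"] by (simp add: ws_def mult.assoc)
    also have "((- 1) ^ i * (- 1) ^ i :: 'k) = 1" by (simp flip: power_mult_distrib)
    finally show ?thesis by (simp add: ws_def)
  qed
  then have "exterior_derivative (X \<rfloor> \<Omega>) x vs = (\<Sum>i<CARD('q). ?det (vs[i := J *v (vs ! i)]))"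
    by (simp add: exterior_derivative_def len)
  also have "\<dots> = (\<Sum>r\<in>(UNIV::'q set). ?det (vs[index_position r := J *v (vs ! index_position r)]))"
    by (rule sum.reindex_bij_betw[OF index_position_bij, where g="\<lambda>i. ?det (vs[i := J *v (vs ! i)])", symmetric])
  also have "\<dots> = det_variation (rows_to_matrix vs) (rows_to_matrix vs ** Finite_Cartesian_Product.transpose J)"
    unfolding det_variation_def rows_to_matrix_update[OF len]
    by (intro sum.cong refl arg_cong[where f=det] arg_cong[where f="replace_row _ _"])
       (simp add: rows_to_matrix_def vec_eq_iff matrix_vector_mult_def matrix_matrix_mult_def
         Finite_Cartesian_Product.transpose_def mult.commute)
  also have "\<dots> = trace (Finite_Cartesian_Product.transpose J) * ?det vs"
    by (rule det_variation_mult_right)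
  also have "trace (Finite_Cartesian_Product.transpose J) = divergence (\<lambda>y. w y *s X y) x"
    by (simp add: trace_def Finite_Cartesian_Product.transpose_def J_def divergence_def)
  finally show ?thesis .
qed

end

section \<open>Time-dependent maps near the time axis\<close>

lemma sum_option: "(\<Sum>i\<in>(UNIV::'q::finite option set). f i) = f None + (\<Sum>j\<in>UNIV. f (Some j))"
  by (simp add: UNIV_option_conv sum.reindex)

lemma time_space_None [simp]: "time_space t x $ None = t"
  and time_space_Some [simp]: "time_space t x $ Some j = x $ j"
  by (simp_all add: time_space_def)

definition space_part :: "'k^('q::finite option) \<Rightarrow> 'k^'q"
  where "space_part z = (\<chi> j. z $ Some j)"

lemma space_part_nth [simp]: "space_part z $ j = z $ Some j"
  by (simp add: space_part_def)

lemma space_part_time_space [simp]: "space_part (time_space t x) = x"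
  by (simp add: vec_eq_iff)

lemma time_space_eta: "time_space (z $ None) (space_part z) = z"
proof -
  have "time_space (z $ None) (space_part z) $ i = z $ i" for i
    by (cases i) simp_all
  then show ?thesis by (simp add: vec_eq_iff)
qed

lemma time_space_diff: "time_space t x - time_space s y = time_space (t - s) (x - y)"
proof -
  have "(time_space t x - time_space s y) $ i = time_space (t - s) (x - y) $ i" for i
    by (cases i) simp_all
  then show ?thesis by (simp add: vec_eq_iff)
qed

lemma time_space_line: "time_space (of_real t) x = time_space 0 x + t *\<^sub>R axis None (1::'k::real_normed_field)"
proof -
  have "time_space (of_real t) x $ i = (time_space 0 x + t *\<^sub>R axis None (1::'k)) $ i" for i
    by (cases i) (simp_all add: axis_def of_real_def)
  then show ?thesis by (simp add: vec_eq_iff)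
qed

lemma norm_time_space_le: "norm (time_space t (x::'k::real_normed_vector^'q)) \<le> norm t + real CARD('q) * norm x"
proof -
  have "norm (time_space t x) \<le> norm t + (\<Sum>j\<in>UNIV. norm (x $ j))"
    using norm_vec_le_sum[of "time_space t x"] by (simp add: sum_option)
  also have "(\<Sum>j\<in>UNIV. norm (x $ j)) \<le> (\<Sum>j\<in>(UNIV::'q set). norm x)"
    by (intro sum_mono Finite_Cartesian_Product.norm_nth_le)
  finally show ?thesis by simp
qed

lemma space_part_has_derivative: "(space_part has_derivative space_part) (at (z::'k::real_normed_vector^('q::finite option)) within S)"
proof (rule has_derivative_vec)
  fix j show "((\<lambda>z. space_part z $ j) has_derivative (\<lambda>z::'k^('q::finite option). space_part z $ j)) (at z within S)"
    unfolding space_part_nth by (rule bounded_linear_imp_has_derivative[OF bounded_linear_vec_nth])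
qed

lemma continuous_on_space_part: "continuous_on S (space_part :: 'k::real_normed_vector^('q::finite option) \<Rightarrow> 'k^'q)"
  by (rule has_derivative_continuous_on) (rule space_part_has_derivative)

lemma time_space_has_vector_derivative:
  "((\<lambda>t. time_space (of_real t) x) has_vector_derivative axis None (1::'k::real_normed_field)) (at t within S)"
  unfolding time_space_line by (auto intro!: derivative_eq_intros)

lemma continuous_on_time_space:
  fixes f :: "'a::topological_space \<Rightarrow> 'k::real_normed_vector" and g :: "'a \<Rightarrow> 'k^'q"
  assumes "continuous_on S f" "continuous_on S g"
  shows "continuous_on S (\<lambda>p. time_space (f p) (g p))"
proof -
  have "continuous_on S (\<lambda>p. \<chi> i. case i of None \<Rightarrow> f p | Some j \<Rightarrow> g p $ j)"
  proof (rule continuous_on_vec_lambda)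
    fix i show "continuous_on S (\<lambda>p. case i of None \<Rightarrow> f p | Some j \<Rightarrow> g p $ j)"
      by (cases i) (auto intro!: assms continuous_intros)
  qed
  then show ?thesis by (simp add: time_space_def)
qed

text \<open>
  The open sets on which smooth families live: neighbourhoods of $[0,1] \times \{0\}$.
\<close>

definition contains_time_axis :: "('k::real_normed_field^('q::finite option)) set \<Rightarrow> bool"
  where "contains_time_axis W \<longleftrightarrow> open W \<and> (\<forall>t\<in>{0..1}. time_space (of_real t) 0 \<in> W)"

lemma contains_time_axis_Int: "contains_time_axis V \<Longrightarrow> contains_time_axis W \<Longrightarrow> contains_time_axis (V \<inter> W)"
  by (auto simp: contains_time_axis_def)

text \<open>
  The tube lemma for the compact time axis: some neighbourhood of the origin serves all times.
\<close>

lemma tube_around_time_axis: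
  fixes W :: "('k::real_normed_field^('q::finite option)) set"
  assumes "contains_time_axis W"
  obtains \<epsilon> where "\<epsilon> > 0"
    "\<And>t s x. t \<in> {0..1} \<Longrightarrow> dist s (of_real t) < \<epsilon> \<Longrightarrow> norm x < \<epsilon> \<Longrightarrow> time_space s x \<in> W"
proof -
  let ?C = "(\<lambda>t. time_space (of_real t) (0::'k^'q)) ` {0..1}"
  have "compact ?C"
    by (intro compact_continuous_image continuous_on_time_space continuous_intros) auto
  moreover have "open W" "?C \<subseteq> W"
    using assms by (auto simp: contains_time_axis_def)
  ultimately obtain e where e: "e > 0" "(\<Union>z\<in>?C. ball z e) \<subseteq> W"
    by (rule compact_subset_open_imp_ball_epsilon_subset)
  define n where "n = 1 + real CARD('q)"
  have n: "n > 0" by (simp add: n_def)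
  show thesis
  proof (rule that[of "e / n"])
    fix t :: real and s :: 'k and x :: "'k^'q" assume t: "t \<in> {0..1}" and s: "dist s (of_real t) < e / n" and x: "norm x < e / n"
    have "dist (time_space s x) (time_space (of_real t) 0) \<le> norm (s - of_real t) + real CARD('q) * norm x"
      using norm_time_space_le[of "s - of_real t" x] by (simp add: dist_norm time_space_diff)
    also have "\<dots> < e / n + real CARD('q) * (e / n)"
      using s x by (intro add_less_le_mono mult_left_mono) (auto simp: dist_norm)
    also have "\<dots> = n * (e / n)" by (simp only: n_def distrib_right mult_1)
    also have "\<dots> = e" using n by simp
    finally have "time_space s x \<in> ball (time_space (of_real t) 0) e"
      by (simp add: dist_commute)
    then show "time_space s x \<in> W" using e(2) t by blast
  qed (use e n in simp)
qed

lemma eventually_time_space_in: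
  assumes "contains_time_axis (W :: ('k::real_normed_field^('q::finite option)) set)"
  shows "\<forall>\<^sub>F x in nhds 0. \<forall>t\<in>{0..1}. time_space (of_real t) x \<in> W"
proof -
  obtain \<epsilon> where e: "\<epsilon> > 0"
    "\<And>t s x. t \<in> {0..1} \<Longrightarrow> dist s (of_real t) < \<epsilon> \<Longrightarrow> norm x < \<epsilon> \<Longrightarrow> time_space s x \<in> W"
    using tube_around_time_axis[OF assms] by blast
  then show ?thesis
    unfolding eventually_nhds_metric by (intro exI[of _ \<epsilon>]) auto
qed

text \<open>
  To be smooth as a family it suffices to be smooth near the time axis; by \<open>tube_around_time_axis\<close> such a
  neighbourhood contains a product.
\<close>

lemma smooth_familyI:
  fixes F :: "real \<Rightarrow> 'k::real_normed_field^'q \<Rightarrow> 'k^'q"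
  assumes W: "contains_time_axis W" and sm: "\<And>V j. V \<subseteq> W \<Longrightarrow> smooth_on r V (\<lambda>z. G z $ j)"
    and F: "\<forall>\<^sub>F x in nhds 0. \<forall>t\<in>{0..1}. F t x = G (time_space (of_real t) x)"
  shows "smooth_family r F"
proof -
  obtain \<epsilon> where e: "\<epsilon> > 0"
    "\<And>t s x. t \<in> {0..1} \<Longrightarrow> dist s (of_real t) < \<epsilon> \<Longrightarrow> norm x < \<epsilon> \<Longrightarrow> time_space s x \<in> W"
    using tube_around_time_axis[OF W] by blast
  obtain U0 where U0: "open U0" "0 \<in> U0" "\<And>x t. x \<in> U0 \<Longrightarrow> t \<in> {0..1} \<Longrightarrow> F t x = G (time_space (of_real t) x)"
    using F unfolding eventually_nhds by blast
  let ?T = "\<Union>t\<in>{0..1}. ball (of_real t :: 'k) \<epsilon>" and ?U = "U0 \<inter> ball 0 \<epsilon>"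
  show ?thesis
    unfolding smooth_family_def
  proof (intro exI[of _ ?T] exI[of _ ?U] exI[of _ G] conjI allI ballI)
    fix j
    show "smooth_on r {time_space s x |s x. s \<in> ?T \<and> x \<in> ?U} (\<lambda>z. G z $ j)"
      by (rule sm) (use e(2) in \<open>auto simp: dist_commute\<close>)
  qed (use e U0 in auto)
qed

lemma open_time_space_box:
  assumes "open T" "open U"
  shows "open {time_space s x |s x. s \<in> T \<and> x \<in> (U :: ('k::real_normed_vector^'q) set)}"
proof -
  have "{time_space s x |s x. s \<in> T \<and> x \<in> U} = (\<lambda>z. z $ None) -` T \<inter> space_part -` U"
    by (auto simp flip: time_space_eta) (metis time_space_eta)
  moreover have "open ((\<lambda>z::'k^('q::finite option). z $ None) -` T)"
    by (intro open_vimage assms continuous_intros)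
  moreover have "open ((space_part :: 'k^('q::finite option) \<Rightarrow> _) -` U)"
    by (intro open_vimage assms continuous_on_space_part)
  ultimately show ?thesis by auto
qed

lemma smooth_familyE:
  fixes F :: "real \<Rightarrow> 'k::real_normed_field^'q \<Rightarrow> 'k^'q"
  assumes "smooth_family r F"
  obtains W G where "contains_time_axis W" "\<And>j. smooth_on r W (\<lambda>z. G z $ j)"
    "\<forall>\<^sub>F x in nhds 0. \<forall>t\<in>{0..1}. F t x = G (time_space (of_real t) x)"
proof -
  obtain T U and G :: "'k^('q::finite option) \<Rightarrow> 'k^'q" where *: "open T" "of_real ` {0..1} \<subseteq> T" "open U" "0 \<in> U"
      "\<And>j. smooth_on r {time_space s x | s x. s \<in> T \<and> x \<in> U} (\<lambda>z. G z $ j)"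
      "\<And>t x. t\<in>{0..1} \<Longrightarrow> x\<in>U \<Longrightarrow> F t x = G (time_space (of_real t) x)"
    using assms unfolding smooth_family_def by blast
  show thesis
  proof (rule that[of "{time_space s x | s x. s \<in> T \<and> x \<in> U}" G])
    show "contains_time_axis {time_space s x |s x. s \<in> T \<and> x \<in> U}"
      unfolding contains_time_axis_def using * open_time_space_box[OF *(1,3)] by blast
    show "\<forall>\<^sub>F x in nhds 0. \<forall>t\<in>{0..1}. F t x = G (time_space (of_real t) x)"
      unfolding eventually_nhds using * by blast
  qed (rule *(5))
qed

section \<open>Flows of fields that vanish at the origin\<close>

text \<open>
  Because \<open>V t 0 = 0\<close>, solutions that start close enough to \<open>0\<close> cannot leave the ball before time $1$.
  The Picard operator is a contraction of the continuous functions with values in a small ball, when an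
  exponential weight in time is put on them.
\<close>

lemma picard_lindelof:
  fixes V :: "real \<Rightarrow> 'a::euclidean_space \<Rightarrow> 'a"
  assumes cont: "continuous_on ({0..1} \<times> cball 0 R) (\<lambda>(t, x). V t x)"
    and lip: "\<And>t x y. t \<in> {0..1} \<Longrightarrow> x \<in> cball 0 R \<Longrightarrow> y \<in> cball 0 R \<Longrightarrow> norm (V t x - V t y) \<le> L * norm (x - y)"
    and zero: "\<And>t. t \<in> {0..1} \<Longrightarrow> V t 0 = 0"
    and R: "R > 0" and L: "L > 0" and x0: "norm x0 \<le> R * exp (- (2 * L)) / 2"
  obtains \<phi> where "\<phi> 0 = x0" "\<And>t. t \<in> {0..1} \<Longrightarrow> \<phi> t \<in> cball 0 R"
    "\<And>t. t \<in> {0..1} \<Longrightarrow> (\<phi> has_vector_derivative V t (\<phi> t)) (at t within {0..1})"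
proof -
  define B where "B = R * exp (- (2 * L))"
  have B: "B > 0" using R by (simp add: B_def)
  \<comment> \<open>In terms of \<open>u s = exp (- 2 L s) \<phi> s\<close> the Picard operator contracts by one half, however large \<open>L\<close> is.\<close>
  define w where "w u s = exp (2 * L * s) *\<^sub>R u s" for u :: "real \<Rightarrow> 'a" and s
  have wR: "w u s \<in> cball 0 R" if "norm (u s) \<le> B" "s \<in> {0..1}" for u s
  proof -
    have "norm (w u s) \<le> exp (2 * L * s) * B" using that by (simp add: w_def)
    also have "\<dots> \<le> exp (2 * L) * B" using that L B by (intro mult_right_mono) auto
    also have "\<dots> = R" by (simp add: B_def exp_minus)
    finally show ?thesis by simp
  qed
  have Vcont: "continuous_on {0..1} (\<lambda>s. V s (w u s))" if "continuous_on {0..1} u" "\<And>s. norm (u s) \<le> B" for u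
  proof -
    have c: "continuous_on {0..1} (\<lambda>s. (s, w u s))"
      unfolding w_def by (intro continuous_intros that)
    have "continuous_on {0..1} (\<lambda>s. (\<lambda>(t, x). V t x) (s, w u s))"
      by (rule continuous_on_compose2[OF cont c]) (use wR that in auto)
    then show ?thesis by simp
  qed
  define T0 where "T0 u t = exp (- (2 * L * t)) *\<^sub>R (x0 + integral {0..t} (\<lambda>s. V s (w u s)))" for u t
  have T0cont: "continuous_on {0..1} (T0 u)" if "continuous_on {0..1} u" "\<And>s. norm (u s) \<le> B" for u
    unfolding T0_def
    by (intro continuous_intros indefinite_integral_continuous_1 integrable_continuous_real Vcont that)
  have T0diff: "norm (T0 u t - T0 v t) \<le> d / 2"
    if u: "continuous_on {0..1} u" "\<And>s. norm (u s) \<le> B" and v: "continuous_on {0..1} v" "\<And>s. norm (v s) \<le> B"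
      and d: "\<And>s. s \<in> {0..1} \<Longrightarrow> norm (u s - v s) \<le> d" "0 \<le> d" and t: "t \<in> {0..1}" for u v d t
  proof -
    have iu: "(\<lambda>s. V s (w u s)) integrable_on {0..t}" and iv: "(\<lambda>s. V s (w v s)) integrable_on {0..t}"
      using t by (auto intro!: integrable_continuous_real continuous_on_subset[OF Vcont] u v)
    have iexp: "((\<lambda>s. L * d * exp (2 * L * s)) has_integral (d / 2 * exp (2 * L * t) - d / 2 * exp (2 * L * 0))) {0..t}"
      using t L by (intro fundamental_theorem_of_calculus)
        (auto intro!: derivative_eq_intros simp flip: has_real_derivative_iff_has_vector_derivative)
    have "norm (integral {0..t} (\<lambda>s. V s (w u s)) - integral {0..t} (\<lambda>s. V s (w v s)))
       = norm (integral {0..t} (\<lambda>s. V s (w u s) - V s (w v s)))"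
      by (simp add: integral_diff[OF iu iv])
    also have "\<dots> \<le> integral {0..t} (\<lambda>s. L * d * exp (2 * L * s))"
    proof (rule integral_norm_bound_integral)
      show "(\<lambda>s. V s (w u s) - V s (w v s)) integrable_on {0..t}" by (intro integrable_diff iu iv)
      show "(\<lambda>s. L * d * exp (2 * L * s)) integrable_on {0..t}" using iexp by blast
      fix s assume s: "s \<in> {0..t}"
      then have s1: "s \<in> {0..1}" using t by auto
      have "norm (V s (w u s) - V s (w v s)) \<le> L * norm (w u s - w v s)"
        by (intro lip s1 wR u v)
      also have "norm (w u s - w v s) = exp (2 * L * s) * norm (u s - v s)"
        by (simp add: w_def flip: scaleR_diff_right)
      also have "L * (exp (2 * L * s) * norm (u s - v s)) \<le> L * (exp (2 * L * s) * d)"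
        using d(1)[OF s1] L by (intro mult_left_mono) auto
      finally show "norm (V s (w u s) - V s (w v s)) \<le> L * d * exp (2 * L * s)" by (simp add: mult_ac)
    qed
    also have "\<dots> = d / 2 * exp (2 * L * t) - d / 2" using integral_unique[OF iexp] by simp
    also have "\<dots> \<le> d / 2 * exp (2 * L * t)" using d(2) by simp
    finally have le: "norm (integral {0..t} (\<lambda>s. V s (w u s)) - integral {0..t} (\<lambda>s. V s (w v s))) \<le> d / 2 * exp (2 * L * t)" .
    have "norm (T0 u t - T0 v t) = exp (- (2 * L * t)) * norm (integral {0..t} (\<lambda>s. V s (w u s)) - integral {0..t} (\<lambda>s. V s (w v s)))"
      by (simp add: T0_def flip: scaleR_diff_right)
    also have "\<dots> \<le> exp (- (2 * L * t)) * (d / 2 * exp (2 * L * t))"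
      by (intro mult_left_mono le) simp
    also have "\<dots> = d / 2" by (simp add: exp_minus)
    finally show ?thesis .
  qed
  have T0zero: "T0 (\<lambda>_. 0) t = exp (- (2 * L * t)) *\<^sub>R x0" if "t \<in> {0..1}" for t
  proof -
    have "integral {0..t} (\<lambda>s. V s (w (\<lambda>_. 0) s)) = integral {0..t} (\<lambda>s. 0)"
      by (rule integral_cong) (use zero that in \<open>auto simp: w_def\<close>)
    then show ?thesis by (simp add: T0_def)
  qed
  have T0bound: "norm (T0 u t) \<le> B" if u: "continuous_on {0..1} u" "\<And>s. norm (u s) \<le> B" and t: "t \<in> {0..1}" for u t
  proof -
    have "norm (T0 u t - T0 (\<lambda>_. 0) t) \<le> B / 2"
      by (rule T0diff[OF u]) (use u B t in auto)
    moreover have "norm (T0 (\<lambda>_. 0) t) \<le> norm x0"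
      using L t by (simp add: T0zero mult_left_le_one_le)
    moreover have "norm x0 \<le> B / 2" using x0 by (simp add: B_def)
    ultimately show ?thesis using norm_triangle_sub[of "T0 u t" "T0 (\<lambda>_. 0) t"] by linarith
  qed
  define S where "S = (cball 0 B :: (real \<Rightarrow>\<^sub>C 'a) set)"
  have Sn: "norm (apply_bcontfun u s) \<le> B" if "u \<in> S" for u s
    using that norm_bounded[of u s] by (simp add: S_def)
  have "\<exists>g. \<forall>t. apply_bcontfun g t = T0 (apply_bcontfun u) (clamp 0 1 t)" if "u \<in> S" for u
  proof -
    have "continuous_on (cbox 0 1) (T0 (apply_bcontfun u))"
      using T0cont[of u] Sn[OF that] by simp
    then obtain g :: "real \<Rightarrow>\<^sub>C 'a" where "\<And>t. apply_bcontfun g t = T0 (apply_bcontfun u) (clamp 0 1 t)"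
      by (rule continuous_on_cbox_bcontfunE) blast
    then show ?thesis by blast
  qed
  then obtain T where T: "\<And>u t. u \<in> S \<Longrightarrow> apply_bcontfun (T u) t = T0 (apply_bcontfun u) (clamp 0 1 t)"
    by metis
  have clamp01: "clamp 0 1 t \<in> {0..1::real}" for t
    using clamp_in_interval[of 0 1 t] by simp
  have "\<exists>!u\<in>S. T u = u"
  proof (rule Banach_fix[where c="1/2"])
    show "complete S" unfolding S_def by (simp add: complete_eq_closed)
    show "S \<noteq> {}" using B by (auto simp: S_def)
    show "T ` S \<subseteq> S"
    proof clarify
      fix u assume u: "u \<in> S"
      have "norm (T u) \<le> B"
        by (rule norm_bound) (use T[OF u] T0bound[OF _ Sn[OF u] clamp01] in simp)
      then show "T u \<in> S" by (simp add: S_def)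
    qed
    fix u v assume u: "u \<in> S" and v: "v \<in> S"
    show "dist (T u) (T v) \<le> 1 / 2 * dist u v"
    proof (rule dist_bound)
      fix t
      have "norm (T0 (apply_bcontfun u) (clamp 0 1 t) - T0 (apply_bcontfun v) (clamp 0 1 t)) \<le> dist u v / 2"
        by (rule T0diff) (use Sn u v clamp01 dist_bounded[of u _ v] in \<open>auto simp: dist_norm\<close>)
      then show "dist (apply_bcontfun (T u) t) (apply_bcontfun (T v) t) \<le> 1 / 2 * dist u v"
        by (simp add: T u v dist_norm)
    qed
  qed auto
  then obtain u where u: "u \<in> S" "T u = u" by blast
  define \<phi> where "\<phi> = w (apply_bcontfun u)"
  have eq: "\<phi> t = x0 + integral {0..t} (\<lambda>s. V s (\<phi> s))" if t: "t \<in> {0..1}" for t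
  proof -
    have "apply_bcontfun u t = T0 (apply_bcontfun u) t"
      using T[OF u(1), of t] u(2) t by simp
    then show ?thesis by (simp add: \<phi>_def w_def[of _ t] T0_def exp_minus)
  qed
  have Vc: "continuous_on {0..1} (\<lambda>s. V s (\<phi> s))"
    unfolding \<phi>_def by (rule Vcont) (use Sn u in auto)
  show thesis
  proof (rule that[of \<phi>])
    show "\<phi> 0 = x0" using eq[of 0] by simp
    show "\<phi> t \<in> cball 0 R" if "t \<in> {0..1}" for t
      unfolding \<phi>_def by (rule wR[OF Sn[OF u(1)] that])
    show "(\<phi> has_vector_derivative V t (\<phi> t)) (at t within {0..1})" if t: "t \<in> {0..1}" for t
    proof -
      have "((\<lambda>t. x0 + integral {0..t} (\<lambda>s. V s (\<phi> s))) has_vector_derivative 0 + V t (\<phi> t)) (at t within {0..1})"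
        by (intro has_vector_derivative_add has_vector_derivative_const integral_has_vector_derivative[OF Vc t])
      then have "((\<lambda>t. x0 + integral {0..t} (\<lambda>s. V s (\<phi> s))) has_vector_derivative V t (\<phi> t)) (at t within {0..1})"
        by simp
      then show ?thesis
        by (rule has_vector_derivative_transform[OF t, rotated]) (rule eq)
    qed
  qed
qed

context smooth_category begin

lemma partial_slice:
  fixes f :: "'k^('q::finite option) \<Rightarrow> 'k"
  assumes "smooth_on r W f" "open W" "time_space s x \<in> W"
  shows "partial m (\<lambda>x. f (time_space s x)) x = partial (Some m) f (time_space s x)"
proof -
  have sm: "smooth_on r UNIV (\<lambda>x. time_space s x $ i)" for i :: "'q option"
    by (cases i) (auto intro: smooth_const smooth_coord)
  have "partial m (\<lambda>x. f (time_space s x)) x =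
      (\<Sum>i\<in>UNIV. partial i f (time_space s x) * partial m (\<lambda>x. time_space s x $ i) x)"
    by (rule partial_compose[OF assms(1) sm open_UNIV assms(2) UNIV_I assms(3)])
  then show ?thesis
    by (simp add: sum_option partial_const partial_coord if_distrib cong: if_cong)
qed

lemma open_slice: "open W \<Longrightarrow> open {x::'k^'q. time_space s x \<in> W}"
  using open_vimage[of W "time_space s"] continuous_on_time_space[of UNIV "\<lambda>_. s" "\<lambda>x::'k^'q. x"]
  by (simp add: vimage_def)

lemma smooth_slice:
  fixes f :: "'k^('q::finite option) \<Rightarrow> 'k"
  assumes "smooth_on r W f" "open W"
  shows "smooth_on r {x. time_space s x \<in> W} (\<lambda>x. f (time_space s x))"
proof (rule smooth_compose[OF assms(1) _ open_slice[OF assms(2)] assms(2)])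
  fix i :: "'q option" show "smooth_on r {x. time_space s x \<in> W} (\<lambda>x. time_space s x $ i)"
    by (cases i) (auto intro: smooth_const smooth_coord open_slice assms)
qed auto

lemma smooth_space_part:
  fixes f :: "'k^'q \<Rightarrow> 'k"
  assumes "smooth_on r U f" "open U"
  shows "open {z. space_part z \<in> U}" "smooth_on r {z. space_part z \<in> U} (\<lambda>z. f (space_part z))"
proof -
  show o: "open {z. space_part z \<in> U}"
    using open_vimage[OF assms(2) continuous_on_space_part] by (simp add: vimage_def)
  show "smooth_on r {z. space_part z \<in> U} (\<lambda>z. f (space_part z))"
    by (rule smooth_compose[OF assms(1) _ o assms(2)]) (auto intro: smooth_coord o)
qed

lemma partial_space_part:
  fixes f :: "'k^'q \<Rightarrow> 'k"
  assumes "smooth_on r U f" "open U" "space_part z \<in> U"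
  shows "partial (Some m) (\<lambda>z. f (space_part z)) z = partial m f (space_part z)"
    and "partial None (\<lambda>z. f (space_part z)) z = 0"
proof -
  have "partial i (\<lambda>z. f (space_part z)) z = (\<Sum>j\<in>UNIV. partial j f (space_part z) * partial i (\<lambda>z. space_part z $ j) z)" for i
    by (rule partial_compose[where f=space_part and U=UNIV and V=U]) (use assms in \<open>auto intro: smooth_coord\<close>)
  then show "partial (Some m) (\<lambda>z. f (space_part z)) z = partial m f (space_part z)"
    and "partial None (\<lambda>z. f (space_part z)) z = 0"
    by (simp_all add: partial_coord if_distrib cong: if_cong)
qed

lemma smooth_in_time:
  fixes f :: "'k^('q::finite option) \<Rightarrow> 'k"
  assumes "smooth_on r W f" "open W" "time_space (of_real t) x \<in> W"
  shows "((\<lambda>t. f (time_space (of_real t) x)) has_vector_derivative partial None f (time_space (of_real t) x)) (at t within S)"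
  using smooth_along_curve[OF assms time_space_has_vector_derivative] by (simp add: sum_axis_nth)

text \<open>
  Bounds for the partial derivatives on the compact tube, through the mean value inequality.
\<close>

lemma slice_Lipschitz:
  fixes Z :: "'k^('q::finite option) \<Rightarrow> 'k^'q"
  assumes W: "open W" and Z: "\<And>j. smooth_on r W (\<lambda>z. Z z $ j)"
    and sub: "\<And>t x. t \<in> {0..1} \<Longrightarrow> x \<in> cball 0 R \<Longrightarrow> time_space (of_real t) x \<in> W"
  obtains L where "L > 0" "\<And>t x y. t \<in> {0..1} \<Longrightarrow> x \<in> cball 0 R \<Longrightarrow> y \<in> cball 0 R \<Longrightarrow>
     norm (Z (time_space (of_real t) x) - Z (time_space (of_real t) y)) \<le> L * norm (x - y)"
proof -
  define C where "C = (\<lambda>(t, x). time_space (of_real t) x) ` ({0..1} \<times> cball (0::'k^'q) R)"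
  have "compact C"
    unfolding C_def case_prod_beta
    by (intro compact_continuous_image continuous_on_time_space continuous_intros compact_Times) auto
  have CW: "C \<subseteq> W" using sub by (auto simp: C_def)
  have "\<exists>b. \<forall>z\<in>C. norm (partial (Some m) (\<lambda>z. Z z $ j) z) \<le> b" for j m
  proof -
    have "continuous_on C (partial (Some m) (\<lambda>z. Z z $ j))"
      using smooth_continuous_on[OF smooth_partial[OF Z] W] CW continuous_on_subset by blast
    then have "bounded (partial (Some m) (\<lambda>z. Z z $ j) ` C)"
      using \<open>compact C\<close> compact_continuous_image compact_imp_bounded by blast
    then show ?thesis by (auto simp: bounded_iff)
  qed
  then have bex: "\<exists>b. \<forall>p. \<forall>z\<in>C. norm (partial (Some (snd p)) (\<lambda>z. Z z $ fst p) z) \<le> b p"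
    by (intro choice allI)
  then obtain b' where b': "\<And>p z. z \<in> C \<Longrightarrow> norm (partial (Some (snd p)) (\<lambda>z. Z z $ fst p) z) \<le> b' p"
    by blast
  define b where "b j m = b' (j, m)" for j m
  have b: "norm (partial (Some m) (\<lambda>z. Z z $ j) z) \<le> b j m" if "z \<in> C" for j m z
    using b'[OF that, of "(j, m)"] by (simp add: b_def)
  define L where "L = 1 + (\<Sum>j\<in>UNIV. \<Sum>m\<in>UNIV. \<bar>b j m\<bar>)"
  have "L > 0" unfolding L_def by (intro add_pos_nonneg sum_nonneg) auto
  moreover have "norm (Z (time_space (of_real t) x) - Z (time_space (of_real t) y)) \<le> L * norm (x - y)"
    if t: "t \<in> {0..1}" and xy: "x \<in> cball 0 R" "y \<in> cball 0 R" for t x y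
  proof (rule differentiable_bound[of "cball 0 R", OF convex_cball _ _ xy])
    let ?f' = "\<lambda>x v. \<chi> j. \<Sum>m\<in>UNIV. partial m (\<lambda>x. Z (time_space (of_real t) x) $ j) x * v $ m"
    fix x :: "'k^'q" assume x: "x \<in> cball 0 R"
    have z: "time_space (of_real t) x \<in> W" "time_space (of_real t) x \<in> C"
      using sub[OF t x] t x by (auto simp: C_def)
    show "((\<lambda>x. Z (time_space (of_real t) x)) has_derivative ?f' x) (at x within cball 0 R)"
      by (rule has_derivative_at_withinI[OF smooth_vec_has_derivative[OF smooth_slice[OF Z W] open_slice[OF W]]])
         (use z in simp)
    show "onorm (?f' x) \<le> L"
    proof (rule onorm_le)
      fix v
      have "norm (?f' x v) \<le> (\<Sum>j\<in>UNIV. norm (\<Sum>m\<in>UNIV. partial m (\<lambda>x. Z (time_space (of_real t) x) $ j) x * v $ m))"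
        using norm_vec_le_sum[of "?f' x v"] by simp
      also have "\<dots> \<le> (\<Sum>j\<in>UNIV. \<Sum>m\<in>UNIV. \<bar>b j m\<bar> * norm v)"
      proof (intro sum_mono order_trans[OF norm_sum])
        fix j m
        have "norm (partial m (\<lambda>x. Z (time_space (of_real t) x) $ j) x) \<le> \<bar>b j m\<bar>"
          using b[OF z(2), of m j] partial_slice[OF Z W z(1), of m j] by simp
        then show "norm (partial m (\<lambda>x. Z (time_space (of_real t) x) $ j) x * v $ m) \<le> \<bar>b j m\<bar> * norm v"
          unfolding norm_mult by (intro mult_mono Finite_Cartesian_Product.norm_nth_le) auto
      qed
      also have "\<dots> = (\<Sum>j\<in>UNIV. \<Sum>m\<in>UNIV. \<bar>b j m\<bar>) * norm v"
        by (simp add: sum_distrib_right)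
      also have "\<dots> \<le> L * norm v" by (simp add: L_def mult_right_mono)
      finally show "norm (?f' x v) \<le> L * norm v" .
    qed
  qed
  ultimately show thesis by (rule that)
qed

text \<open>
  In a tube around the time axis the field is Lipschitz in space, uniformly in time, so \<open>picard_lindelof\<close> applies
  to all initial values in a common ball.
\<close>

lemma flow_of_vanishing_field:
  fixes Z :: "'k^('q::finite option) \<Rightarrow> 'k^'q"
  assumes W: "contains_time_axis W" and Z: "\<And>j. smooth_on r W (\<lambda>z. Z z $ j)"
    and zero: "\<And>t. t \<in> {0..1} \<Longrightarrow> Z (time_space (of_real t) 0) = 0"
  obtains \<Phi> where "\<forall>\<^sub>F x in nhds 0. \<Phi> 0 x = x \<and> (\<forall>t\<in>{0..1}.
    ((\<lambda>s. \<Phi> s x) has_vector_derivative Z (time_space (of_real t) (\<Phi> t x))) (at t within {0..1}))"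
proof -
  have oW: "open W" using W by (simp add: contains_time_axis_def)
  obtain \<epsilon> where e: "\<epsilon> > 0"
    "\<And>t s x. t \<in> {0..1} \<Longrightarrow> dist s (of_real t) < \<epsilon> \<Longrightarrow> norm x < \<epsilon> \<Longrightarrow> time_space s x \<in> W"
    using tube_around_time_axis[OF W] by blast
  define R where "R = \<epsilon> / 2"
  have R: "R > 0" "R < \<epsilon>" using e by (auto simp: R_def)
  have sub: "time_space (of_real t) x \<in> W" if "t \<in> {0..1}" "x \<in> cball 0 R" for t and x :: "'k^'q"
    using e(2)[OF that(1), of "of_real t" x] that(2) R e(1) by simp
  obtain L where L: "L > 0" "\<And>t x y. t \<in> {0..1} \<Longrightarrow> x \<in> cball 0 R \<Longrightarrow> y \<in> cball 0 R \<Longrightarrow>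
     norm (Z (time_space (of_real t) x) - Z (time_space (of_real t) y)) \<le> L * norm (x - y)"
    using slice_Lipschitz[OF oW Z sub] by blast
  have cont: "continuous_on ({0..1} \<times> cball 0 R) (\<lambda>(t, x). Z (time_space (of_real t) x))"
    unfolding case_prod_beta
    by (rule continuous_on_compose2[OF smooth_vec_continuous_on[OF Z oW]])
       (use sub in \<open>auto intro!: continuous_on_time_space continuous_intros\<close>)
  define \<delta> where "\<delta> = R * exp (- (2 * L)) / 2"
  have \<delta>: "\<delta> > 0" using R by (simp add: \<delta>_def)
  have "\<exists>\<phi>. \<phi> 0 = x \<and> (\<forall>t\<in>{0..1}. (\<phi> has_vector_derivative Z (time_space (of_real t) (\<phi> t))) (at t within {0..1}))"
    if "norm x \<le> \<delta>" for x
  proof (rule picard_lindelof[where V="\<lambda>t x. Z (time_space (of_real t) x)" and R=R and L=L and ?x0.0=x])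
    show "norm x \<le> R * exp (- (2 * L)) / 2" using that by (simp add: \<delta>_def)
  qed (use cont L zero R(1) in blast)+
  then obtain \<phi> where \<phi>: "\<And>x. norm x \<le> \<delta> \<Longrightarrow> \<phi> x 0 = x \<and> (\<forall>t\<in>{0..1}. (\<phi> x has_vector_derivative Z (time_space (of_real t) (\<phi> x t))) (at t within {0..1}))"
    by metis
  have "\<forall>\<^sub>F x in nhds 0. norm x \<le> \<delta>"
    unfolding eventually_nhds_metric using \<delta> by (intro exI[of _ \<delta>]) auto
  then have "\<forall>\<^sub>F x in nhds 0. \<phi> x 0 = x \<and> (\<forall>t\<in>{0..1}.
    ((\<lambda>s. \<phi> x s) has_vector_derivative Z (time_space (of_real t) (\<phi> x t))) (at t within {0..1}))"
    by eventually_elim (use \<phi> in simp)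
  then show thesis by (rule that[of "\<lambda>s x. \<phi> x s"])
qed

end

section \<open>Transport of densities\<close>

definition space_jacobian :: "('k::real_normed_field^('q::finite option) \<Rightarrow> 'k^'q) \<Rightarrow> 'k^('q option) \<Rightarrow> 'k^'q^'q"
  where "space_jacobian G z = (\<chi> j k. partial (Some k) (\<lambda>z. G z $ j) z)"

definition velocity :: "('k::real_normed_field^('q::finite option) \<Rightarrow> 'k^'q) \<Rightarrow> 'k^('q option) \<Rightarrow> 'k^'q"
  where "velocity G z = (\<chi> j. partial None (\<lambda>z. G z $ j) z)"

lemma scaleR_eq_scale: "c *\<^sub>R v = of_real c *s (v :: 'k::real_normed_field^'q)"
  by (simp add: vec_eq_iff of_real_def)

lemma det_variation_add: "det_variation P (Q + R) = det_variation P Q + det_variation P (R :: 'k::field^'q^'q)"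
  by (simp add: det_variation_def alternating_rows_add[OF alternating_rows_det] sum.distrib)

lemma det_variation_scale: "det_variation P (\<chi> i. c *s Q $ i) = c * det_variation P (Q :: 'k::field^'q^'q)"
  by (simp add: det_variation_def alternating_rows_scale[OF alternating_rows_det] sum_distrib_left)

lemma det_variation_sum:
  assumes "finite M"
  shows "det_variation P (\<chi> i. \<Sum>m\<in>M. c m *s Q m $ i) = (\<Sum>m\<in>M. c m * det_variation P (Q m :: 'k::field^'q^'q))"
  using assms
proof (induction M)
  case empty
  have "(\<chi> i. 0) = (\<chi> i. 0 *s (0::'k^'q^'q) $ i)" by (simp add: vec_eq_iff)
  then show ?case using det_variation_scale[of P 0 0] by simp
next
  case (insert m M)
  have "(\<chi> i. \<Sum>m\<in>insert m M. c m *s Q m $ i) = (\<chi> i. c m *s Q m $ i) + (\<chi> i. \<Sum>m\<in>M. c m *s Q m $ i)"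
    using insert by (simp add: vec_eq_iff)
  then show ?case using insert by (simp add: det_variation_add det_variation_scale)
qed

lemma (in smooth_category) smooth_vec_germ:
  fixes F :: "'k^'m \<Rightarrow> 'k^'n"
  assumes "\<And>j. (\<lambda>x. F x $ j) \<in> smooth_germs r"
  obtains U where "open U" "0 \<in> U" "\<And>j. smooth_on r U (\<lambda>x. F x $ j)"
proof -
  have "\<forall>j. \<exists>U. open U \<and> 0 \<in> U \<and> smooth_on r U (\<lambda>x. F x $ j)"
    using assms unfolding smooth_germs_def by blast
  then obtain U where U: "\<And>j. open (U j)" "\<And>j. 0 \<in> U j" "\<And>j. smooth_on r (U j) (\<lambda>x. F x $ j)"
    by metis
  show thesis
  proof (rule that[of "\<Inter>j. U j"])
    show "open (\<Inter>j. U j)" using U(1) by (intro open_INT) auto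
    show "0 \<in> (\<Inter>j. U j)" using U(2) by blast
    show "smooth_on r (\<Inter>j. U j) (\<lambda>x. F x $ j)" for j
      by (rule smooth_subset[OF U(3)]) blast
  qed
qed

context smooth_category begin

lemma smooth_jacobian: "(\<And>j. smooth_on r W (\<lambda>z. G z $ j)) \<Longrightarrow> smooth_on r W (\<lambda>z. space_jacobian G (z :: 'k^('q::finite option)) $ j $ k)"
  unfolding space_jacobian_def by (simp add: smooth_partial)

lemma smooth_velocity: "(\<And>j. smooth_on r W (\<lambda>z. G z $ j)) \<Longrightarrow> smooth_on r W (\<lambda>z. velocity G (z :: 'k^('q::finite option)) $ j)"
  unfolding velocity_def by (simp add: smooth_partial)

lemma slice_has_derivative:
  fixes G :: "'k^('q::finite option) \<Rightarrow> 'k^'q"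
  assumes G: "\<And>j. smooth_on r W (\<lambda>z. G z $ j)" and W: "open W" and z: "time_space s x \<in> W"
  shows "((\<lambda>x. G (time_space s x)) has_derivative (\<lambda>v. space_jacobian G (time_space s x) *v v)) (at x)"
proof -
  have "((\<lambda>x. G (time_space s x)) has_derivative
     (\<lambda>v. \<chi> j. \<Sum>m\<in>UNIV. partial m (\<lambda>x. G (time_space s x) $ j) x * v $ m)) (at x)"
    by (rule smooth_vec_has_derivative[OF smooth_slice[OF G W] open_slice[OF W]]) (use z in simp)
  then show ?thesis
    by (simp add: partial_slice[OF G W z] space_jacobian_def matrix_vector_mult_def)
qed

lemma family_in_time:
  fixes G :: "'k^('q::finite option) \<Rightarrow> 'k^'q"
  assumes G: "\<And>j. smooth_on r W (\<lambda>z. G z $ j)" and W: "open W" and z: "time_space (of_real t) x \<in> W"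
  shows "((\<lambda>t. G (time_space (of_real t) x)) has_vector_derivative velocity G (time_space (of_real t) x)) (at t within S)"
  unfolding has_vector_derivative_def
proof (rule has_derivative_vec)
  fix j
  show "((\<lambda>t. G (time_space (of_real t) x) $ j) has_derivative (\<lambda>h. (h *\<^sub>R velocity G (time_space (of_real t) x)) $ j)) (at t within S)"
    using smooth_in_time[OF G W z, of j S] by (simp add: has_vector_derivative_def velocity_def)
qed

lemma contains_time_axis_preimage:
  fixes G :: "'k^('q::finite option) \<Rightarrow> 'k^'n"
  assumes W: "contains_time_axis W" and G: "\<And>j. smooth_on r W (\<lambda>z. G z $ j)"
    and N: "open N" and mem: "\<And>t. t \<in> {0..1} \<Longrightarrow> G (time_space (of_real t) 0) \<in> N"
  shows "contains_time_axis {z\<in>W. G z \<in> N}"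
proof -
  have oW: "open W" using W by (simp add: contains_time_axis_def)
  have "open (W \<inter> G -` N)"
    using smooth_vec_continuous_on[OF G oW] oW N by (simp add: continuous_on_open_vimage Int_commute)
  moreover have "W \<inter> G -` N = {z\<in>W. G z \<in> N}" by auto
  ultimately show ?thesis using W mem by (auto simp: contains_time_axis_def)
qed

lemma contains_time_axis_nonzero:
  fixes f :: "'k^('q::finite option) \<Rightarrow> 'k"
  assumes W: "contains_time_axis W" and f: "smooth_on r W f"
    and mem: "\<And>t. t \<in> {0..1} \<Longrightarrow> f (time_space (of_real t) 0) \<noteq> 0"
  shows "contains_time_axis {z\<in>W. f z \<noteq> 0}"
proof -
  have oW: "open W" using W by (simp add: contains_time_axis_def)
  have "open (W \<inter> f -` (- {0}))"
    using smooth_continuous_on[OF f oW] oW by (simp add: continuous_on_open_vimage Int_commute open_Compl)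
  moreover have "W \<inter> f -` (- {0}) = {z\<in>W. f z \<noteq> 0}" by auto
  ultimately show ?thesis using W mem by (auto simp: contains_time_axis_def)
qed

lemma contains_time_axis_space:
  "open U \<Longrightarrow> 0 \<in> U \<Longrightarrow> contains_time_axis {z :: 'k^('q::finite option). space_part z \<in> U}"
  using open_vimage[OF _ continuous_on_space_part, of U] by (simp add: contains_time_axis_def vimage_def)

lemma family_derivative:
  fixes G :: "'k^('q::finite option) \<Rightarrow> 'k^'q"
  assumes W: "contains_time_axis W" and G: "\<And>j. smooth_on r W (\<lambda>z. G z $ j)"
    and \<Phi>: "\<forall>\<^sub>F x in nhds 0. \<forall>t\<in>{0..1}. \<Phi> t x = G (time_space (of_real t) x)"
  shows "\<forall>\<^sub>F x in nhds 0. \<forall>t\<in>{0..1}. (\<Phi> t has_derivative (\<lambda>v. space_jacobian G (time_space (of_real t) x) *v v)) (at x)"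
proof -
  obtain U where U: "open U" "0 \<in> U" "\<And>x t. x \<in> U \<Longrightarrow> t \<in> {0..1} \<Longrightarrow> \<Phi> t x = G (time_space (of_real t) x)"
    using \<Phi> unfolding eventually_nhds by blast
  have oW: "open W" using W by (simp add: contains_time_axis_def)
  have "\<forall>\<^sub>F x in nhds 0. x \<in> U" using U by (simp add: eventually_nhds_in_open)
  with eventually_time_space_in[OF W] show ?thesis
  proof (eventually_elim, intro ballI)
    fix x t assume x: "\<forall>t\<in>{0..1}. time_space (of_real t) x \<in> W" "x \<in> U" and t: "t \<in> {0..1::real}"
    then have "((\<lambda>x. G (time_space (of_real t) x)) has_derivative (\<lambda>v. space_jacobian G (time_space (of_real t) x) *v v)) (at x)"
      by (intro slice_has_derivative[OF G oW]) blast
    then show "(\<Phi> t has_derivative (\<lambda>v. space_jacobian G (time_space (of_real t) x) *v v)) (at x)"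
      by (rule has_derivative_transform_within_open[OF _ U(1) x(2)]) (use U(3) t in simp)
  qed
qed

lemma det_nonzero_if_left_inverse:
  fixes A :: "'k^'q^'q"
  assumes "\<And>v. B (A *v v) = v" shows "det A \<noteq> 0"
proof -
  have "\<exists>B. B ** A = mat 1"
    unfolding matrix_left_invertible_injective by (rule injI) (metis assms)
  then show ?thesis by (simp add: invertible_det_nz[symmetric] invertible_left_inverse)
qed

lemma Diff0_jacobian_nonzero:
  fixes \<Phi> :: "'k^'q \<Rightarrow> 'k^'q"
  assumes "\<Phi> \<in> Diff0 r" "(\<Phi> has_derivative (\<lambda>v. A *v v)) (at 0)"
  shows "det A \<noteq> 0"
proof -
  obtain \<Psi> where \<Psi>: "\<Phi> 0 = 0" "\<And>j. (\<lambda>x. \<Psi> x $ j) \<in> smooth_germs r" "\<Psi> \<circ> \<Phi> \<simeq> id"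
    using assms(1) unfolding Diff0_def by blast
  obtain U where U: "open U" "0 \<in> U" "\<And>j. smooth_on r U (\<lambda>x. \<Psi> x $ j)"
    using smooth_vec_germ[OF \<Psi>(2)] by blast
  obtain B where B: "(\<Psi> has_derivative B) (at 0)"
    using smooth_vec_has_derivative[OF U(3,1,2)] by blast
  obtain N where N: "open N" "0 \<in> N" "\<And>x. x \<in> N \<Longrightarrow> (\<Psi> \<circ> \<Phi>) x = id x"
    using \<Psi>(3) unfolding germ_eq_def eventually_nhds by blast
  have "(\<Psi> \<circ> \<Phi> has_derivative (B \<circ> (\<lambda>v. A *v v))) (at 0)"
    using diff_chain_at[OF assms(2)] B \<Psi>(1) by simp
  then have "(id has_derivative (B \<circ> (\<lambda>v. A *v v))) (at 0)"
    by (rule has_derivative_transform_within_open[OF _ N])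
  then have "B \<circ> (\<lambda>v. A *v v) = id"
    using has_derivative_id has_derivative_unique by blast
  then show ?thesis
    by (intro det_nonzero_if_left_inverse[of B]) (simp add: fun_eq_iff)
qed

lemma submodule_scale:
  assumes "submodule_of_vector_fields r M" "f \<in> smooth_germs r" "X \<in> M"
  shows "(\<lambda>x. f x *s X x) \<in> M"
  using assms unfolding submodule_of_vector_fields_def by blast

lemma submodule_cong:
  assumes "submodule_of_vector_fields r M" "X \<in> M" "\<forall>\<^sub>F x in nhds 0. X x = Y x"
  shows "Y \<in> M"
  using assms(2,3) assms(1)[unfolded submodule_of_vector_fields_def germ_saturated_def germ_eq_def] by metis

text \<open>
  With $\Psi = \Phi_{t_0}^{-1}$ and $\tau(s) = t_0 + s\delta$, the family $\Theta_s = \Psi \circ \Phi_{\tau(s)}$ lies in \<open>H\<close>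
  and starts at the identity, so it is generated by some smooth family \<open>Z\<close> in \<open>L\<close>.  Differentiating
  $\Phi_{t_0} \circ \Theta_s = \Phi_{\tau(s)}$ at $s = 0$ gives $D\Phi_{t_0} Z_0 = \delta\, \partial_t \Phi_{t_0}$, that is
  $Z_0 = \delta Y$.
\<close>

lemma logarithmic_derivative_in_Lie_algebra:
  fixes G :: "'k^('q::finite option) \<Rightarrow> 'k^'q"
  assumes H: "subgroup_of_Diff0 r H" and L: "is_Lie_algebra_of r L H" and mod: "submodule_of_vector_fields r L"
    and W: "contains_time_axis W" and G: "\<And>j. smooth_on r W (\<lambda>z. G z $ j)"
    and \<Phi>: "\<forall>\<^sub>F x in nhds 0. \<forall>t\<in>{0..1}. \<Phi> t x = G (time_space (of_real t) x)"
    and \<Phi>H: "\<And>t. t \<in> {0..1} \<Longrightarrow> \<Phi> t \<in> H" and t0: "t0 \<in> {0..1}"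
    and Y: "\<forall>\<^sub>F x in nhds 0. det (space_jacobian G (time_space (of_real t0) x)) \<noteq> 0 \<and>
       space_jacobian G (time_space (of_real t0) x) *v Y x = velocity G (time_space (of_real t0) x)"
  shows "Y \<in> L"
proof -
  \<comment> \<open>Away from \<open>t0 = 1\<close> the family runs on to time \<open>1\<close>; at \<open>t0 = 1\<close> it runs backwards to time \<open>0\<close>.\<close>
  define \<delta> where "\<delta> = (if t0 < 1 then 1 - t0 else - 1)"
  have \<delta>: "\<delta> \<noteq> 0" by (auto simp: \<delta>_def)
  define \<tau> where "\<tau> s = t0 + s * \<delta>" for s
  have \<tau>: "\<tau> s \<in> {0..1}" if "s \<in> {0..1}" for s
  proof (cases "t0 < 1")
    case True
    have eq: "\<tau> s = t0 + s * (1 - t0)" using True by (simp add: \<tau>_def \<delta>_def)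
    have "\<tau> s \<le> t0 + 1 * (1 - t0)"
      unfolding eq using that t0 by (intro add_left_mono mult_right_mono) auto
    moreover have "0 \<le> \<tau> s" unfolding eq using that t0 by simp
    ultimately show ?thesis by simp
  next
    case False
    then show ?thesis using that t0 by (simp add: \<tau>_def \<delta>_def)
  qed
  have oW: "open W" using W by (simp add: contains_time_axis_def)
  have D: "\<Phi> t \<in> Diff0 r" if "t \<in> {0..1}" for t
    using H \<Phi>H[OF that] unfolding subgroup_of_Diff0_def by blast
  obtain \<Psi> where \<Psi>: "\<Psi> 0 = 0" "\<And>j. (\<lambda>x. \<Psi> x $ j) \<in> smooth_germs r"
      "\<Psi> \<circ> \<Phi> t0 \<simeq> id" "\<Phi> t0 \<circ> \<Psi> \<simeq> id"
    using D[OF t0] unfolding Diff0_def by blast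
  have "\<Psi> \<in> Diff0 r" using D[OF t0] \<Psi> unfolding Diff0_def by blast
  then have \<Psi>H: "\<Psi> \<in> H" using H \<Phi>H[OF t0] \<Psi>(4) unfolding subgroup_of_Diff0_def by blast
  obtain U where U: "open U" "0 \<in> U" "\<And>j. smooth_on r U (\<lambda>x. \<Psi> x $ j)"
    using smooth_vec_germ[OF \<Psi>(2)] by blast
  obtain N where N: "open N" "0 \<in> N" "\<And>y. y \<in> N \<Longrightarrow> \<Phi> t0 (\<Psi> y) = y"
    using \<Psi>(4) unfolding germ_eq_def eventually_nhds by auto
  have G0: "G (time_space (of_real t) 0) = 0" if "t \<in> {0..1}" for t
    using eventually_nhds_x_imp_x[OF \<Phi>] that D[OF that] unfolding Diff0_def by force
  define \<Theta> where "\<Theta> s = \<Psi> \<circ> \<Phi> (\<tau> s)" for s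
  have \<Theta>H: "\<Theta> s \<in> H" if "s \<in> {0..1}" for s
    using H \<Psi>H \<Phi>H[OF \<tau>[OF that]] unfolding \<Theta>_def subgroup_of_Diff0_def by blast
  have \<Theta>0: "\<Theta> 0 \<simeq> id" using \<Psi>(3) by (simp add: \<Theta>_def \<tau>_def)
  define \<sigma> :: "'k^('q option) \<Rightarrow> 'k^('q option)" where
    "\<sigma> z = time_space (of_real t0 + of_real \<delta> * z $ None) (space_part z)" for z
  have \<sigma>ts: "\<sigma> (time_space (of_real s) x) = time_space (of_real (\<tau> s)) x" for s x
    by (simp add: \<sigma>_def \<tau>_def mult.commute)
  have \<sigma>sm: "smooth_on r V (\<lambda>z. \<sigma> z $ i)" if "open V" for V i
  proof (cases i)
    case None then show ?thesis
      using that by (auto simp: \<sigma>_def intro!: smooth_add smooth_mult smooth_const smooth_coord)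
  next
    case (Some j) then show ?thesis using that by (auto simp: \<sigma>_def intro!: smooth_coord)
  qed
  have top: "contains_time_axis (UNIV :: ('k^('q option)) set)" by (simp add: contains_time_axis_def)
  define W1 where "W1 = {z\<in>UNIV. \<sigma> z \<in> W}"
  have W1: "contains_time_axis W1"
    unfolding W1_def
    by (rule contains_time_axis_preimage[OF top \<sigma>sm oW]) (use W \<tau> in \<open>auto simp: \<sigma>ts contains_time_axis_def\<close>)
  then have oW1: "open W1" by (simp add: contains_time_axis_def)
  have Gsm: "smooth_on r W1 (\<lambda>z. G (\<sigma> z) $ j)" for j
    by (rule smooth_compose[OF G \<sigma>sm[OF oW1] oW1 oW]) (simp add: W1_def)
  define W2 where "W2 = {z\<in>W1. G (\<sigma> z) \<in> U}"
  have W2: "contains_time_axis W2"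
    unfolding W2_def
    by (rule contains_time_axis_preimage[OF W1 Gsm U(1)]) (use G0 \<tau> U(2) in \<open>simp add: \<sigma>ts\<close>)
  then have oW2: "open W2" by (simp add: contains_time_axis_def)
  have \<Psi>sm: "smooth_on r W2 (\<lambda>z. \<Psi> (G (\<sigma> z)) $ j)" for j
    by (rule smooth_compose[where f="\<lambda>z. G (\<sigma> z)", OF U(3) smooth_subset[OF Gsm] oW2 U(1)]) (auto simp: W2_def)
  have "smooth_family r \<Theta>"
  proof (rule smooth_familyI[OF W2, where G="\<lambda>z. \<Psi> (G (\<sigma> z))"])
    show "smooth_on r V (\<lambda>z. \<Psi> (G (\<sigma> z)) $ j)" if "V \<subseteq> W2" for V j
      by (rule smooth_subset[OF \<Psi>sm that])
    show "\<forall>\<^sub>F x in nhds 0. \<forall>s\<in>{0..1}. \<Theta> s x = \<Psi> (G (\<sigma> (time_space (of_real s) x)))"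
      using \<Phi> by eventually_elim (use \<tau> in \<open>auto simp: \<Theta>_def \<sigma>ts\<close>)
  qed
  with \<Theta>H \<Theta>0 have "\<Theta> \<in> {\<Phi>. smooth_family r \<Phi> \<and> (\<forall>t\<in>{0..1}. \<Phi> t \<in> H) \<and> \<Phi> 0 \<simeq> id}" by blast
  then obtain Z where Z: "\<And>t. t\<in>{0..1} \<Longrightarrow> Z t \<in> L" "generates Z \<Theta>"
    using L unfolding is_Lie_algebra_of_def by blast
  have nearN: "\<forall>\<^sub>F x in nhds 0. \<forall>t\<in>{0..1}. time_space (of_real t) x \<in> {z\<in>W. G z \<in> N}"
    by (rule eventually_time_space_in[OF contains_time_axis_preimage[OF W G N(1)]]) (use G0 N(2) in simp)
  have "\<forall>\<^sub>F x in nhds 0. of_real (inverse \<delta>) *s Z 0 x = Y x"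
    using Y nearN \<Phi> family_derivative[OF W G \<Phi>] \<Theta>0[unfolded germ_eq_def] Z(2)[unfolded generates_def]
  proof eventually_elim
    case (elim x)
    let ?z = "time_space (of_real t0) x"
    let ?A = "space_jacobian G ?z"
    have T0: "\<Theta> 0 x = x" using elim(5) by simp
    have comp: "\<Phi> t0 (\<Theta> s x) = G (time_space (of_real (\<tau> s)) x)" if "s \<in> {0..1}" for s
      using elim(2,3) \<tau>[OF that] N(3) by (simp add: \<Theta>_def)
    have "((\<lambda>s. \<Theta> s x) has_vector_derivative Z 0 x) (at 0 within {0..1})"
      using elim(6) T0 by force
    moreover have "(\<Phi> t0 has_derivative (\<lambda>v. ?A *v v)) (at (\<Theta> 0 x) within (\<lambda>s. \<Theta> s x) ` {0..1})"
      using elim(4) t0 T0 by (auto intro: has_derivative_at_withinI)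
    ultimately have "((\<lambda>s. \<Phi> t0 (\<Theta> s x)) has_vector_derivative ?A *v Z 0 x) (at 0 within {0..1})"
      by (drule_tac vector_derivative_diff_chain_within) (simp_all add: o_def)
    then have 1: "((\<lambda>s. G (time_space (of_real (\<tau> s)) x)) has_vector_derivative ?A *v Z 0 x) (at 0 within {0..1})"
      by (rule has_vector_derivative_transform[rotated 2]) (use comp in auto)
    have zW: "time_space (of_real (\<tau> 0)) x \<in> W" using elim(2) t0 by (simp add: \<tau>_def)
    have "(\<tau> has_vector_derivative \<delta>) (at 0 within {0..1})"
      unfolding \<tau>_def by (auto intro!: derivative_eq_intros)
    from vector_diff_chain_within[OF this family_in_time[OF G oW zW]]
    have 2: "((\<lambda>s. G (time_space (of_real (\<tau> s)) x)) has_vector_derivative \<delta> *\<^sub>R velocity G ?z) (at 0 within {0..1})"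
      by (simp add: o_def \<tau>_def)
    have "?A *v Z 0 x = \<delta> *\<^sub>R velocity G ?z"
      by (rule vector_derivative_unique_within_closed_interval[of 0 1 0 "\<lambda>s. G (time_space (of_real (\<tau> s)) x)"])
         (use 1 2 in auto)
    also have "\<dots> = \<delta> *\<^sub>R (?A *v Y x)" using elim(1) by simp
    also have "\<dots> = ?A *v (of_real \<delta> *s Y x)"
      by (simp add: scaleR_eq_scale vector_scalar_commute)
    finally have eq: "?A *v Z 0 x = ?A *v (of_real \<delta> *s Y x)" .
    obtain B where "B ** ?A = mat 1"
      using elim(1) invertible_det_nz invertible_left_inverse by blast
    then have "Z 0 x = of_real \<delta> *s Y x"
      using arg_cong[OF eq, of "\<lambda>v. B *v v"] by (simp add: matrix_vector_mul_assoc)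
    then show ?case using \<delta> by (simp add: vec_eq_iff)
  qed
  moreover have "(\<lambda>x. of_real (inverse \<delta>) *s Z 0 x) \<in> L"
  proof -
    have "smooth_on r UNIV (\<lambda>x::'k^'q. of_real (inverse \<delta>))"
      by (rule smooth_const[OF open_UNIV])
    then have "(\<lambda>x::'k^'q. of_real (inverse \<delta>)) \<in> smooth_germs r"
      unfolding smooth_germs_def by (intro CollectI exI[of _ UNIV]) simp
    moreover have "Z 0 \<in> L" by (rule Z(1)) simp
    ultimately show ?thesis by (rule submodule_scale[OF mod])
  qed
  ultimately show "Y \<in> L"
    by (rule submodule_cong[OF mod, rotated])
qed

text \<open>
  Here $P = D\Phi_t$ and $PY = \partial_t \Phi_t$.  Differentiating the latter in space and exchanging derivatives gives
  $\partial_t P = \sum_m Y_m \partial_m P + P\,DY$, hence $\partial_t J = \sum_m Y_m \partial_m J + J \,\mathrm{tr}\, DY = \mathrm{div}(JY)$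
  for $J = \det P$, while $b \circ \Phi$ is differentiated in time as along $Y$.
\<close>

lemma transported_density_time_derivative:
  fixes G Y :: "'k^('q::finite option) \<Rightarrow> 'k^'q"
  assumes W: "open W" and G: "\<And>j. smooth_on r W (\<lambda>z. G z $ j)" and Ysm: "\<And>j. smooth_on r W (\<lambda>z. Y z $ j)"
    and Y: "\<And>z. z \<in> W \<Longrightarrow> space_jacobian G z *v Y z = velocity G z"
    and b: "open B" "smooth_on r B b" "\<And>z. z \<in> W \<Longrightarrow> G z \<in> B" and z: "z \<in> W"
  shows "partial None (\<lambda>z. b (G z) * det (space_jacobian G z)) z =
    (\<Sum>m\<in>UNIV. partial (Some m) (\<lambda>z. b (G z) * det (space_jacobian G z) * Y z $ m) z)"
proof -
  let ?b = "\<lambda>z. b (G z)" and ?J = "\<lambda>z. det (space_jacobian G z)"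
  let ?P = "space_jacobian G z"
  define DY where "DY = (\<chi> m k. partial (Some k) (\<lambda>z. Y z $ m) z)"
  define M where "M m = (\<chi> j k. partial (Some m) (\<lambda>z. space_jacobian G z $ j $ k) z)" for m
  note Psm = smooth_jacobian[OF G]
  have bsm: "smooth_on r W ?b" by (rule smooth_compose[OF b(2) G W b(1,3)])
  have Jsm: "smooth_on r W ?J" by (rule smooth_det[OF Psm W])
  have vel: "velocity G z $ j = (\<Sum>m\<in>UNIV. space_jacobian G z $ j $ m * Y z $ m)" if "z \<in> W" for z j
    using Y[OF that, symmetric] by (simp add: matrix_vector_mult_def)
  have pb: "partial i ?b z = (\<Sum>l\<in>UNIV. partial l b (G z) * partial i (\<lambda>z. G z $ l) z)" for i
    by (rule partial_compose[OF b(2) G W b(1) z b(3)[OF z]])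
  have b0: "partial None ?b z = (\<Sum>m\<in>UNIV. Y z $ m * partial (Some m) ?b z)"
  proof -
    have "partial None ?b z = (\<Sum>l\<in>UNIV. partial l b (G z) * (\<Sum>m\<in>UNIV. ?P $ l $ m * Y z $ m))"
      using vel[OF z] by (simp add: pb velocity_def)
    also have "\<dots> = (\<Sum>l\<in>UNIV. \<Sum>m\<in>UNIV. Y z $ m * (partial l b (G z) * ?P $ l $ m))"
      by (simp add: sum_distrib_left mult_ac)
    also have "\<dots> = (\<Sum>m\<in>UNIV. \<Sum>l\<in>UNIV. Y z $ m * (partial l b (G z) * ?P $ l $ m))"
      by (rule sum.swap)
    finally show ?thesis by (simp add: pb space_jacobian_def sum_distrib_left)
  qed
  have second: "partial (Some k) (\<lambda>z. space_jacobian G z $ j $ m) z = M m $ j $ k" for j k m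
    unfolding M_def space_jacobian_def by (simp add: partial_commute[OF G W z, of "Some k" "Some m"])
  have mixed: "partial None (\<lambda>z. space_jacobian G z $ j $ k) z = (\<Sum>m\<in>UNIV. Y z $ m * M m $ j $ k) + (?P ** DY) $ j $ k" for j k
  proof -
    have "partial None (\<lambda>z. space_jacobian G z $ j $ k) z = partial (Some k) (\<lambda>z. velocity G z $ j) z"
      unfolding space_jacobian_def velocity_def by (simp add: partial_commute[OF G W z, of None "Some k"])
    also have "\<dots> = partial (Some k) (\<lambda>z. \<Sum>m\<in>UNIV. space_jacobian G z $ j $ m * Y z $ m) z"
      by (rule partial_cong[OF W z vel])
    also have "\<dots> = (\<Sum>m\<in>UNIV. partial (Some k) (\<lambda>z. space_jacobian G z $ j $ m * Y z $ m) z)"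
      by (rule partial_sum[OF smooth_mult[OF Psm Ysm W] W z])
    also have "\<dots> = (\<Sum>m\<in>UNIV. partial (Some k) (\<lambda>z. space_jacobian G z $ j $ m) z * Y z $ m + ?P $ j $ m * partial (Some k) (\<lambda>z. Y z $ m) z)"
      by (intro sum.cong refl partial_mult[OF Psm Ysm W z])
    finally show ?thesis by (simp add: second sum.distrib matrix_matrix_mult_def DY_def mult.commute)
  qed
  have J0: "partial None ?J z = (\<Sum>m\<in>UNIV. Y z $ m * partial (Some m) ?J z) + trace DY * ?J z"
  proof -
    have "(\<chi> j k. partial None (\<lambda>z. space_jacobian G z $ j $ k) z) = (\<chi> j. \<Sum>m\<in>UNIV. Y z $ m *s M m $ j) + ?P ** DY"
      by (simp add: vec_eq_iff mixed)
    moreover have "partial (Some m) ?J z = det_variation ?P (M m)" for m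
      unfolding M_def by (rule partial_det[OF Psm W z])
    ultimately show ?thesis
      by (simp add: partial_det[OF Psm W z] det_variation_add det_variation_sum det_variation_mult_right)
  qed
  have "partial None (\<lambda>z. ?b z * ?J z) z = partial None ?b z * ?J z + ?b z * partial None ?J z"
    by (rule partial_mult[OF bsm Jsm W z])
  also have "\<dots> = (\<Sum>m\<in>UNIV. (partial (Some m) ?b z * ?J z + ?b z * partial (Some m) ?J z) * Y z $ m
      + ?b z * ?J z * partial (Some m) (\<lambda>z. Y z $ m) z)"
    unfolding b0 J0 by (simp add: trace_def DY_def sum_distrib_left sum_distrib_right sum.distrib algebra_simps)
  also have "\<dots> = (\<Sum>m\<in>UNIV. partial (Some m) (\<lambda>z. ?b z * ?J z * Y z $ m) z)"
    by (intro sum.cong refl)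
       (simp add: partial_mult[OF smooth_mult[OF bsm Jsm W] Ysm W z] partial_mult[OF bsm Jsm W z])
  finally show ?thesis .
qed

text \<open>
  Differentiating $\partial_t \Phi_t = Z_t \circ \Phi_t$ in space gives $\partial_t P = (DZ_t \circ \Phi_t) P$ for $P = D\Phi_t$.
  The flow equation enters on a whole neighbourhood in one time slice, where it may be differentiated in space.
\<close>

lemma liouville_formula:
  fixes G Z :: "'k^('q::finite option) \<Rightarrow> 'k^'q"
  assumes W: "open W" and G: "\<And>j. smooth_on r W (\<lambda>z. G z $ j)" and V: "open V" and Z: "\<And>j. smooth_on r V (\<lambda>z. Z z $ j)"
    and N: "open N" "x \<in> N"
    and mem: "\<And>y. y \<in> N \<Longrightarrow> time_space t y \<in> W" "\<And>y. y \<in> N \<Longrightarrow> time_space t (G (time_space t y)) \<in> V"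
    and vel: "\<And>y. y \<in> N \<Longrightarrow> velocity G (time_space t y) = Z (time_space t (G (time_space t y)))"
  shows "partial None (\<lambda>z. det (space_jacobian G z)) (time_space t x) =
    (\<Sum>l\<in>UNIV. partial (Some l) (\<lambda>z. Z z $ l) (time_space t (G (time_space t x)))) * det (space_jacobian G (time_space t x))"
proof -
  let ?z = "time_space t x" and ?\<zeta> = "time_space t (G (time_space t x))"
  have z: "?z \<in> W" and \<zeta>: "?\<zeta> \<in> V" using mem N by auto
  define A where "A = (\<chi> j l. partial (Some l) (\<lambda>z. Z z $ j) ?\<zeta>)"
  note Psm = smooth_jacobian[OF G]
  have "partial None (\<lambda>z. space_jacobian G z $ j $ k) ?z = (A ** space_jacobian G ?z) $ j $ k" for j k
  proof -
    have "partial None (\<lambda>z. space_jacobian G z $ j $ k) ?z = partial (Some k) (\<lambda>z. velocity G z $ j) ?z"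
      unfolding space_jacobian_def velocity_def by (simp add: partial_commute[OF G W z, of None "Some k"])
    also have "\<dots> = partial k (\<lambda>y. velocity G (time_space t y) $ j) x"
      by (rule partial_slice[OF smooth_velocity[OF G] W z, symmetric])
    also have "\<dots> = partial k (\<lambda>y. Z (time_space t (G (time_space t y))) $ j) x"
      by (rule partial_cong[OF N]) (simp add: vel)
    also have "\<dots> = (\<Sum>l\<in>UNIV. partial l (\<lambda>y. Z (time_space t y) $ j) (G ?z) * partial k (\<lambda>y. G (time_space t y) $ l) x)"
      by (rule partial_compose[where f="\<lambda>y. G (time_space t y)", OF smooth_slice[OF Z V] smooth_slice[OF G W] open_slice[OF W] open_slice[OF V]])
         (use z \<zeta> in auto)
    also have "\<dots> = (\<Sum>l\<in>UNIV. A $ j $ l * space_jacobian G ?z $ l $ k)"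
      by (simp add: partial_slice[OF Z V \<zeta>] partial_slice[OF G W z] A_def space_jacobian_def)
    finally show ?thesis by (simp add: matrix_matrix_mult_def)
  qed
  then have "(\<chi> j k. partial None (\<lambda>z. space_jacobian G z $ j $ k) ?z) = A ** space_jacobian G ?z"
    by (simp add: vec_eq_iff)
  then show ?thesis
    by (simp add: partial_det[OF Psm W z] det_variation_mult_left trace_def A_def)
qed

lemma pullback_density:
  fixes G :: "'k^('q::finite option) \<Rightarrow> 'k^'q"
  assumes W: "contains_time_axis W" and G: "\<And>j. smooth_on r W (\<lambda>z. G z $ j)"
    and \<Phi>: "\<forall>\<^sub>F x in nhds 0. \<forall>t\<in>{0..1}. \<Phi> t x = G (time_space (of_real t) x)"
    and G0: "\<And>t. t \<in> {0..1} \<Longrightarrow> G (time_space (of_real t) 0) = 0"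
    and B: "open B" "0 \<in> B" "\<And>y vs. y \<in> B \<Longrightarrow> length vs = CARD('q) \<Longrightarrow> \<Omega> y vs = b y * det (rows_to_matrix vs)"
    and t: "t \<in> {0..1}"
  shows "\<forall>\<^sub>F x in nhds 0. \<forall>vs. length vs = CARD('q) \<longrightarrow>
    pullback (\<Phi> t) \<Omega> x vs = b (G (time_space (of_real t) x)) * det (space_jacobian G (time_space (of_real t) x)) * det (rows_to_matrix vs)"
proof -
  have "\<forall>\<^sub>F x in nhds 0. \<forall>t\<in>{0..1}. time_space (of_real t) x \<in> {z\<in>W. G z \<in> B}"
    by (rule eventually_time_space_in[OF contains_time_axis_preimage[OF W G B(1)]]) (use G0 B(2) in simp)
  with \<Phi> family_derivative[OF W G \<Phi>] show ?thesis
  proof (eventually_elim, intro allI impI)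
    fix x and vs :: "('k^'q) list"
    assume *: "\<forall>t\<in>{0..1}. \<Phi> t x = G (time_space (of_real t) x)"
      "\<forall>t\<in>{0..1}. (\<Phi> t has_derivative (\<lambda>v. space_jacobian G (time_space (of_real t) x) *v v)) (at x)"
      "\<forall>t\<in>{0..1}. time_space (of_real t) x \<in> {z\<in>W. G z \<in> B}" and len: "length vs = CARD('q)"
    let ?A = "space_jacobian G (time_space (of_real t) x)"
    have fd: "frechet_derivative (\<Phi> t) (at x) = (\<lambda>v. ?A *v v)"
      using *(2) t frechet_derivative_at by metis
    have "rows_to_matrix (map (frechet_derivative (\<Phi> t) (at x)) vs) = rows_to_matrix vs ** Finite_Cartesian_Product.transpose ?A"
      by (rule rows_to_matrix_map[OF len]) (simp add: fd)
    then show "pullback (\<Phi> t) \<Omega> x vs = b (G (time_space (of_real t) x)) * det ?A * det (rows_to_matrix vs)"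
      using B(3)[of "G (time_space (of_real t) x)" "map (frechet_derivative (\<Phi> t) (at x)) vs"] * t len
      by (simp add: pullback_def det_mul mult_ac)
  qed
qed

lemma jacobian_of_identity:
  fixes G :: "'k^('q::finite option) \<Rightarrow> 'k^'q"
  assumes W: "contains_time_axis W" and G: "\<And>j. smooth_on r W (\<lambda>z. G z $ j)"
    and \<Phi>: "\<forall>\<^sub>F x in nhds 0. \<forall>t\<in>{0..1}. \<Phi> t x = G (time_space (of_real t) x)" and id: "\<Phi> 0 \<simeq> id"
  shows "\<forall>\<^sub>F x in nhds 0. G (time_space 0 x) = x \<and> det (space_jacobian G (time_space 0 x)) = 1"
proof -
  obtain N where N: "open N" "0 \<in> N" "\<And>x. x \<in> N \<Longrightarrow> \<Phi> 0 x = x"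
    using id unfolding germ_eq_def eventually_nhds by auto
  have "\<forall>\<^sub>F x in nhds 0. x \<in> N" using N by (simp add: eventually_nhds_in_open)
  with \<Phi> family_derivative[OF W G \<Phi>] show ?thesis
  proof eventually_elim
    case (elim x)
    have "(\<Phi> 0 has_derivative (\<lambda>v. space_jacobian G (time_space 0 x) *v v)) (at x)"
      using elim(2)[rule_format, of 0] by simp
    moreover have "((\<lambda>x. x) has_derivative (\<lambda>v. v)) (at x)" by simp
    then have "(\<Phi> 0 has_derivative (\<lambda>v. v)) (at x)"
      by (rule has_derivative_transform_within_open[OF _ N(1) elim(3)]) (simp add: N(3))
    ultimately have "(\<lambda>v. space_jacobian G (time_space 0 x) *v v) = (\<lambda>v. v)"
      by (rule has_derivative_unique)
    then have "space_jacobian G (time_space 0 x) = mat 1"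
      unfolding matrix_eq by (metis matrix_vector_mul_lid)
    moreover have "\<Phi> 0 x = G (time_space 0 x)" using elim(1)[rule_format, of 0] by simp
    ultimately show ?case using N(3)[OF elim(3)] by simp
  qed
qed

text \<open>
  Differentiation under the integral gives the directional derivative along a coordinate line; it is the
  partial derivative, since \<open>q\<close> is known to be differentiable.
\<close>

lemma partial_of_time_integral:
  fixes s :: "'k^('q::finite option) \<Rightarrow> 'k"
  assumes W: "open W" and s: "smooth_on r W s" and U: "open U" "x \<in> U" and q: "smooth_on r U q"
    and mem: "\<And>t y. t \<in> {0..1} \<Longrightarrow> y \<in> U \<Longrightarrow> time_space (of_real t) y \<in> W"
    and eq: "\<And>y. y \<in> U \<Longrightarrow> q y = integral {0..1} (\<lambda>t. s (time_space (of_real t) y))"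
  shows "partial m q x = integral {0..1} (\<lambda>t. partial (Some m) s (time_space (of_real t) x))"
proof -
  define \<gamma> where "\<gamma> u = x + u *\<^sub>R axis m (1::'k)" for u
  obtain \<epsilon> where eps: "\<epsilon> > 0" "ball x \<epsilon> \<subseteq> U" using U open_contains_ball by blast
  define \<delta> where "\<delta> = \<epsilon> / 2"
  have \<delta>: "\<delta> > 0" "\<delta> < \<epsilon>" using eps by (auto simp: \<delta>_def)
  define I where "I = {-\<delta>..\<delta>}"
  have \<gamma>U: "\<gamma> u \<in> U" if "u \<in> I" for u
  proof -
    have "dist x (\<gamma> u) = \<bar>u\<bar>" by (simp add: \<gamma>_def dist_norm norm_axis)
    then have "dist x (\<gamma> u) < \<epsilon>" using that \<delta> by (auto simp: I_def)
    then show ?thesis using eps by auto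
  qed
  have \<gamma>d: "(\<gamma> has_vector_derivative axis m 1) (at u within S)" for u S
    unfolding \<gamma>_def by (auto intro!: derivative_eq_intros)
  have \<gamma>c: "continuous_on S (\<lambda>p. time_space (of_real (snd p)) (\<gamma> (fst p)) :: 'k^('q option))" for S
    unfolding \<gamma>_def by (intro continuous_on_time_space continuous_intros)
  have "((\<lambda>u. integral (cbox 0 1) (\<lambda>t. s (time_space (of_real t) (\<gamma> u)))) has_vector_derivative
      integral (cbox 0 1) (\<lambda>t. partial (Some m) s (time_space (of_real t) (\<gamma> 0)))) (at 0 within I)"
  proof (rule leibniz_rule_vector_derivative)
    show "((\<lambda>u. s (time_space (of_real t) (\<gamma> u))) has_vector_derivative partial (Some m) s (time_space (of_real t) (\<gamma> u))) (at u within I)"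
      if u: "u \<in> I" and t: "t \<in> cbox 0 1" for u t
    proof -
      have z: "time_space (of_real t) (\<gamma> u) \<in> W" using mem \<gamma>U[OF u] t by simp
      have "((\<lambda>u. s (time_space (of_real t) (\<gamma> u))) has_vector_derivative
        (\<Sum>i\<in>UNIV. partial i (\<lambda>y. s (time_space (of_real t) y)) (\<gamma> u) * axis m 1 $ i)) (at u within I)"
        by (rule smooth_along_curve[OF smooth_slice[OF s W] open_slice[OF W] _ \<gamma>d]) (use z in simp)
      then show ?thesis by (simp add: sum_axis_nth partial_slice[OF s W z])
    qed
    show "(\<lambda>t. s (time_space (of_real t) (\<gamma> u))) integrable_on cbox 0 1" if "u \<in> I" for u
      by (intro integrable_continuous continuous_on_compose2[OF smooth_continuous_on[OF s W]] continuous_on_time_space continuous_intros)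
         (use mem \<gamma>U[OF that] in auto)
    show "continuous_on (I \<times> cbox 0 1) (\<lambda>(u, t). partial (Some m) s (time_space (of_real t) (\<gamma> u)))"
      unfolding case_prod_beta
      by (rule continuous_on_compose2[OF smooth_continuous_on[OF smooth_partial[OF s] W] \<gamma>c]) (use mem \<gamma>U in auto)
  qed (use \<delta> in \<open>auto simp: I_def\<close>)
  moreover have \<gamma>0: "\<gamma> 0 = x" by (simp add: \<gamma>_def)
  ultimately have leibniz: "((\<lambda>u. integral {0..1} (\<lambda>t. s (time_space (of_real t) (\<gamma> u)))) has_vector_derivative
      integral {0..1} (\<lambda>t. partial (Some m) s (time_space (of_real t) x))) (at 0 within I)"
    by (simp only: cbox_interval)
  have "((\<lambda>u. q (\<gamma> u)) has_vector_derivative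
      integral {0..1} (\<lambda>t. partial (Some m) s (time_space (of_real t) x))) (at 0 within I)"
    by (rule has_vector_derivative_transform[rotated, OF _ leibniz])
       (rule eq[OF \<gamma>U], assumption, use \<delta> in \<open>simp add: I_def\<close>)
  moreover have "((\<lambda>u. q (\<gamma> u)) has_vector_derivative partial m q x) (at 0 within I)"
    using smooth_along_curve[OF q U(1) _ \<gamma>d, of 0 I] U(2) by (simp add: \<gamma>_def sum_axis_nth)
  ultimately show ?thesis
    unfolding I_def using \<delta>
    by (intro vector_derivative_unique_within_closed_interval[of "-\<delta>" \<delta> 0 "\<lambda>u. q (\<gamma> u)"]) auto
qed

lemma integral_time_derivative:
  fixes s :: "'k^('q::finite option) \<Rightarrow> 'k"
  assumes W: "open W" and s: "smooth_on r W s" and mem: "\<And>t. t \<in> {0..1} \<Longrightarrow> time_space (of_real t) x \<in> W"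
  shows "integral {0..1} (\<lambda>t. partial None s (time_space (of_real t) x)) = s (time_space 1 x) - s (time_space 0 x)"
proof -
  have "((\<lambda>t. partial None s (time_space (of_real t) x)) has_integral
     (s (time_space (of_real 1) x) - s (time_space (of_real 0) x))) {0..1}"
    by (rule fundamental_theorem_of_calculus) (use mem in \<open>auto intro: smooth_in_time[OF s W]\<close>)
  then show ?thesis by (simp add: integral_unique)
qed

lemma subgroup_Diff0:
  assumes "subgroup_of_Diff0 r H" "\<Phi> \<in> H"
  shows "\<Phi> \<in> Diff0 r" and "\<Phi> 0 = 0"
proof -
  show "\<Phi> \<in> Diff0 r" using assms unfolding subgroup_of_Diff0_def by (elim conjE) (rule subsetD)
  then show "\<Phi> 0 = 0" by (simp add: Diff0_def)
qed

lemma family_fixes_origin: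
  fixes G :: "'k^('q::finite option) \<Rightarrow> 'k^'q"
  assumes "subgroup_of_Diff0 r H" "\<And>t. t \<in> {0..1} \<Longrightarrow> \<Phi> t \<in> H"
    "\<forall>\<^sub>F x in nhds 0. \<forall>t\<in>{0..1}. \<Phi> t x = G (time_space (of_real t) x)" "t \<in> {0..1}"
  shows "G (time_space (of_real t) 0) = 0"
  using eventually_nhds_x_imp_x[OF assms(3)] subgroup_Diff0(2)[OF assms(1) assms(2)[OF assms(4)]] assms(4) by force

lemma smooth_germ_slice:
  fixes f :: "'k^('q::finite option) \<Rightarrow> 'k"
  assumes "contains_time_axis W" "smooth_on r W f" "t \<in> {0..1}"
  shows "(\<lambda>x. f (time_space (of_real t) x)) \<in> smooth_germs r"
proof -
  have W: "open W" "time_space (of_real t) 0 \<in> W"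
    using assms by (auto simp: contains_time_axis_def)
  show ?thesis
    unfolding smooth_germs_def using W
    by (intro CollectI exI[of _ "{x. time_space (of_real t) x \<in> W}"] conjI smooth_slice[OF assms(2)] open_slice) auto
qed

section \<open>Isotopy and equivalence\<close>

text \<open>
  The transported density times the field of \<open>logarithmic_derivative_in_Lie_algebra\<close>, divided by the density
  \<open>w\<close> of \<open>\<Omega>\<close>, is a smooth family in \<open>L\<close>.  Its time integral \<open>X\<close> is the required field: the divergence
  of \<open>w X\<close> is the change of the transported density between time $0$, where it is \<open>b\<close>, and time $1$, where it
  is \<open>a\<close>.
\<close>

lemma isotopic_imp_module_equivalent:
  fixes \<Omega>0 \<Omega>1 \<Omega> :: "'k^'q \<Rightarrow> ('k^'q) list \<Rightarrow> 'k"
  assumes H: "subgroup_of_Diff0 r H" and L: "is_Lie_algebra_of r L H" and mod: "submodule_of_vector_fields r L"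
    and closed: "closed_under_integration r L"
    and vol: "volume_form r \<Omega>0" "volume_form r \<Omega>1" "volume_form r \<Omega>" and iso: "isotopic r H \<Omega>0 \<Omega>1"
  shows "module_equivalent \<Omega> L \<Omega>0 \<Omega>1"
proof -
  obtain \<Phi> where \<Phi>: "smooth_family r \<Phi>" "\<And>t. t \<in> {0..1} \<Longrightarrow> \<Phi> t \<in> H" "\<Phi> 0 \<simeq> id"
    "top_form_eq (pullback (\<Phi> 1) \<Omega>1) \<Omega>0"
    using iso unfolding isotopic_def by blast
  obtain W0 G where W0: "contains_time_axis W0" and G: "\<And>j. smooth_on r W0 (\<lambda>z. G z $ j)"
    and \<Phi>G: "\<forall>\<^sub>F x in nhds 0. \<forall>t\<in>{0..1}. \<Phi> t x = G (time_space (of_real t) x)"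
    using smooth_familyE[OF \<Phi>(1)] by blast
  note G0 = family_fixes_origin[OF H \<Phi>(2) \<Phi>G]
  define a b w where "a = form_density \<Omega>0" and "b = form_density \<Omega>1" and "w = form_density \<Omega>"
  obtain Ua where Ua: "open Ua" "0 \<in> Ua" "\<And>x vs. x \<in> Ua \<Longrightarrow> length vs = CARD('q) \<Longrightarrow> \<Omega>0 x vs = a x * det (rows_to_matrix vs)"
    using volume_form_density[OF vol(1)] unfolding a_def by metis
  obtain Ub where Ub: "open Ub" "0 \<in> Ub" "smooth_on r Ub b"
    "\<And>x vs. x \<in> Ub \<Longrightarrow> length vs = CARD('q) \<Longrightarrow> \<Omega>1 x vs = b x * det (rows_to_matrix vs)"
    using volume_form_density[OF vol(2)] unfolding b_def by metis
  obtain Uw where Uw: "open Uw" "0 \<in> Uw" "smooth_on r Uw w" "\<And>x. x \<in> Uw \<Longrightarrow> w x \<noteq> 0"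
    "\<And>x vs. x \<in> Uw \<Longrightarrow> length vs = CARD('q) \<Longrightarrow> \<Omega> x vs = w x * det (rows_to_matrix vs)"
    using volume_form_density[OF vol(3)] unfolding w_def by metis
  define J where "J z = det (space_jacobian G z)" for z
  have oW0: "open W0" using W0 by (simp add: contains_time_axis_def)
  have J0: "smooth_on r W0 J" unfolding J_def by (rule smooth_det[OF smooth_jacobian[OF G] oW0])
  have Jnz: "J (time_space (of_real t) 0) \<noteq> 0" if "t \<in> {0..1}" for t
    unfolding J_def
    by (rule Diff0_jacobian_nonzero[OF subgroup_Diff0(1)[OF H \<Phi>(2)[OF that]]])
       (use eventually_nhds_x_imp_x[OF family_derivative[OF W0 G \<Phi>G]] that in blast)
  define W where "W = {z\<in>W0. G z \<in> Ub} \<inter> {z\<in>W0. J z \<noteq> 0} \<inter> {z. space_part z \<in> Uw}"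
  have W: "contains_time_axis W"
    unfolding W_def
    by (intro contains_time_axis_Int contains_time_axis_preimage[OF W0 G Ub(1)]
        contains_time_axis_nonzero[OF W0 J0 Jnz] contains_time_axis_space Uw) (use G0 Ub(2) in simp_all)
  then have oW: "open W" by (simp add: contains_time_axis_def)
  have WW0: "W \<subseteq> W0" by (auto simp: W_def)
  note GW = smooth_subset[OF G WW0]
  have JW: "smooth_on r W J" by (rule smooth_subset[OF J0 WW0])
  have bW: "smooth_on r W (\<lambda>z. b (G z))"
    by (rule smooth_compose[OF Ub(3) GW oW Ub(1)]) (simp add: W_def)
  have wW: "smooth_on r W (\<lambda>z. w (space_part z))"
    by (rule smooth_subset[OF smooth_space_part(2)[OF Uw(3,1)]]) (auto simp: W_def)
  \<comment> \<open>Cramer's solution of \<open>space_jacobian G z *v Y z = velocity G z\<close>, which is visibly smooth in time and space.\<close>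
  define Y where "Y z = (\<chi> m. det (\<chi> i j. if j = m then velocity G z $ i else space_jacobian G z $ i $ j) * inverse (J z))" for z
  have YW: "smooth_on r W (\<lambda>z. Y z $ m)" for m
  proof -
    have entry: "smooth_on r W (\<lambda>z. (\<chi> i j. if j = m then velocity G z $ i else space_jacobian G z $ i $ j) $ i $ j)" for i j
      using smooth_velocity[OF GW] smooth_jacobian[OF GW] by (cases "j = m") auto
    show ?thesis
      unfolding Y_def by simp (intro smooth_mult smooth_det[OF entry] smooth_inverse JW oW, simp add: W_def)
  qed
  have Yeq: "space_jacobian G z *v Y z = velocity G z" if "z \<in> W" for z
  proof -
    have nz: "det (space_jacobian G z) \<noteq> 0" using that by (simp add: W_def J_def)
    show ?thesis
      unfolding cramer[OF nz] by (simp add: Y_def J_def divide_inverse)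
  qed
  define c where "c z = inverse (w (space_part z)) * (b (G z) * J z)" for z
  have cW: "smooth_on r W c"
    unfolding c_def by (intro smooth_mult smooth_inverse wW bW JW oW) (use Uw(4) in \<open>simp add: W_def\<close>)
  define F where "F t x = c (time_space (of_real t) x) *s Y (time_space (of_real t) x)" for t x
  have cY: "smooth_on r W (\<lambda>z. (c z *s Y z) $ j)" for j
    by simp (intro smooth_mult cW YW oW)
  have "smooth_family r F"
    by (rule smooth_familyI[OF W, where G="\<lambda>z. c z *s Y z"]) (use smooth_subset[OF cY] in \<open>auto simp: F_def\<close>)
  moreover have "F t \<in> L" if t: "t \<in> {0..1}" for t
  proof -
    have "(\<lambda>x. c (time_space (of_real t) x)) \<in> smooth_germs r"
      by (rule smooth_germ_slice[OF W cW t])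
    moreover have "(\<lambda>x. Y (time_space (of_real t) x)) \<in> L"
    proof (rule logarithmic_derivative_in_Lie_algebra[OF H L mod W GW \<Phi>G \<Phi>(2) t])
      show "\<forall>\<^sub>F x in nhds 0. det (space_jacobian G (time_space (of_real t) x)) \<noteq> 0 \<and>
          space_jacobian G (time_space (of_real t) x) *v Y (time_space (of_real t) x) = velocity G (time_space (of_real t) x)"
        using eventually_time_space_in[OF W]
      proof eventually_elim
        case (elim x)
        then have z: "time_space (of_real t) x \<in> W" using t by blast
        then have "det (space_jacobian G (time_space (of_real t) x)) \<noteq> 0" by (simp add: W_def J_def)
        with Yeq[OF z] show ?case by blast
      qed
    qed
    ultimately show ?thesis
      unfolding F_def[abs_def] by (rule submodule_scale[OF mod])
  qed
  ultimately have XL: "(\<lambda>x. integral {0..1} (\<lambda>t. F t x)) \<in> L"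
    using closed unfolding closed_under_integration_def by blast
  define X where "X = (\<lambda>x. integral {0..1} (\<lambda>t. F t x))"
  have "X \<in> vector_fields r" using XL mod unfolding submodule_of_vector_fields_def X_def by blast
  then obtain UX where UX: "open UX" "0 \<in> UX" "\<And>j. smooth_on r UX (\<lambda>x. X x $ j)"
    using smooth_vec_germ unfolding vector_fields_def by blast
  obtain UW where UW: "open UW" "0 \<in> UW" "\<And>t x. t \<in> {0..1} \<Longrightarrow> x \<in> UW \<Longrightarrow> time_space (of_real t) x \<in> W"
    using eventually_time_space_in[OF W] unfolding eventually_nhds by blast
  define U where "U = Ua \<inter> Ub \<inter> Uw \<inter> UX \<inter> UW"
  have U: "open U" "0 \<in> U" using Ua Ub Uw UX UW by (auto simp: U_def)
  have wU: "smooth_on r U w" by (rule smooth_subset[OF Uw(3)]) (auto simp: U_def)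
  have XU: "smooth_on r U (\<lambda>x. X x $ j)" for j by (rule smooth_subset[OF UX(3)]) (auto simp: U_def)
  have wXU: "smooth_on r U (\<lambda>x. w x * X x $ j)" for j by (intro smooth_mult wU XU U)
  define s where "s m z = b (G z) * J z * Y z $ m" for m z
  have sW: "smooth_on r W (s m)" for m
    unfolding s_def[abs_def] by (intro smooth_mult bW JW YW oW)
  have wX: "w y * X y $ m = integral {0..1} (\<lambda>t. s m (time_space (of_real t) y))" if y: "y \<in> U" for y m
  proof -
    have mem: "time_space (of_real t) y \<in> W" if "t \<in> {0..1}" for t using UW(3) y that by (simp add: U_def)
    have wnz: "w y \<noteq> 0" using Uw(4) y by (simp add: U_def)
    have "continuous_on {0..1} (\<lambda>t. c (time_space (of_real t) y) *s Y (time_space (of_real t) y))"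
      by (rule continuous_on_compose2[OF smooth_vec_continuous_on[OF cY oW]])
         (use mem in \<open>auto intro!: continuous_on_time_space continuous_intros\<close>)
    then have int: "(\<lambda>t. F t y) integrable_on {0..1}"
      unfolding F_def by (rule integrable_continuous_real)
    have "bounded_linear (\<lambda>v::'k^'q. w y * v $ m)"
      by (rule bounded_linear_compose[OF bounded_linear_mult_right bounded_linear_vec_nth])
    from integral_linear[OF int this, symmetric]
    have "w y * X y $ m = integral {0..1} (\<lambda>t. w y * F t y $ m)" by (simp only: X_def o_def)
    also have "(\<lambda>t. w y * F t y $ m) = (\<lambda>t. s m (time_space (of_real t) y))"
      using wnz by (simp add: F_def c_def s_def fun_eq_iff mult_ac)
    finally show ?thesis .
  qed
  define f where "f z = b (G z) * J z" for z
  have fW: "smooth_on r W f" unfolding f_def[abs_def] by (intro smooth_mult bW JW oW)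
  have div: "divergence (\<lambda>y. w y *s X y) x = f (time_space 1 x) - f (time_space 0 x)" if x: "x \<in> U" for x
  proof -
    have mem: "time_space (of_real t) y \<in> W" if "t \<in> {0..1}" "y \<in> U" for t y using UW(3) that by (simp add: U_def)
    have "divergence (\<lambda>y. w y *s X y) x = (\<Sum>m\<in>UNIV. partial m (\<lambda>y. w y * X y $ m) x)"
      by (simp add: divergence_def)
    also have "\<dots> = (\<Sum>m\<in>UNIV. integral {0..1} (\<lambda>t. partial (Some m) (s m) (time_space (of_real t) x)))"
      by (intro sum.cong refl partial_of_time_integral[OF oW sW U(1) x wXU mem wX])
    also have "\<dots> = integral {0..1} (\<lambda>t. \<Sum>m\<in>UNIV. partial (Some m) (s m) (time_space (of_real t) x))"
    proof (rule integral_sum[symmetric])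
      show "(\<lambda>t. partial (Some m) (s m) (time_space (of_real t) x)) integrable_on {0..1}" for m
        by (intro integrable_continuous_real continuous_on_compose2[OF smooth_continuous_on[OF smooth_partial[OF sW] oW]]
             continuous_on_time_space continuous_intros) (use mem x in auto)
    qed simp
    also have "\<dots> = integral {0..1} (\<lambda>t. partial None f (time_space (of_real t) x))"
    proof (rule integral_cong)
      fix t :: real assume t: "t \<in> {0..1}"
      show "(\<Sum>m\<in>UNIV. partial (Some m) (s m) (time_space (of_real t) x)) = partial None f (time_space (of_real t) x)"
        unfolding f_def[abs_def] s_def[abs_def] J_def[abs_def]
        by (rule transported_density_time_derivative[OF oW GW YW Yeq Ub(1,3) _ mem[OF t x], symmetric]) (simp_all add: W_def)
    qed
    also have "\<dots> = f (time_space 1 x) - f (time_space 0 x)"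
      by (rule integral_time_derivative[OF oW fW mem[OF _ x]])
    finally show ?thesis .
  qed
  have one: "(1::real) \<in> {0..1}" by simp
  have pb: "\<forall>\<^sub>F x in nhds 0. \<forall>vs. length vs = CARD('q) \<longrightarrow> pullback (\<Phi> 1) \<Omega>1 x vs =
      b (G (time_space (of_real 1) x)) * det (space_jacobian G (time_space (of_real 1) x)) * det (rows_to_matrix vs)"
    by (rule pullback_density[OF W0 G \<Phi>G _ Ub(1,2) _ one]) (use G0 Ub(4) in blast)+
  have "\<forall>\<^sub>F x in nhds 0. x \<in> U" using U by (simp add: eventually_nhds_in_open)
  with jacobian_of_identity[OF W0 G \<Phi>G \<Phi>(3)] pb \<Phi>(4)[unfolded top_form_eq_def]
  have "\<forall>\<^sub>F x in nhds 0. \<forall>vs. length vs = CARD('q) \<longrightarrow>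
     \<Omega>0 x vs - \<Omega>1 x vs = exterior_derivative (X \<rfloor> \<Omega>) x vs"
  proof (eventually_elim, intro allI impI)
    fix x and vs :: "('k^'q) list"
    assume id: "G (time_space 0 x) = x \<and> det (space_jacobian G (time_space 0 x)) = 1"
      and pb: "\<forall>vs. length vs = CARD('q) \<longrightarrow> pullback (\<Phi> 1) \<Omega>1 x vs =
          b (G (time_space (of_real 1) x)) * det (space_jacobian G (time_space (of_real 1) x)) * det (rows_to_matrix vs)"
      and eq: "\<forall>vs. length vs = CARD('q) \<longrightarrow> pullback (\<Phi> 1) \<Omega>1 x vs = \<Omega>0 x vs"
      and x: "x \<in> U" and len: "length vs = CARD('q)"
    have "f (time_space 1 x) = a x"
      using pb[rule_format, of "matrix_to_rows (mat 1)"] eq[rule_format, of "matrix_to_rows (mat 1)"]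
      by (simp add: a_def form_density_def f_def J_def)
    moreover have "f (time_space 0 x) = b x" using id by (simp add: f_def J_def)
    moreover have "exterior_derivative (X \<rfloor> \<Omega>) x vs = divergence (\<lambda>y. w y *s X y) x * det (rows_to_matrix vs)"
      by (rule exterior_derivative_contraction[OF U(1) x wU XU Uw(5) len]) (simp_all add: U_def)
    moreover have "\<Omega>0 x vs = a x * det (rows_to_matrix vs)" "\<Omega>1 x vs = b x * det (rows_to_matrix vs)"
      using Ua(3) Ub(4) x len by (auto simp: U_def)
    ultimately show "\<Omega>0 x vs - \<Omega>1 x vs = exterior_derivative (X \<rfloor> \<Omega>) x vs"
      by (simp add: div[OF x] left_diff_distrib)
  qed
  then show ?thesis
    unfolding module_equivalent_def top_form_eq_def using XL unfolding X_def by blast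
qed

text \<open>
  The path from one density to the other is $h(t) = t + \kappa t(1-t)$, a polynomial in time, so that it is
  smooth in every category; the assumption on \<open>\<kappa>\<close> keeps the interpolated density away from $0$ at the origin,
  hence near it.
\<close>

lemma module_equivalent_imp_isotopic:
  fixes \<Omega>0 \<Omega>1 \<Omega> :: "'k^'q \<Rightarrow> ('k^'q) list \<Rightarrow> 'k"
  assumes H: "subgroup_of_Diff0 r H" and L: "is_Lie_algebra_of r L H" and mod: "submodule_of_vector_fields r L"
    and vol: "volume_form r \<Omega>0" "volume_form r \<Omega>1" "volume_form r \<Omega>"
    and path: "\<And>t. t \<in> {0..1} \<Longrightarrow>
       form_density \<Omega>0 0 + (of_real t + \<kappa> * (of_real t * (1 - of_real t))) * (form_density \<Omega>1 0 - form_density \<Omega>0 0) \<noteq> 0"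
    and equiv: "module_equivalent \<Omega> L \<Omega>0 \<Omega>1"
  shows "isotopic r H \<Omega>0 \<Omega>1"
proof -
  obtain X where XL: "X \<in> L" and ext: "top_form_eq (\<lambda>x vs. \<Omega>0 x vs - \<Omega>1 x vs) (exterior_derivative (X \<rfloor> \<Omega>))"
    using equiv unfolding module_equivalent_def by blast
  define a b w where "a = form_density \<Omega>0" and "b = form_density \<Omega>1" and "w = form_density \<Omega>"
  obtain Ua where Ua: "open Ua" "0 \<in> Ua" "smooth_on r Ua a"
    "\<And>x vs. x \<in> Ua \<Longrightarrow> length vs = CARD('q) \<Longrightarrow> \<Omega>0 x vs = a x * det (rows_to_matrix vs)"
    using volume_form_density[OF vol(1)] unfolding a_def by metis
  obtain Ub where Ub: "open Ub" "0 \<in> Ub" "smooth_on r Ub b"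
    "\<And>x vs. x \<in> Ub \<Longrightarrow> length vs = CARD('q) \<Longrightarrow> \<Omega>1 x vs = b x * det (rows_to_matrix vs)"
    using volume_form_density[OF vol(2)] unfolding b_def by metis
  obtain Uw where Uw: "open Uw" "0 \<in> Uw" "smooth_on r Uw w"
    "\<And>x vs. x \<in> Uw \<Longrightarrow> length vs = CARD('q) \<Longrightarrow> \<Omega> x vs = w x * det (rows_to_matrix vs)"
    using volume_form_density[OF vol(3)] unfolding w_def by metis
  have X0: "X 0 = 0" and "X \<in> vector_fields r"
    using XL L unfolding is_Lie_algebra_of_def by auto
  then obtain UX where UX: "open UX" "0 \<in> UX" "\<And>j. smooth_on r UX (\<lambda>x. X x $ j)"
    using smooth_vec_germ unfolding vector_fields_def by blast
  obtain Ue where Ue: "open Ue" "0 \<in> Ue" "\<And>x vs. x \<in> Ue \<Longrightarrow> length vs = CARD('q) \<Longrightarrow>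
      \<Omega>0 x vs - \<Omega>1 x vs = exterior_derivative (X \<rfloor> \<Omega>) x vs"
    using ext unfolding top_form_eq_def eventually_nhds by blast
  define U where "U = Ua \<inter> Ub \<inter> Uw \<inter> UX \<inter> Ue"
  have U: "open U" "0 \<in> U" using Ua Ub Uw UX Ue by (auto simp: U_def)
  have aU: "smooth_on r U a" by (rule smooth_subset[OF Ua(3)]) (auto simp: U_def)
  have bU: "smooth_on r U b" by (rule smooth_subset[OF Ub(3)]) (auto simp: U_def)
  have wU: "smooth_on r U w" by (rule smooth_subset[OF Uw(3)]) (auto simp: U_def)
  have XU: "smooth_on r U (\<lambda>x. X x $ j)" for j by (rule smooth_subset[OF UX(3)]) (auto simp: U_def)
  have div: "divergence (\<lambda>y. w y *s X y) x = a x - b x" if x: "x \<in> U" for x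
  proof -
    have "exterior_derivative (X \<rfloor> \<Omega>) x (matrix_to_rows (mat 1)) = divergence (\<lambda>y. w y *s X y) x * det (rows_to_matrix (matrix_to_rows (mat 1)) :: 'k^'q^'q)"
      by (rule exterior_derivative_contraction[OF U(1) x wU XU Uw(4)]) (simp_all add: U_def)
    then show ?thesis using Ue(3)[of x "matrix_to_rows (mat 1)"] x by (simp add: U_def a_def b_def form_density_def)
  qed
  define h h' where "h \<tau> = \<tau> + \<kappa> * (\<tau> * (1 - \<tau>))" and "h' \<tau> = 1 + \<kappa> * (1 - 2 * \<tau>)" for \<tau> :: 'k
  have interpolation: "partial None (\<lambda>z::'k^('q option). h (z $ None)) z = h' (z $ None)"
    "partial (Some l) (\<lambda>z::'k^('q option). h' (z $ None)) z = 0" for z l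
  proof -
    have "(h has_derivative (\<lambda>v. h' \<tau> * v)) (at \<tau>)" for \<tau>
      unfolding h_def h'_def by (auto intro!: derivative_eq_intros simp: algebra_simps)
    from diff_chain_at[OF bounded_linear_imp_has_derivative[OF bounded_linear_vec_nth] this]
    have "((\<lambda>z::'k^('q option). h (z $ None)) has_derivative (\<lambda>v. h' (z $ None) * v $ None)) (at z)" by (simp add: o_def)
    from partialI[OF this, of "None"] show "partial None (\<lambda>z::'k^('q option). h (z $ None)) z = h' (z $ None)"
      by (simp add: axis_def)
    have "(h' has_derivative (\<lambda>v. - 2 * \<kappa> * v)) (at \<tau>)" for \<tau>
      unfolding h'_def by (auto intro!: derivative_eq_intros simp: algebra_simps)
    from diff_chain_at[OF bounded_linear_imp_has_derivative[OF bounded_linear_vec_nth] this]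
    have "((\<lambda>z::'k^('q option). h' (z $ None)) has_derivative (\<lambda>v. - 2 * \<kappa> * v $ None)) (at z)" by (simp add: o_def)
    from partialI[OF this, of "Some l"] show "partial (Some l) (\<lambda>z::'k^('q option). h' (z $ None)) z = 0"
      by (simp add: axis_def)
  qed
  define f where "f z = a (space_part z) + h (z $ None) * (b (space_part z) - a (space_part z))" for z :: "'k^('q option)"
  define V0 where "V0 = {z :: 'k^('q option). space_part z \<in> U}"
  have V0: "contains_time_axis V0" unfolding V0_def by (rule contains_time_axis_space[OF U])
  then have oV0: "open V0" by (simp add: contains_time_axis_def)
  have onV0: "smooth_on r V0 (\<lambda>z. g (space_part z))" if "smooth_on r U g" for g
    unfolding V0_def by (rule smooth_space_part(2)[OF that U(1)])
  have hs: "smooth_on r V0 (\<lambda>z. h (z $ None))"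
    unfolding h_def by (intro smooth_add smooth_mult smooth_diff smooth_const smooth_coord oV0)
  have h's: "smooth_on r V0 (\<lambda>z. h' (z $ None))"
    unfolding h'_def by (intro smooth_add smooth_mult smooth_diff smooth_const smooth_coord oV0)
  have fV0: "smooth_on r V0 f"
    unfolding f_def by (intro smooth_add smooth_mult smooth_diff hs onV0[OF aU] onV0[OF bU] oV0)
  define V where "V = {z\<in>V0. f z \<noteq> 0}"
  have V: "contains_time_axis V"
    unfolding V_def
    by (rule contains_time_axis_nonzero[OF V0 fV0]) (use path in \<open>simp add: f_def h_def a_def b_def\<close>)
  then have oV: "open V" by (simp add: contains_time_axis_def)
  have VV0: "V \<subseteq> V0" by (auto simp: V_def)
  define c where "c z = h' (z $ None) * w (space_part z) * inverse (f z)" for z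
  have cV: "smooth_on r V c"
    unfolding c_def
    by (intro smooth_mult smooth_inverse smooth_subset[OF h's VV0] smooth_subset[OF onV0[OF wU] VV0] smooth_subset[OF fV0 VV0] oV)
       (simp add: V_def)
  \<comment> \<open>Moser's field, chosen so that \<open>f z *s Z z = h' (z $ None) * w *s X\<close>.\<close>
  define Z where "Z z = c z *s X (space_part z)" for z
  have ZV: "smooth_on r V (\<lambda>z. Z z $ j)" for j
    unfolding Z_def by simp (intro smooth_mult cV smooth_subset[OF onV0[OF XU] VV0] oV)
  define Zt where "Zt t x = Z (time_space (of_real t) x)" for t x
  have Zfam: "smooth_family r Zt"
    by (rule smooth_familyI[OF V, where G=Z]) (use smooth_subset[OF ZV] in \<open>auto simp: Zt_def\<close>)
  have ZL: "Zt t \<in> L" if t: "t \<in> {0..1}" for t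
  proof -
    have "(\<lambda>x. c (time_space (of_real t) x)) \<in> smooth_germs r"
      by (rule smooth_germ_slice[OF V cV t])
    from submodule_scale[OF mod this XL] show ?thesis by (simp add: Zt_def[abs_def] Z_def)
  qed
  obtain \<Phi> where \<Phi>: "\<forall>\<^sub>F x in nhds 0. \<Phi> 0 x = x \<and> (\<forall>t\<in>{0..1}.
    ((\<lambda>s. \<Phi> s x) has_vector_derivative Z (time_space (of_real t) (\<Phi> t x))) (at t within {0..1}))"
    by (rule flow_of_vanishing_field[OF V ZV]) (simp_all add: Z_def X0)
  have id: "\<Phi> 0 \<simeq> id" using \<Phi> unfolding germ_eq_def by (auto elim: eventually_mono)
  have "generates Zt \<Phi>" using \<Phi> unfolding generates_def Zt_def by (auto elim: eventually_mono)
  with id Zfam ZL have "\<Phi> \<in> {\<Phi>. \<Phi> 0 \<simeq> id \<and> (\<exists>X. smooth_family r X \<and> (\<forall>t\<in>{0..1}. X t \<in> L) \<and> generates X \<Phi>)}" by blast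
  then have fam: "smooth_family r \<Phi>" and \<Phi>H: "\<And>t. t \<in> {0..1} \<Longrightarrow> \<Phi> t \<in> H"
    using L unfolding is_Lie_algebra_of_def by blast+
  obtain W0 G where W0: "contains_time_axis W0" and G0sm: "\<And>j. smooth_on r W0 (\<lambda>z. G z $ j)"
    and \<Phi>G: "\<forall>\<^sub>F x in nhds 0. \<forall>t\<in>{0..1}. \<Phi> t x = G (time_space (of_real t) x)"
    using smooth_familyE[OF fam] by blast
  have oW0: "open W0" using W0 by (simp add: contains_time_axis_def)
  note G0 = family_fixes_origin[OF H \<Phi>H \<Phi>G]
  define \<sigma> where "\<sigma> z = time_space (z $ None) (G z)" for z
  have \<sigma>sm: "smooth_on r W0 (\<lambda>z. \<sigma> z $ i)" for i
    by (cases i) (auto simp: \<sigma>_def intro: smooth_coord oW0 G0sm)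
  define W where "W = {z\<in>W0. \<sigma> z \<in> V}"
  have W: "contains_time_axis W"
    unfolding W_def
    by (rule contains_time_axis_preimage[OF W0 \<sigma>sm oV]) (use G0 V in \<open>simp add: \<sigma>_def contains_time_axis_def\<close>)
  then have oW: "open W" by (simp add: contains_time_axis_def)
  have WW0: "W \<subseteq> W0" by (auto simp: W_def)
  note G = smooth_subset[OF G0sm WW0] and \<sigma>W = smooth_subset[OF \<sigma>sm WW0]
  define J where "J z = det (space_jacobian G z)" for z
  have JW: "smooth_on r W J" unfolding J_def by (rule smooth_det[OF smooth_jacobian[OF G] oW])
  have fV: "smooth_on r V f" by (rule smooth_subset[OF fV0 VV0])
  have f\<sigma>: "smooth_on r W (\<lambda>z. f (\<sigma> z))"
    by (rule smooth_compose[where f=\<sigma>, OF fV \<sigma>W oW oV]) (simp add: W_def)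
  \<comment> \<open>The interpolated density pulled back by the flow; it will be constant in time.\<close>
  define F where "F z = f (\<sigma> z) * J z" for z
  have FW: "smooth_on r W F" unfolding F_def[abs_def] by (intro smooth_mult f\<sigma> JW oW)
  have "\<forall>\<^sub>F x in nhds 0. (\<forall>t\<in>{0..1}. time_space (of_real t) x \<in> W) \<and>
     (\<forall>t\<in>{0..1}. velocity G (time_space (of_real t) x) = Z (\<sigma> (time_space (of_real t) x)))"
    using eventually_time_space_in[OF W] \<Phi> \<Phi>G
  proof (eventually_elim, intro conjI ballI)
    fix x and t :: real
    assume W: "\<forall>t\<in>{0..1}. time_space (of_real t) x \<in> W" and eqG: "\<forall>t\<in>{0..1}. \<Phi> t x = G (time_space (of_real t) x)"
      and ode: "\<Phi> 0 x = x \<and> (\<forall>t\<in>{0..1}.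
        ((\<lambda>s. \<Phi> s x) has_vector_derivative Z (time_space (of_real t) (\<Phi> t x))) (at t within {0..1}))"
      and t: "t \<in> {0..1}"
    have "((\<lambda>s. \<Phi> s x) has_vector_derivative Z (\<sigma> (time_space (of_real t) x))) (at t within {0..1})"
      using ode eqG t by (simp add: \<sigma>_def)
    moreover have "((\<lambda>s. \<Phi> s x) has_vector_derivative velocity G (time_space (of_real t) x)) (at t within {0..1})"
      by (rule has_vector_derivative_transform[OF t, rotated, OF family_in_time[OF G oW]]) (use W eqG t in auto)
    ultimately show "velocity G (time_space (of_real t) x) = Z (\<sigma> (time_space (of_real t) x))"
      using t by (intro vector_derivative_unique_within_closed_interval[of 0 1 t "\<lambda>s. \<Phi> s x"]) auto
  qed auto
  then obtain N where N: "open N" "0 \<in> N" "\<And>t x. t \<in> {0..1} \<Longrightarrow> x \<in> N \<Longrightarrow> time_space (of_real t) x \<in> W"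
     "\<And>t x. t \<in> {0..1} \<Longrightarrow> x \<in> N \<Longrightarrow> velocity G (time_space (of_real t) x) = Z (\<sigma> (time_space (of_real t) x))"
    unfolding eventually_nhds by blast
  \<comment> \<open>The continuity equation: with \<open>f Z = h' w X\<close> the divergence is \<open>h' (a - b)\<close>, and \<open>h' (b - a)\<close> is the time derivative of \<open>f\<close>.\<close>
  have cont_eq: "partial None f z + (\<Sum>l\<in>UNIV. partial (Some l) f z * Z z $ l + f z * partial (Some l) (\<lambda>z. Z z $ l) z) = 0"
    if z: "z \<in> V" for z
  proof -
    let ?y = "space_part z"
    have yU: "?y \<in> U" and zV0: "z \<in> V0" using z by (auto simp: V_def V0_def)
    have "partial (Some l) f z * Z z $ l + f z * partial (Some l) (\<lambda>z. Z z $ l) z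
        = h' (z $ None) * partial l (\<lambda>y. w y * X y $ l) ?y" for l
    proof -
      have wX: "smooth_on r U (\<lambda>y. w y * X y $ l)" by (intro smooth_mult wU XU U)
      have "partial (Some l) f z * Z z $ l + f z * partial (Some l) (\<lambda>z. Z z $ l) z = partial (Some l) (\<lambda>z. f z * Z z $ l) z"
        by (rule partial_mult[OF fV ZV oV z, symmetric])
      also have "\<dots> = partial (Some l) (\<lambda>z. h' (z $ None) * (w (space_part z) * X (space_part z) $ l)) z"
        by (rule partial_cong[OF oV z]) (simp add: Z_def c_def V_def)
      also have "\<dots> = partial (Some l) (\<lambda>z. h' (z $ None)) z * (w ?y * X ?y $ l)
          + h' (z $ None) * partial (Some l) (\<lambda>z. w (space_part z) * X (space_part z) $ l) z"
        by (rule partial_mult[OF h's onV0[OF wX] oV0 zV0])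
      also have "partial (Some l) (\<lambda>z. h' (z $ None)) z = 0" by (rule interpolation(2))
      also have "partial (Some l) (\<lambda>z. w (space_part z) * X (space_part z) $ l) z = partial l (\<lambda>y. w y * X y $ l) ?y"
        by (rule partial_space_part(1)[OF wX U(1) yU])
      finally show ?thesis by simp
    qed
    then have "(\<Sum>l\<in>UNIV. partial (Some l) f z * Z z $ l + f z * partial (Some l) (\<lambda>z. Z z $ l) z)
       = h' (z $ None) * divergence (\<lambda>y. w y *s X y) ?y"
      by (simp add: divergence_def sum_distrib_left)
    also have "\<dots> = h' (z $ None) * (a ?y - b ?y)" by (simp add: div[OF yU])
    finally have 1: "(\<Sum>l\<in>UNIV. partial (Some l) f z * Z z $ l + f z * partial (Some l) (\<lambda>z. Z z $ l) z) = h' (z $ None) * (a ?y - b ?y)" .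
    have ba: "smooth_on r U (\<lambda>y. b y - a y)" by (intro smooth_diff bU aU U)
    have "partial None f z = partial None (\<lambda>z. a (space_part z)) z + partial None (\<lambda>z. h (z $ None) * (b (space_part z) - a (space_part z))) z"
      unfolding f_def by (rule partial_add[OF onV0[OF aU] smooth_mult[OF hs onV0[OF ba] oV0] oV0 zV0])
    also have "partial None (\<lambda>z. h (z $ None) * (b (space_part z) - a (space_part z))) z
       = partial None (\<lambda>z. h (z $ None)) z * (b ?y - a ?y) + h (z $ None) * partial None (\<lambda>z. b (space_part z) - a (space_part z)) z"
      by (rule partial_mult[OF hs onV0[OF ba] oV0 zV0])
    also have "partial None (\<lambda>z. a (space_part z)) z = 0" by (rule partial_space_part(2)[OF aU U(1) yU])
    also have "partial None (\<lambda>z. b (space_part z) - a (space_part z)) z = 0" by (rule partial_space_part(2)[OF ba U(1) yU])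
    also have "partial None (\<lambda>z. h (z $ None)) z = h' (z $ None)" by (rule interpolation(1))
    finally have 2: "partial None f z = h' (z $ None) * (b ?y - a ?y)" by simp
    show ?thesis unfolding 1 2 by (simp add: algebra_simps)
  qed
  have F0: "partial None F (time_space (of_real t) x) = 0" if t: "t \<in> {0..1}" and x: "x \<in> N" for t x
  proof -
    let ?z = "time_space (of_real t) x" and ?\<zeta> = "\<sigma> (time_space (of_real t) x)"
    have z: "?z \<in> W" by (rule N(3)[OF t x])
    then have \<zeta>: "?\<zeta> \<in> V" by (simp add: W_def)
    have \<sigma>t: "\<sigma> (time_space (of_real t) y) = time_space (of_real t) (G (time_space (of_real t) y))" for y
      by (simp add: \<sigma>_def)
    have "partial None (\<lambda>z. f (\<sigma> z)) ?z = (\<Sum>i\<in>UNIV. partial i f ?\<zeta> * partial None (\<lambda>z. \<sigma> z $ i) ?z)"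
      by (rule partial_compose[OF fV \<sigma>W oW oV z \<zeta>])
    also have "\<dots> = partial None f ?\<zeta> + (\<Sum>l\<in>UNIV. partial (Some l) f ?\<zeta> * velocity G ?z $ l)"
      by (simp add: sum_option \<sigma>_def partial_coord velocity_def)
    finally have 1: "partial None (\<lambda>z. f (\<sigma> z)) ?z = partial None f ?\<zeta> + (\<Sum>l\<in>UNIV. partial (Some l) f ?\<zeta> * Z ?\<zeta> $ l)"
      by (simp add: N(4)[OF t x])
    have 2: "partial None J ?z = (\<Sum>l\<in>UNIV. partial (Some l) (\<lambda>z. Z z $ l) ?\<zeta>) * J ?z"
      unfolding J_def[abs_def] \<sigma>t
    proof (rule liouville_formula[OF oW G oV ZV N(1) x])
      fix y assume y: "y \<in> N"
      show "time_space (of_real t) y \<in> W" by (rule N(3)[OF t y])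
      then show "time_space (of_real t) (G (time_space (of_real t) y)) \<in> V" by (simp add: W_def \<sigma>t)
      show "velocity G (time_space (of_real t) y) = Z (time_space (of_real t) (G (time_space (of_real t) y)))"
        using N(4)[OF t y] by (simp add: \<sigma>t)
    qed
    have "partial None F ?z = partial None (\<lambda>z. f (\<sigma> z)) ?z * J ?z + f ?\<zeta> * partial None J ?z"
      unfolding F_def[abs_def] by (rule partial_mult[OF f\<sigma> JW oW z])
    also have "\<dots> = (partial None f ?\<zeta> + (\<Sum>l\<in>UNIV. partial (Some l) f ?\<zeta> * Z ?\<zeta> $ l + f ?\<zeta> * partial (Some l) (\<lambda>z. Z z $ l) ?\<zeta>)) * J ?z"
      unfolding 1 2 by (simp add: sum.distrib sum_distrib_left algebra_simps)
    finally show ?thesis by (simp add: cont_eq[OF \<zeta>])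
  qed
  have Fconst: "F (time_space 1 x) = F (time_space 0 x)" if x: "x \<in> N" for x
  proof -
    have "integral {0..1} (\<lambda>t. partial None F (time_space (of_real t) x)) = integral {0..1} (\<lambda>t::real. 0)"
      by (rule integral_cong) (simp add: F0[OF _ x])
    then show ?thesis using integral_time_derivative[OF oW FW N(3)[OF _ x]] by simp
  qed
  have one: "(1::real) \<in> {0..1}" by simp
  have pb: "\<forall>\<^sub>F x in nhds 0. \<forall>vs. length vs = CARD('q) \<longrightarrow> pullback (\<Phi> 1) \<Omega>1 x vs =
      b (G (time_space (of_real 1) x)) * det (space_jacobian G (time_space (of_real 1) x)) * det (rows_to_matrix vs)"
    by (rule pullback_density[OF W0 G0sm \<Phi>G _ Ub(1,2) _ one]) (use G0 Ub(4) in blast)+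
  have "\<forall>\<^sub>F x in nhds 0. x \<in> N \<inter> U" using N U by (intro eventually_nhds_in_open) auto
  with jacobian_of_identity[OF W0 G0sm \<Phi>G id] pb
  have "\<forall>\<^sub>F x in nhds 0. \<forall>vs. length vs = CARD('q) \<longrightarrow> pullback (\<Phi> 1) \<Omega>1 x vs = \<Omega>0 x vs"
  proof (eventually_elim, intro allI impI)
    fix x and vs :: "('k^'q) list"
    assume id: "G (time_space 0 x) = x \<and> det (space_jacobian G (time_space 0 x)) = 1"
      and pb: "\<forall>vs. length vs = CARD('q) \<longrightarrow> pullback (\<Phi> 1) \<Omega>1 x vs =
          b (G (time_space (of_real 1) x)) * det (space_jacobian G (time_space (of_real 1) x)) * det (rows_to_matrix vs)"
      and x: "x \<in> N \<inter> U" and len: "length vs = CARD('q)"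
    have "F (time_space 1 x) = b (G (time_space 1 x)) * det (space_jacobian G (time_space 1 x))"
      by (simp add: F_def J_def f_def \<sigma>_def h_def)
    moreover have "F (time_space 0 x) = a x" using id by (simp add: F_def J_def f_def \<sigma>_def h_def)
    ultimately show "pullback (\<Phi> 1) \<Omega>1 x vs = \<Omega>0 x vs"
      using pb len Fconst[of x] x Ua(4)[of x vs] by (simp add: U_def)
  qed
  then show ?thesis
    unfolding isotopic_def top_form_eq_def using fam \<Phi>H id by blast
qed

end

text \<open>
  If the segment from \<open>a\<close> to \<open>b\<close> meets $0$ at the real parameter \<open>p\<close>, then the path bent by $\kappa = i$ can
  meet $0$ only where $t + i t (1-t) = p$; this forces $t \in \{0, 1\}$ and $p = t$, so that \<open>a\<close> or \<open>b\<close> would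
  vanish.
\<close>

lemma complex_path_avoiding_zero:
  fixes a b :: complex
  assumes "a \<noteq> 0" "b \<noteq> 0"
  shows "\<exists>\<kappa>. \<forall>t\<in>{0..1}. a + (of_real t + \<kappa> * (of_real t * (1 - of_real t))) * (b - a) \<noteq> 0"
proof (cases "\<exists>t\<in>{0..1}. a + of_real t * (b - a) = 0")
  case False then show ?thesis by (intro exI[of _ 0]) auto
next
  case True
  then obtain p where p: "p \<in> {0..1}" "a + of_real p * (b - a) = 0" by blast
  have ba: "b - a \<noteq> 0" using p(2) assms(1) by auto
  show ?thesis
  proof (intro exI[of _ \<i>] ballI)
    fix t :: real
    define z :: complex where "z = of_real t + \<i> * (of_real t * (1 - of_real t))"
    have "a + z * (b - a) \<noteq> 0"
    proof
      assume "a + z * (b - a) = 0"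
      moreover have "(z - of_real p) * (b - a) = (a + z * (b - a)) - (a + of_real p * (b - a))"
        by (simp add: algebra_simps)
      ultimately have "z = of_real p" using p(2) ba by simp
      then have "t * (1 - t) = 0" "t = p" by (auto simp: z_def complex_eq_iff)
      then have "p = 0 \<or> p = 1" by auto
      then show False using p(2) assms by auto
    qed
    then show "a + (of_real t + \<i> * (of_real t * (1 - of_real t))) * (b - a) \<noteq> 0"
      by (simp add: z_def)
  qed
qed

lemma real_path_avoiding_zero:
  fixes a b :: real
  assumes "0 < a * b" "t \<in> {0..1}"
  shows "a + t * (b - a) \<noteq> 0"
proof
  assume "a + t * (b - a) = 0"
  then have "(1 - t) * a + t * b = 0" by (simp add: algebra_simps)
  then have "a * ((1 - t) * a + t * b) = 0" by simp
  then have "(1 - t) * (a * a) + t * (a * b) = 0" by (simp add: algebra_simps)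
  moreover have "0 < (1 - t) * (a * a) + t * (a * b)"
  proof (cases "t = 1")
    case False
    then have "0 < 1 - t" using assms by auto
    moreover have "0 < a * a" using assms(1) by (auto simp: zero_less_mult_iff)
    ultimately have "0 < (1 - t) * (a * a)" by (rule mult_pos_pos)
    moreover have "0 \<le> t * (a * b)" using assms by simp
    ultimately show ?thesis by linarith
  qed (use assms in simp)
  ultimately show False by simp
qed

lemma density_nonzero:
  assumes "volume_form r \<Omega>" shows "form_density \<Omega> 0 \<noteq> 0"
proof -
  obtain U where "0 \<in> U" "\<And>x. x \<in> U \<Longrightarrow> form_density \<Omega> x \<noteq> 0"
    using volume_form_density[OF assms] by metis
  then show ?thesis by blast
qed

lemma same_orientation_density:
  fixes \<Omega>0 \<Omega>1 :: "real^'q \<Rightarrow> (real^'q) list \<Rightarrow> real"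
  assumes "volume_form r \<Omega>0" "volume_form r \<Omega>1" "same_orientation \<Omega>0 \<Omega>1"
  shows "0 < form_density \<Omega>0 0 * form_density \<Omega>1 0"
proof -
  have "form_density \<Omega>0 0 \<noteq> 0" by (rule density_nonzero[OF assms(1)])
  moreover have "form_density \<Omega>1 0 \<noteq> 0" by (rule density_nonzero[OF assms(2)])
  moreover have "form_density \<Omega>0 0 > 0 \<longleftrightarrow> form_density \<Omega>1 0 > 0"
    using assms(3) unfolding same_orientation_def form_density_def by simp
  ultimately show ?thesis by (auto simp: zero_less_mult_iff not_less)
qed

theorem theorem2p8:
  shows
    "(\<forall>(H :: (complex^'q \<Rightarrow> complex^'q) set) LH \<Omega>0 \<Omega>1 \<Omega>.
        subgroup_of_Diff0 Analytic H \<and> is_Lie_algebra_of Analytic LH H \<and>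
        submodule_of_vector_fields Analytic LH \<and> closed_under_integration Analytic LH \<and>
        volume_form Analytic \<Omega>0 \<and> volume_form Analytic \<Omega>1 \<and> volume_form Analytic \<Omega>
        \<longrightarrow> (module_equivalent \<Omega> LH \<Omega>0 \<Omega>1 \<longleftrightarrow> isotopic Analytic H \<Omega>0 \<Omega>1))
     \<and>
     (\<forall>r. \<forall>(H :: (real^'q \<Rightarrow> real^'q) set) LH \<Omega>0 \<Omega>1 \<Omega>.
        subgroup_of_Diff0 r H \<and> is_Lie_algebra_of r LH H \<and>
        submodule_of_vector_fields r LH \<and> closed_under_integration r LH \<and>
        volume_form r \<Omega>0 \<and> volume_form r \<Omega>1 \<and> volume_form r \<Omega> \<and> same_orientation \<Omega>0 \<Omega>1
        \<longrightarrow> (module_equivalent \<Omega> LH \<Omega>0 \<Omega>1 \<longleftrightarrow> isotopic r H \<Omega>0 \<Omega>1))"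
proof (intro conjI allI impI; elim conjE)
  fix H :: "(complex^'q \<Rightarrow> complex^'q) set" and LH
    and \<Omega>0 \<Omega>1 \<Omega> :: "complex^'q \<Rightarrow> (complex^'q) list \<Rightarrow> complex"
  assume hyps: "subgroup_of_Diff0 Analytic H" "is_Lie_algebra_of Analytic LH H"
    "submodule_of_vector_fields Analytic LH" "closed_under_integration Analytic LH"
    "volume_form Analytic \<Omega>0" "volume_form Analytic \<Omega>1" "volume_form Analytic \<Omega>"
  interpret smooth_category Analytic "TYPE(complex)" by standard simp
  have "form_density \<Omega>0 0 \<noteq> 0" by (rule density_nonzero[OF hyps(5)])
  moreover have "form_density \<Omega>1 0 \<noteq> 0" by (rule density_nonzero[OF hyps(6)])
  ultimately obtain \<kappa> where path: "\<And>t. t \<in> {0..1} \<Longrightarrow>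
      form_density \<Omega>0 0 + (of_real t + \<kappa> * (of_real t * (1 - of_real t))) * (form_density \<Omega>1 0 - form_density \<Omega>0 0) \<noteq> 0"
    using complex_path_avoiding_zero by metis
  show "module_equivalent \<Omega> LH \<Omega>0 \<Omega>1 \<longleftrightarrow> isotopic Analytic H \<Omega>0 \<Omega>1"
    using isotopic_imp_module_equivalent[OF hyps]
      module_equivalent_imp_isotopic[OF hyps(1-3,5-7) path] by blast
next
  fix r and H :: "(real^'q \<Rightarrow> real^'q) set" and LH
    and \<Omega>0 \<Omega>1 \<Omega> :: "real^'q \<Rightarrow> (real^'q) list \<Rightarrow> real"
  assume hyps: "subgroup_of_Diff0 r H" "is_Lie_algebra_of r LH H"
    "submodule_of_vector_fields r LH" "closed_under_integration r LH"
    "volume_form r \<Omega>0" "volume_form r \<Omega>1" "volume_form r \<Omega>" and orient: "same_orientation \<Omega>0 \<Omega>1"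
  interpret smooth_category r "TYPE(real)" by standard simp
  have path: "form_density \<Omega>0 0 + (of_real t + 0 * (of_real t * (1 - of_real t))) * (form_density \<Omega>1 0 - form_density \<Omega>0 0) \<noteq> 0"
    if "t \<in> {0..1}" for t
    using real_path_avoiding_zero[OF same_orientation_density[OF hyps(5,6) orient] that] by simp
  show "module_equivalent \<Omega> LH \<Omega>0 \<Omega>1 \<longleftrightarrow> isotopic r H \<Omega>0 \<Omega>1"
    using isotopic_imp_module_equivalent[OF hyps]
      module_equivalent_imp_isotopic[OF hyps(1-3,5-7) path] by blast
qed

end
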